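(* Let $m,d\in\mathbb{N}$ and let $W$ be an $n$-dimensional vector space over a finite field $\mathbb{F}_q$. Suppose $G\in\{\mathrm{GL}(W),\mathrm{SL}(W),\mathrm{U}(W)\}$. Then there exists a set of homogeneous invariant polynomials $\{f_1,f_2,\dots,f_{(m+d)n}\}\subseteq \mathbb{F}_q[mW\oplus dW^*]^{G}$ such that $$\mathbb{F}_q(mW\oplus dW^* )^{G}=\mathbb{F}_q(f_1,f_2,\dots,f_{(m+d)n}).$$ In particular, $\mathbb{F}_q[mW\oplus dW^*]^{G}$ is a localized polynomial ring, i.e., there exists an element $f\in\mathbb{F}_q[mW\oplus dW^*]^{G}$ such that $$\mathbb{F}_q[mW\oplus dW^*]^{G}[f^{-1}]=\mathbb{F}_q[f_1,f_2,\dots,f_{(m+d)n}][f^{-1}].$$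
   Context: $\mathbb{F}_q$ is a finite field of order $q$ and characteristic $p>0$. $\mathrm{U}(W)$ denotes a Sylow $p$-subgroup of $\mathrm{GL}(W)$ (equivalently, of any group between $\mathrm{SL}(W)$ and $\mathrm{GL}(W)$). $W^*$ is the dual space of $W$ with the dual (contragredient) action, and $mW\oplus dW^*$ is the direct sum of $m$ copies of $W$ and $d$ copies of $W^*$, on which $G$ acts diagonally. $\mathbb{F}_q[mW\oplus dW^*]$ is the ring of polynomial functions on $mW\oplus dW^*$ (a polynomial ring in $(m+d)n$ variables) and $\mathbb{F}_q(mW\oplus dW^* )$ is its field of fractions; the superscript $G$ denotes $G$-fixed elements. For a (necessarily nonzero) $f$ as in the claim, the rings obtained by adjoining $f^{-1}$ are regarded as subrings of $\mathbb{F}_q(mW\oplus dW^* )$, and the displayed equality is an equality of such subrings. *)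

theory Defs
  imports
    "HOL-Library.Poly_Mapping"
    "HOL-Library.Product_Lexorder"
    "HOL-Computational_Algebra.Fraction_Field"
    "HOL-Computational_Algebra.Polynomial_Factorial"
    "HOL-Algebra.Coset"
    "Jordan_Normal_Form.Determinant"
begin

section \<open>The groups\<close>

definition ordered_basis ::
    "('k::field \<Rightarrow> 'w::ab_group_add \<Rightarrow> 'w) \<Rightarrow> nat \<Rightarrow> (nat \<Rightarrow> 'w) \<Rightarrow> bool" where
  "ordered_basis scale n b \<longleftrightarrow>
     inj_on b {..<n} \<and>
     \<not> module.dependent scale (b ` {..<n}) \<and>
     module.span scale (b ` {..<n}) = UNIV"

text \<open>The coordinate functionals; they form the basis of the dual space that is dual to \<^term>\<open>b\<close>.\<close>

definition coord ::
    "('k::field \<Rightarrow> 'w::ab_group_add \<Rightarrow> 'w) \<Rightarrow> nat \<Rightarrow> (nat \<Rightarrow> 'w) \<Rightarrow> nat \<Rightarrow> 'w \<Rightarrow> 'k" where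
  "coord scale n b i w = module.representation scale (b ` {..<n}) w (b i)"

definition GL :: "('k::field \<Rightarrow> 'w::ab_group_add \<Rightarrow> 'w) \<Rightarrow> ('w \<Rightarrow> 'w) monoid" where
  "GL scale = \<lparr>carrier = {g. Vector_Spaces.linear scale scale g \<and> bij g},
               monoid.mult = (\<circ>), one = id\<rparr>"

definition SL ::
    "('k::field \<Rightarrow> 'w::ab_group_add \<Rightarrow> 'w) \<Rightarrow> nat \<Rightarrow> (nat \<Rightarrow> 'w) \<Rightarrow> ('w \<Rightarrow> 'w) set" where
  "SL scale n b =
     {g \<in> carrier (GL scale). det (mat n n (\<lambda>(i, j). coord scale n b i (g (b j)))) = 1}"

definition sylow_subgroup :: "nat \<Rightarrow> ('g, 'x) monoid_scheme \<Rightarrow> 'g set \<Rightarrow> bool" where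
  "sylow_subgroup p \<Gamma> H \<longleftrightarrow> subgroup H \<Gamma> \<and> card H = p ^ multiplicity p (Coset.order \<Gamma>)"

section \<open>Polynomials and the action\<close>

text \<open>The variable \<^term>\<open>(k, i) :: nat \<times> nat\<close> with \<^term>\<open>i < n\<close> is the \<^term>\<open>i\<close>-th coordinate function
  (with respect to \<^term>\<open>b\<close>) on the \<^term>\<open>k\<close>-th copy of \<open>W\<close> if \<^term>\<open>k < m\<close>, and the \<^term>\<open>i\<close>-th coordinate function
  (with respect to the dual basis, that is, evaluation at \<^term>\<open>b i\<close>) on the \<open>(k - m)\<close>-th copy of the
  dual of \<open>W\<close> if \<open>m \<le> k < m + d\<close>. The other variables do not occur in \<open>poly_ring\<close> below.\<close>

type_synonym 'k mpoly = "(nat \<times> nat \<Rightarrow>\<^sub>0 nat) \<Rightarrow>\<^sub>0 'k"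

definition Const :: "'k::field \<Rightarrow> 'k mpoly" where
  "Const c = Poly_Mapping.single 0 c"

definition Var :: "nat \<times> nat \<Rightarrow> 'k::field mpoly" where
  "Var v = Poly_Mapping.single (Poly_Mapping.single v 1) 1"

definition poly_ring :: "nat \<Rightarrow> nat \<Rightarrow> nat \<Rightarrow> 'k::field mpoly set" where
  "poly_ring n m d = {p. \<forall>t \<in> Poly_Mapping.keys p. Poly_Mapping.keys t \<subseteq> {..<m + d} \<times> {..<n}}"

definition homogeneous :: "'k::field mpoly \<Rightarrow> bool" where
  "homogeneous p \<longleftrightarrow>
     (\<exists>e. \<forall>t \<in> Poly_Mapping.keys p. (\<Sum>v \<in> Poly_Mapping.keys t. Poly_Mapping.lookup t v) = e)"

definition poly_subst :: "(nat \<times> nat \<Rightarrow> 'k::field mpoly) \<Rightarrow> 'k mpoly \<Rightarrow> 'k mpoly" where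
  "poly_subst \<sigma> p =
     (\<Sum>t \<in> Poly_Mapping.keys p. Const (Poly_Mapping.lookup p t) *
        (\<Prod>v \<in> Poly_Mapping.keys t. \<sigma> v ^ Poly_Mapping.lookup t v))"

text \<open>The contragredient action on linear functionals.\<close>

definition dual_act :: "('w \<Rightarrow> 'w) \<Rightarrow> ('w \<Rightarrow> 'k) \<Rightarrow> 'w \<Rightarrow> 'k" where
  "dual_act g \<phi> = \<phi> \<circ> inv_into UNIV g"

text \<open>The group acts on polynomial functions by \<open>(g \<cdot> f)(v) = f(g\<^sup>-\<^sup>1 v)\<close>. So a coordinate function
  \<open>x\<close> on a copy of \<open>W\<close> or its dual is sent to the linear form whose coefficient at the \<open>j\<close>-th
  coordinate is the value of \<open>x\<close> at \<open>g\<^sup>-\<^sup>1\<close> applied to the \<open>j\<close>-th basis vector (see \<open>ev_act\<close>).\<close>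

definition var_act ::
    "('k::field \<Rightarrow> 'w::ab_group_add \<Rightarrow> 'w) \<Rightarrow> nat \<Rightarrow> (nat \<Rightarrow> 'w) \<Rightarrow> nat \<Rightarrow> nat \<Rightarrow>
     ('w \<Rightarrow> 'w) \<Rightarrow> nat \<times> nat \<Rightarrow> 'k mpoly" where
  "var_act scale n b m d g = (\<lambda>(k, i).
     if i < n \<and> k < m then
       (\<Sum>j<n. Const (coord scale n b i (inv_into UNIV g (b j))) * Var (k, j))
     else if i < n \<and> k < m + d then
       (\<Sum>j<n. Const (dual_act (inv_into UNIV g) (coord scale n b j) (b i)) * Var (k, j))
     else Var (k, i))"

definition poly_act ::
    "('k::field \<Rightarrow> 'w::ab_group_add \<Rightarrow> 'w) \<Rightarrow> nat \<Rightarrow> (nat \<Rightarrow> 'w) \<Rightarrow> nat \<Rightarrow> nat \<Rightarrow>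
     ('w \<Rightarrow> 'w) \<Rightarrow> 'k mpoly \<Rightarrow> 'k mpoly" where
  "poly_act scale n b m d g = poly_subst (var_act scale n b m d g)"

definition poly_invariants ::
    "('k::field \<Rightarrow> 'w::ab_group_add \<Rightarrow> 'w) \<Rightarrow> nat \<Rightarrow> (nat \<Rightarrow> 'w) \<Rightarrow> nat \<Rightarrow> nat \<Rightarrow>
     ('w \<Rightarrow> 'w) set \<Rightarrow> 'k mpoly set" where
  "poly_invariants scale n b m d G =
     {p \<in> poly_ring n m d. \<forall>g\<in>G. poly_act scale n b m d g p = p}"

section \<open>Rational functions\<close>

definition rat_field :: "nat \<Rightarrow> nat \<Rightarrow> nat \<Rightarrow> 'k::field mpoly fract set" where
  "rat_field n m d = {Fract p q | p q. p \<in> poly_ring n m d \<and> q \<in> poly_ring n m d \<and> q \<noteq> 0}"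

text \<open>The extension of an injective ring endomorphism to fractions; see
  \<open>fract_ext_Fract\<close> and \<open>rat_act_Fract\<close>.\<close>

definition fract_ext :: "('r::idom \<Rightarrow> 'r) \<Rightarrow> 'r fract \<Rightarrow> 'r fract" where
  "fract_ext h z = (SOME w. \<exists>p q. q \<noteq> 0 \<and> z = Fract p q \<and> w = Fract (h p) (h q))"

definition rat_act ::
    "('k::field \<Rightarrow> 'w::ab_group_add \<Rightarrow> 'w) \<Rightarrow> nat \<Rightarrow> (nat \<Rightarrow> 'w) \<Rightarrow> nat \<Rightarrow> nat \<Rightarrow>
     ('w \<Rightarrow> 'w) \<Rightarrow> 'k mpoly fract \<Rightarrow> 'k mpoly fract" where
  "rat_act scale n b m d g = fract_ext (poly_act scale n b m d g)"

definition rat_invariants ::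
    "('k::field \<Rightarrow> 'w::ab_group_add \<Rightarrow> 'w) \<Rightarrow> nat \<Rightarrow> (nat \<Rightarrow> 'w) \<Rightarrow> nat \<Rightarrow> nat \<Rightarrow>
     ('w \<Rightarrow> 'w) set \<Rightarrow> 'k mpoly fract set" where
  "rat_invariants scale n b m d G =
     {z \<in> rat_field n m d. \<forall>g\<in>G. rat_act scale n b m d g z = z}"

section \<open>Generated subrings and subfields\<close>

definition is_subring :: "'r::comm_ring_1 set \<Rightarrow> bool" where
  "is_subring R \<longleftrightarrow> 1 \<in> R \<and> (\<forall>x\<in>R. \<forall>y\<in>R. x - y \<in> R \<and> x * y \<in> R)"

definition is_subfield :: "'r::field set \<Rightarrow> bool" where
  "is_subfield K \<longleftrightarrow> is_subring K \<and> (\<forall>x\<in>K. inverse x \<in> K)"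

definition scalars :: "'k::field mpoly fract set" where
  "scalars = range (\<lambda>c. to_fract (Const c))"

definition generated_algebra :: "'k::field mpoly fract set \<Rightarrow> 'k mpoly fract set" where
  "generated_algebra S = is_subring hull (scalars \<union> S)"

definition generated_field :: "'k::field mpoly fract set \<Rightarrow> 'k mpoly fract set" where
  "generated_field S = is_subfield hull (scalars \<union> S)"

definition adjoin_inverse :: "'r::field set \<Rightarrow> 'r \<Rightarrow> 'r set" where
  "adjoin_inverse A f = is_subring hull (insert (inverse f) A)"

section \<open>The action on rational functions is well defined\<close>

lemma fract_ext_Fract:
  fixes h :: "'r::idom \<Rightarrow> 'r"
  assumes mult: "\<And>x y. h (x * y) = h x * h y"
    and nz: "\<And>x. x \<noteq> 0 \<Longrightarrow> h x \<noteq> 0"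
    and q: "q \<noteq> 0"
  shows "fract_ext h (Fract p q) = Fract (h p) (h q)"
  unfolding fract_ext_def
proof (rule some_equality)
  show "\<exists>p' q'. q' \<noteq> 0 \<and> Fract p q = Fract p' q' \<and> Fract (h p) (h q) = Fract (h p') (h q')"
    using q by blast
next
  fix w assume "\<exists>p' q'. q' \<noteq> 0 \<and> Fract p q = Fract p' q' \<and> w = Fract (h p') (h q')"
  then obtain p' q' where *: "q' \<noteq> 0" "Fract p q = Fract p' q'" "w = Fract (h p') (h q')"
    by blast
  then have "p * q' = p' * q" using q by (simp add: eq_fract)
  then have "h p * h q' = h p' * h q" by (metis mult)
  then show "w = Fract (h p) (h q)" using * q nz by (simp add: eq_fract)
qed


definition mon_img :: "(nat \<times> nat \<Rightarrow> 'k::field mpoly) \<Rightarrow> (nat \<times> nat \<Rightarrow>\<^sub>0 nat) \<Rightarrow> 'k mpoly" where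
  "mon_img \<sigma> t = (\<Prod>v \<in> Poly_Mapping.keys t. \<sigma> v ^ Poly_Mapping.lookup t v)"

lemma mon_img_superset:
  assumes "finite A" "Poly_Mapping.keys t \<subseteq> A"
  shows "mon_img \<sigma> t = (\<Prod>v \<in> A. \<sigma> v ^ Poly_Mapping.lookup t v)"
  unfolding mon_img_def using assms
  by (intro prod.mono_neutral_left) (auto simp: in_keys_iff)

lemma mon_img_add: "mon_img \<sigma> (s + t) = mon_img \<sigma> s * mon_img \<sigma> t"
proof -
  let ?A = "Poly_Mapping.keys s \<union> Poly_Mapping.keys t"
  have "Poly_Mapping.keys (s + t) \<subseteq> ?A" by (rule Poly_Mapping.keys_add)
  then show ?thesis
    by (simp add: mon_img_superset[of ?A] lookup_add power_add prod.distrib)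
qed

lemma Const_0: "Const 0 = 0" and Const_1: "Const 1 = 1"
  and Const_add: "Const (a + b) = Const a + Const b"
  and Const_mult: "Const (a * b) = Const a * Const b"
  by (simp_all add: Const_def single_add mult_single)

lemma poly_subst_superset:
  assumes "finite A" "Poly_Mapping.keys p \<subseteq> A"
  shows "poly_subst \<sigma> p = (\<Sum>t \<in> A. Const (Poly_Mapping.lookup p t) * mon_img \<sigma> t)"
  unfolding poly_subst_def mon_img_def[symmetric] using assms
  by (intro sum.mono_neutral_left) (auto simp: in_keys_iff Const_0)

lemma poly_subst_add: "poly_subst \<sigma> (p + q) = poly_subst \<sigma> p + poly_subst \<sigma> q"
proof -
  let ?A = "Poly_Mapping.keys p \<union> Poly_Mapping.keys q"
  have "Poly_Mapping.keys (p + q) \<subseteq> ?A" by (rule Poly_Mapping.keys_add)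
  then show ?thesis
    by (simp add: poly_subst_superset[of ?A] lookup_add Const_add distrib_right sum.distrib)
qed

lemma poly_subst_0: "poly_subst \<sigma> 0 = 0" by (simp add: poly_subst_def)

lemma poly_subst_sum: "poly_subst \<sigma> (\<Sum>i\<in>I. f i) = (\<Sum>i\<in>I. poly_subst \<sigma> (f i))"
  by (induction I rule: infinite_finite_induct) (auto simp: poly_subst_0 poly_subst_add)

lemma poly_subst_single: "poly_subst \<sigma> (Poly_Mapping.single t c) = Const c * mon_img \<sigma> t"
  by (subst poly_subst_superset[of "{t}"]) auto

lemma mpoly_induct [case_names zero add]:
  fixes p :: "'k::field mpoly"
  assumes "P 0" and "\<And>p t c. P p \<Longrightarrow> P (p + Poly_Mapping.single t c)"
  shows "P p"
proof (induction p rule: update_induct)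
  case const
  then show ?case by (rule assms(1))
next
  case (update f a b)
  have "Poly_Mapping.update a b f = f + Poly_Mapping.single a b"
    using update(1) by (intro poly_mapping_eqI) (auto simp: lookup_update lookup_add lookup_single in_keys_iff when_def)
  with assms(2) update show ?case by simp
qed

lemma poly_subst_mult: "poly_subst \<sigma> (p * q) = poly_subst \<sigma> p * poly_subst \<sigma> q"
proof (induction p rule: mpoly_induct)
  case zero then show ?case by (simp add: poly_subst_0)
next
  case (add p t c)
  have "poly_subst \<sigma> (Poly_Mapping.single t c * q) = poly_subst \<sigma> (Poly_Mapping.single t c) * poly_subst \<sigma> q"
  proof (induction q rule: mpoly_induct)
    case zero then show ?case by (simp add: poly_subst_0)
  next
    case (add p s e)
    then show ?case
      by (simp add: algebra_simps poly_subst_add mult_single poly_subst_single mon_img_add Const_mult)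
  qed
  with add show ?case by (simp add: algebra_simps poly_subst_add)
qed

lemma poly_subst_Const: "poly_subst \<sigma> (Const c) = Const c"
  unfolding Const_def by (simp add: poly_subst_single mon_img_def) (simp add: Const_def)

lemma poly_subst_Var: "poly_subst \<sigma> (Var v) = \<sigma> v"
  unfolding Var_def by (simp add: poly_subst_single mon_img_def Const_1)

lemma poly_subst_1: "poly_subst \<sigma> 1 = 1"
  using poly_subst_Const[of \<sigma> 1] by (simp add: Const_1)

lemma poly_subst_power: "poly_subst \<sigma> (p ^ e) = poly_subst \<sigma> p ^ e"
  by (induction e) (auto simp: poly_subst_1 poly_subst_mult)

lemma poly_subst_prod: "poly_subst \<sigma> (\<Prod>i\<in>I. f i) = (\<Prod>i\<in>I. poly_subst \<sigma> (f i))"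
  by (induction I rule: infinite_finite_induct) (auto simp: poly_subst_1 poly_subst_mult)

lemma poly_subst_subst: "poly_subst \<tau> (poly_subst \<sigma> p) = poly_subst (\<lambda>v. poly_subst \<tau> (\<sigma> v)) p"
  unfolding poly_subst_def[of \<sigma>] poly_subst_def[of "\<lambda>v. poly_subst \<tau> (\<sigma> v)"]
  by (simp add: poly_subst_sum poly_subst_mult poly_subst_Const poly_subst_prod poly_subst_power)

lemma Var_power: "(Var v :: 'k::field mpoly) ^ e = Poly_Mapping.single (Poly_Mapping.single v e) 1"
  by (induction e) (auto simp: Var_def mult_single single_add[symmetric])

lemma mon_img_Var: "mon_img (Var :: _ \<Rightarrow> 'k::field mpoly) t = Poly_Mapping.single t 1"
proof (induction t rule: update_induct)
  case const
  then show ?case by (simp add: mon_img_def)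
next
  case (update f a b)
  have "Poly_Mapping.update a b f = f + Poly_Mapping.single a b"
    using update(1) by (intro poly_mapping_eqI) (auto simp: lookup_update lookup_add lookup_single in_keys_iff when_def)
  moreover have "mon_img Var (Poly_Mapping.single a b) = (Poly_Mapping.single (Poly_Mapping.single a b) 1 :: 'k mpoly)"
    by (subst mon_img_superset[of "{a}"]) (auto simp: Var_power)
  ultimately show ?case using update by (simp add: mon_img_add mult_single)
qed

lemma poly_subst_Var_id: "poly_subst Var p = p"
  by (induction p rule: mpoly_induct)
     (auto simp: poly_subst_0 poly_subst_add poly_subst_single mon_img_Var Const_def mult_single)

lemma coord_combination:
  assumes V: "vector_space scale" and B: "ordered_basis scale n b" and i: "i < n"
  shows "coord scale n b i (\<Sum>j<n. scale (c j) (b j)) = c i"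
proof -
  interpret vector_space scale by (rule V)
  from B have inj: "inj_on b {..<n}" and ind: "independent (b ` {..<n})" and sp: "span (b ` {..<n}) = UNIV"
    by (auto simp: ordered_basis_def)
  have 1: "coord scale n b i (b j) = (if i = j then 1 else 0)" if "j < n" for j
    unfolding coord_def using that i inj ind
    by (auto simp: representation_basis inj_on_eq_iff)
  have "coord scale n b i (\<Sum>j<n. scale (c j) (b j)) = (\<Sum>j<n. c j * coord scale n b i (b j))"
    unfolding coord_def by (simp add: representation_sum[OF ind] representation_scale[OF ind] sp)
  also have "\<dots> = c i" using i by (simp add: 1 if_distrib cong: if_cong)
  finally show ?thesis .
qed

lemma combination_coord:
  assumes V: "vector_space scale" and B: "ordered_basis scale n b"
  shows "w = (\<Sum>j<n. scale (coord scale n b j w) (b j))"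
proof -
  interpret vector_space scale by (rule V)
  from B have inj: "inj_on b {..<n}" and ind: "independent (b ` {..<n})" and sp: "span (b ` {..<n}) = UNIV"
    by (auto simp: ordered_basis_def)
  have "w = (\<Sum>x\<in>b ` {..<n}. scale (representation (b ` {..<n}) w x) x)"
    using sum_representation_eq[OF ind, of w "b ` {..<n}"] sp by simp
  also have "\<dots> = (\<Sum>j<n. scale (coord scale n b j w) (b j))"
    by (simp add: sum.reindex[OF inj] coord_def)
  finally show ?thesis .
qed

lemma coord_linear_sum:
  assumes V: "vector_space scale" and B: "ordered_basis scale n b" 
    and g: "Vector_Spaces.linear scale scale g" and i: "i < n"
  shows "coord scale n b i (g w) = (\<Sum>j<n. coord scale n b j w * coord scale n b i (g (b j)))"
proof -
  interpret vector_space scale by (rule V)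
  interpret g: Vector_Spaces.linear scale scale g by (rule g)
  from B have inj: "inj_on b {..<n}" and ind: "independent (b ` {..<n})" and sp: "span (b ` {..<n}) = UNIV"
    by (auto simp: ordered_basis_def)
  have "g w = g (\<Sum>j<n. scale (coord scale n b j w) (b j))"
    using combination_coord[OF V B, of w] by simp
  also have "\<dots> = (\<Sum>j<n. scale (coord scale n b j w) (g (b j)))"
    by (simp add: g.sum g.scale)
  finally show ?thesis 
    by (simp add: coord_def representation_sum[OF ind] representation_scale[OF ind] sp)
qed

lemma coord_b:
  assumes "vector_space scale" "ordered_basis scale n b" "i < n" "j < n"
  shows "coord scale n b i (b j) = (if i = j then 1 else 0)"
proof -
  interpret vector_space scale by fact
  show ?thesis
    using coord_combination[OF assms(1-3), of "\<lambda>k. if k = j then 1 else 0"] assms(4)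
    by (simp add: if_distrib[of "\<lambda>c. scale c _"] cong: if_cong)
qed

lemma GL_inv:
  assumes "vector_space scale" "g \<in> carrier (GL scale)"
  shows "inv_into UNIV g \<in> carrier (GL scale)"
proof -
  from assms have l: "Vector_Spaces.linear scale scale g" and b: "bij g" by (auto simp: GL_def)
  interpret vector_space_pair scale scale using assms by (simp add: vector_space_pair_def)
  interpret g: Vector_Spaces.linear scale scale g by (rule l)
  have "Vector_Spaces.linear scale scale (inv_into UNIV g)"
    using b l linear_exists_left_inverse_on
    apply unfold_locales
    apply (metis bij_inv_eq_iff g.add)
    apply (metis bij_inv_eq_iff g.scale)
    done
  then show ?thesis using b by (auto simp: GL_def bij_imp_bij_inv)
qed

lemma Const_sum: "Const (\<Sum>i\<in>I. f i) = (\<Sum>i\<in>I. Const (f i))"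
  by (induction I rule: infinite_finite_induct) (auto simp: Const_0 Const_add)

lemma poly_act_comp:
  fixes scale :: "'k::field \<Rightarrow> 'w::ab_group_add \<Rightarrow> 'w"
  assumes V: "vector_space scale" and B: "ordered_basis scale n b"
    and g: "g \<in> carrier (GL scale)" and h: "h \<in> carrier (GL scale)"
  shows "poly_act scale n b m d g (poly_act scale n b m d h p) = poly_act scale n b m d (g \<circ> h) p"
proof -
  have lin: "Vector_Spaces.linear scale scale g" "Vector_Spaces.linear scale scale h" "bij g" "bij h"
    using g h by (auto simp: GL_def)
  have lini: "Vector_Spaces.linear scale scale (inv_into UNIV g)" "Vector_Spaces.linear scale scale (inv_into UNIV h)"
    using GL_inv[OF V g] GL_inv[OF V h] by (auto simp: GL_def)
  have gh: "inv_into UNIV (g \<circ> h) = inv_into UNIV h \<circ> inv_into UNIV g"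
    using lin by (simp add: o_inv_distrib bij_is_surj bij_is_inj)
  have ii: "inv_into UNIV (inv_into UNIV g) = g" if "bij g" for g :: "'w \<Rightarrow> 'w"
    using that by (simp add: inv_inv_eq)
  have ii2: "inv_into UNIV (inv_into UNIV h \<circ> inv_into UNIV g) = g \<circ> h"
    using lin ii[of "g \<circ> h"] by (simp add: gh bij_comp)
  have "poly_subst (var_act scale n b m d g) (var_act scale n b m d h v) = var_act scale n b m d (g \<circ> h) v" for v
  proof (cases v)
    case (Pair k i)
    have 1: "(\<Sum>j<n. Const (f j) * (\<Sum>l<n. Const (e l j) * Var (k,l))) = (\<Sum>l<n. Const (\<Sum>j<n. f j * e l j) * (Var (k,l) :: 'k mpoly))"
       for e f
      by (simp add: sum_distrib_left sum_distrib_right Const_sum Const_mult mult.assoc) (rule sum.swap)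
    show ?thesis
    proof (cases "i < n \<and> k < m")
      case True
      then show ?thesis unfolding Pair var_act_def using True
        by (simp add: poly_subst_sum poly_subst_mult poly_subst_Const poly_subst_Var gh 1)
           (intro sum.cong refl arg_cong2[of _ _ _ _ "(*)"] arg_cong[of _ _ Const],
            simp add: coord_linear_sum[OF V B lini(2), of i "inv_into UNIV g (b _)"] mult.commute)
    next
      case False
      show ?thesis
      proof (cases "i < n \<and> k < m + d")
        case True
        with False have "\<not> k < m" by simp
        then show ?thesis unfolding Pair var_act_def using True
          by (simp add: poly_subst_sum poly_subst_mult poly_subst_Const poly_subst_Var dual_act_def ii ii2 lin gh 1)
             (intro sum.cong refl arg_cong2[of _ _ _ _ "(*)"] arg_cong[of _ _ Const],
              simp add: coord_linear_sum[OF V B lin(1), of _ "h (b _)"])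
      next
        case 2: False
        then show ?thesis using False unfolding Pair var_act_def by (auto simp: poly_subst_Var)
      qed
    qed
  qed
  then show ?thesis by (simp add: poly_act_def poly_subst_subst)
qed

lemma poly_act_id:
  assumes V: "vector_space scale" and B: "ordered_basis scale n b"
  shows "poly_act scale n b m d id p = p"
proof -
  have "var_act scale n b m d id v = Var v" for v
  proof (cases v)
    case (Pair k i)
    then show ?thesis
      by (auto simp: var_act_def dual_act_def coord_b[OF V B] if_distrib[of Const] Const_0 Const_1 
          if_distrib[of "\<lambda>x. x * _"] cong: if_cong)
  qed
  then have "var_act scale n b m d id = Var" by blast
  then show ?thesis by (simp add: poly_act_def poly_subst_Var_id)
qed

lemma rat_act_Fract:
  assumes V: "vector_space scale" and B: "ordered_basis scale n b"
    and g: "g \<in> carrier (GL scale)" and q: "q \<noteq> 0"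
  shows "rat_act scale n b m d g (Fract p q) =
         Fract (poly_act scale n b m d g p) (poly_act scale n b m d g q)"
  unfolding rat_act_def
proof (rule fract_ext_Fract[OF _ _ q])
  show "poly_act scale n b m d g (x * y) = poly_act scale n b m d g x * poly_act scale n b m d g y" for x y
    by (simp add: poly_act_def poly_subst_mult)
  fix x :: "'a mpoly" assume "x \<noteq> 0"
  have "inv_into UNIV g \<circ> g = id" using g by (simp add: GL_def bij_is_inj)
  then have "poly_act scale n b m d (inv_into UNIV g) (poly_act scale n b m d g x) = x"
    by (simp add: poly_act_comp[OF V B GL_inv[OF V g] g] poly_act_id[OF V B])
  with \<open>x \<noteq> 0\<close> show "poly_act scale n b m d g x \<noteq> 0"
    by (metis poly_act_def poly_subst_0)
qed

section \<open>The action is the action on polynomial functions\<close>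

text \<open>Evaluation at the point of the direct sum with components \<open>u k\<close> in the copies of \<open>W\<close> and
  \<open>\<phi> k\<close> in the copies of its dual.\<close>

definition ev :: "(nat \<times> nat \<Rightarrow> 'k::field) \<Rightarrow> 'k mpoly \<Rightarrow> 'k mpoly" where
  "ev x = poly_subst (\<lambda>v. Const (x v))"

definition pt ::
    "('k::field \<Rightarrow> 'w::ab_group_add \<Rightarrow> 'w) \<Rightarrow> nat \<Rightarrow> (nat \<Rightarrow> 'w) \<Rightarrow> nat \<Rightarrow>
     (nat \<Rightarrow> 'w) \<Rightarrow> (nat \<Rightarrow> 'w \<Rightarrow> 'k) \<Rightarrow> nat \<times> nat \<Rightarrow> 'k" where
  "pt scale n b m u \<phi> = (\<lambda>(k,i). if k < m then coord scale n b i (u k) else \<phi> (k - m) (b i))"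

lemma ev_act:
  fixes \<phi> :: "nat \<Rightarrow> 'w::ab_group_add \<Rightarrow> 'k::field"
  assumes V: "vector_space scale" and B: "ordered_basis scale n b"
    and g: "g \<in> carrier (GL scale)" and p: "p \<in> poly_ring n m d"
    and phi: "\<And>k. Vector_Spaces.linear scale (*) (\<phi> k)"
  shows "ev (pt scale n b m u \<phi>) (poly_act scale n b m d g p) =
         ev (pt scale n b m (\<lambda>k. inv_into UNIV g (u k)) (\<lambda>k. dual_act (inv_into UNIV g) (\<phi> k))) p"
proof -
  have lini: "Vector_Spaces.linear scale scale (inv_into UNIV g)" and bg: "bij g"
    using GL_inv[OF V g] g by (auto simp: GL_def)
  have *: "poly_subst (\<lambda>v. Const (pt scale n b m u \<phi> v)) (var_act scale n b m d g v) =
    Const (pt scale n b m (\<lambda>k. inv_into UNIV g (u k)) (\<lambda>k. dual_act (inv_into UNIV g) (\<phi> k)) v)"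
    if v: "v \<in> {..<m+d} \<times> {..<n}" for v
  proof -
    obtain k i where [simp]: "v = (k,i)" and ki: "k < m + d" "i < n" using v by auto
    show ?thesis
    proof (cases "k < m")
      case True
      then show ?thesis using ki coord_linear_sum[OF V B lini ki(2), of "u k"]
        by (simp add: var_act_def pt_def poly_subst_sum poly_subst_mult poly_subst_Const poly_subst_Var
          Const_mult[symmetric] Const_sum[symmetric] mult.commute)
    next
      case False
      interpret ph: Vector_Spaces.linear scale "(*)" "\<phi> (k - m)" by (rule phi)
      have "\<phi> (k - m) (g (b i)) = \<phi> (k - m) (\<Sum>j<n. scale (coord scale n b j (g (b i))) (b j))"
        using combination_coord[OF V B, of "g (b i)"] by simp
      also have "\<dots> = (\<Sum>j<n. coord scale n b j (g (b i)) * \<phi> (k - m) (b j))"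
        by (simp add: ph.sum ph.scale)
      finally show ?thesis using ki False bg
        by (simp add: var_act_def pt_def poly_subst_sum poly_subst_mult poly_subst_Const poly_subst_Var
          Const_mult[symmetric] Const_sum[symmetric] dual_act_def inv_inv_eq)
    qed
  qed
  have "poly_subst (\<lambda>v. poly_subst (\<lambda>v. Const (pt scale n b m u \<phi> v)) (var_act scale n b m d g v)) p =
    poly_subst (\<lambda>v. Const (pt scale n b m (\<lambda>k. inv_into UNIV g (u k)) (\<lambda>k. dual_act (inv_into UNIV g) (\<phi> k)) v)) p"
    unfolding poly_subst_def[of _ p] using p * unfolding poly_ring_def
    by (intro sum.cong refl arg_cong2[of _ _ _ _ "(*)"] prod.cong arg_cong2[of _ _ _ _ "(^)"]) blast
  then show ?thesis by (simp add: ev_def poly_act_def poly_subst_subst)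
qed

end

theory Submission
  imports Defs "HOL-Library.Cardinality" "HOL-Algebra.Group_Action"
begin

text \<open>
  Let \<open>q\<close> be the number of scalars and let \<open>x\<close> be the vector of the \<open>n\<close> coordinate functions on the first
  copy, which may be a copy of \<open>W\<close> or of its dual. Taking \<open>q\<close>-th powers is linear over the scalars, so
  a group element acts on the Moore matrix \<open>M = (x j ^ (q ^ i))\<close> by multiplication with a scalar matrix
  from the left. Its determinant \<open>L\<close> is nonzero and is multiplied by the determinant of that matrix, so
  \<open>L ^ (q - 1)\<close> is invariant under the general linear group.

  Consider another copy with coordinate vector \<open>w\<close>. If it has the same type as the first one, the solution
  \<open>c\<close> of \<open>w = M c\<close> is invariant; its entries become homogeneous polynomials after multiplication with
  \<open>L ^ (q - 1)\<close>. If it has the opposite type, the entries of the row vector \<open>w\<^sup>T M\<close> are invariant. In both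
  cases the \<open>n\<close> invariants determine \<open>w\<close> by Cramer's rule (\<open>moore_cramer\<close>, \<open>moore_cramer_dual\<close>). So if \<open>A\<close>
  is the algebra generated by these invariants, by \<open>1 / L ^ (q - 1)\<close> and by \<open>n\<close> suitable invariants of the
  first copy, all polynomials lie in \<open>A[x]\<close> (\<open>span_recovers_copy\<close>). It remains to choose the latter
  invariants such that every invariant element of \<open>A[x]\<close> lies in \<open>A\<close>, and such that \<open>L ^ (q - 1)\<close> is a
  rational function of them; then \<open>generators_from_base_copy\<close> gives the result with \<open>L ^ (q - 1)\<close> as the
  inverted element.

  The descent from \<open>A[x]\<close> to \<open>A\<close> is elementary. Let \<open>f = \<phi> x\<close> be invariant, with \<open>\<phi>\<close> a polynomial
  over \<open>A\<close>. Then \<open>\<phi>\<close> has the value \<open>f\<close> on the orbit of \<open>x\<close>. The orbit is contained in a finite grid whose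
  coordinates are the roots of monic polynomials over \<open>A\<close>, and extracting a coefficient of the interpolation
  polynomial on the grid is a linear functional that maps polynomials over \<open>A\<close> to \<open>A\<close>. Applied to \<open>\<phi> H\<close>,
  where \<open>H\<close> is a polynomial over \<open>A\<close> that vanishes on the grid outside the orbit and has a unit as the
  extracted coefficient, it yields \<open>f \<in> A\<close> (\<open>grid_descent\<close>).

  For the general linear group the grid consists of the tuples in the span of \<open>x\<close>, whose elements are the
  roots of an additive polynomial \<open>T ^ (q ^ n) - \<Sum>\<^sub>l c\<^sub>l T ^ (q ^ l)\<close> with \<open>c\<^sub>0 = \<plusminus> L ^ (q - 1)\<close>; the
  invariants are the \<open>c\<^sub>l L ^ (q - 1)\<close> for \<open>l > 0\<close> and \<open>L ^ (q - 1)\<close>, and \<open>H\<close> is the Moore determinant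
  (\<open>GL_descent\<close>). For the special linear group \<open>L\<close> takes the place of \<open>L ^ (q - 1)\<close>, and \<open>H\<close> is a
  polynomial in the Moore determinant (\<open>SL_descent\<close>). A Sylow subgroup is the full unitriangular group with
  respect to some basis \<open>z\<close> of the linear forms (\<open>sylow_unitriangular\<close>). The orbit of \<open>z\<close> is then itself a
  grid, the invariants are the orbit products of the \<open>z i\<close>, and \<open>L\<close> is a scalar multiple of their product
  (\<open>unitriangular_descent\<close>, \<open>moore_eq_prod_span_poly\<close>).
\<close>

section \<open>Finite fields inside a field\<close>

lemma finite_field_power_card:
  fixes x :: "'k::{field, finite}"
  shows "x ^ CARD('k) = x"
proof (cases "x = 0")
  case False
  have "(\<Prod>y\<in>UNIV-{0}. x * y) = x ^ (CARD('k) - 1) * \<Prod>(UNIV-{0})"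
    by (simp add: prod.distrib)
  moreover have "(\<Prod>y\<in>UNIV-{0}. x * y) = (\<Prod>y\<in>UNIV-{0}. y)"
    by (rule prod.reindex_bij_witness[of _ "\<lambda>y. y / x" "\<lambda>y. x * y"]) (use False in auto)
  ultimately have "x ^ (CARD('k) - 1) = 1" by simp
  then have "x ^ Suc (CARD('k) - 1) = x" by (subst power_Suc) simp
  then show ?thesis using finite_UNIV_card_ge_0[where ?'a = 'k] by simp
qed (use finite_UNIV_card_ge_0[where ?'a = 'k] in auto)

lemma prime_CHAR_finite_field: "prime CHAR('k::{field, finite})"
  by (simp add: prime_CHAR_semidom finite_imp_CHAR_pos)

lemma card_finite_field_ge_2: "2 \<le> CARD('k::{field, finite})"
proof -
  have "card {0, 1 :: 'k} \<le> CARD('k)" by (rule card_mono) auto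
  then show ?thesis by simp
qed

text \<open>An integer multiple \<open>e x\<close> with \<open>0 < e < p\<close> cannot lie in the additive subgroup \<open>S\<close>, since \<open>e\<close> is
  invertible modulo \<open>p\<close> and \<open>x\<close> would lie in \<open>S\<close> too. Hence the \<open>p\<close> translates of \<open>S\<close> by the
  multiples of \<open>x\<close> are disjoint.\<close>

lemma additive_closure_extend:
  fixes S :: "'k::{field, finite} set"
  defines "p \<equiv> CHAR('k)"
  assumes S0: "0 \<in> S" and add: "\<And>x y. x \<in> S \<Longrightarrow> y \<in> S \<Longrightarrow> x + y \<in> S" and x: "x \<notin> S"
  defines "S' \<equiv> {s + of_nat i * x | s i. s \<in> S \<and> i < p}"
  shows "0 \<in> S'" "\<And>u v. u \<in> S' \<Longrightarrow> v \<in> S' \<Longrightarrow> u + v \<in> S'" "card S' = p * card S"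
proof -
  have p: "prime p" unfolding p_def by (rule prime_CHAR_finite_field)
  then have p0: "p > 0" by (rule prime_gt_0_nat)
  have char: "of_nat p = (0::'k)" unfolding p_def by simp
  have mod: "of_nat (i mod p) = (of_nat i :: 'k)" for i
  proof -
    have "(of_nat i :: 'k) = of_nat (i div p * p + i mod p)" by simp
    then show ?thesis unfolding of_nat_add of_nat_mult char by simp
  qed
  have mul: "of_nat i * s \<in> S" if "s \<in> S" for s i
    by (induction i) (auto simp: S0 algebra_simps intro!: add that)
  show "0 \<in> S'" unfolding S'_def using S0 p0 by (intro CollectI exI[of _ 0] exI[of _ "0::nat"]) auto
  show "u + v \<in> S'" if uv: "u \<in> S'" "v \<in> S'" for u v
  proof -
    from uv obtain s i t j where *: "u = s + of_nat i * x" "v = t + of_nat j * x" "s \<in> S" "t \<in> S"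
      unfolding S'_def by blast
    have "u + v = (s + t) + of_nat ((i + j) mod p) * x" by (simp add: * mod algebra_simps)
    then show ?thesis unfolding S'_def using p0 add[OF *(3,4)]
      by (intro CollectI exI[of _ "s + t"] exI[of _ "(i + j) mod p"]) auto
  qed
  have inj1: "i = j" if "s + of_nat i * x = t + of_nat j * x" "s \<in> S" "t \<in> S" "i \<le> j" "j < p" for s t i j
  proof (rule ccontr)
    assume "i \<noteq> j"
    define e where "e = j - i"
    have e: "0 < e" "e < p" "j = i + e" using that \<open>i \<noteq> j\<close> by (auto simp: e_def)
    have "s = t + of_nat e * x" using that(1) e by (simp add: algebra_simps)
    moreover have "of_nat (p - 1) * t + t = 0"
    proof -
      have "of_nat (p - 1) * t + t = of_nat (Suc (p - 1)) * t" by (simp only: of_nat_Suc distrib_right mult_1 add.commute)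
      also have "\<dots> = 0" using p0 char by simp
      finally show ?thesis .
    qed
    ultimately have "s + of_nat (p - 1) * t = of_nat e * x" by (simp add: add.assoc[symmetric] add.commute)
    then have "of_nat e * x = s + of_nat (p - 1) * t" by simp
    then have ex: "of_nat e * x \<in> S" using add[OF that(2) mul[OF that(3)]] by (simp only:)
    have "coprime e p" using e p
      by (metis coprime_commute nat_dvd_not_less prime_imp_coprime)
    then obtain u y where "e * u = p * y + 1" using bezout_nat[of e p] e(1) by auto
    then have "of_nat (e * u) = (of_nat p * of_nat y + 1 :: 'k)" by (simp only: of_nat_add of_nat_mult of_nat_1)
    then have "of_nat (e * u) = (1 :: 'k)" by (simp only: char mult_zero_left add_0)
    then have "of_nat u * of_nat e = (1 :: 'k)" by (simp only: of_nat_mult mult.commute)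
    then have "of_nat u * (of_nat e * x) = x" by (simp only: mult.assoc[symmetric] mult_1)
    then show False using mul[OF ex, of u] x by (simp only:)
  qed
  have "inj_on (\<lambda>(s, i). s + of_nat i * x) (S \<times> {..<p})"
  proof (rule inj_onI, clarify)
    fix s i t j assume *: "s + of_nat i * x = t + of_nat j * x" "s \<in> S" "t \<in> S" "i < p" "j < p"
    then have "i = j" using inj1[of s i t j] inj1[of t j s i] by (cases "i \<le> j") auto
    with * show "s = t \<and> i = j" by simp
  qed
  moreover have "S' = (\<lambda>(s, i). s + of_nat i * x) ` (S \<times> {..<p})" unfolding S'_def by auto
  ultimately show "card S' = p * card S" by (simp add: card_image card_cartesian_product)
qed

text \<open>An additive subgroup that is largest among those of \<open>p\<close>-power order must be everything, because
  otherwise it could be enlarged by a factor \<open>p\<close>.\<close>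

lemma card_finite_field_CHAR_power: "\<exists>r. CARD('k::{field, finite}) = CHAR('k) ^ r"
proof -
  define p where "p = CHAR('k)"
  define P where "P = (\<lambda>S :: 'k set. 0 \<in> S \<and> (\<forall>x\<in>S. \<forall>y\<in>S. x + y \<in> S) \<and> (\<exists>r. card S = p ^ r))"
  have "P {0}" unfolding P_def by (auto intro: exI[of _ 0])
  moreover have "\<forall>S. P S \<longrightarrow> card S < Suc (CARD('k))" by (simp add: card_mono less_Suc_eq_le)
  ultimately obtain S where S: "P S" "\<And>T. P T \<Longrightarrow> card T \<le> card S"
    using ex_has_greatest_nat[of P "{0}" card "Suc CARD('k)"] by auto
  have "S = UNIV"
  proof (rule ccontr)
    assume "S \<noteq> UNIV"
    then obtain x where x: "x \<notin> S" by blast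
    have 0: "0 \<in> S" and a: "\<And>x y. x \<in> S \<Longrightarrow> y \<in> S \<Longrightarrow> x + y \<in> S" and c: "\<exists>r. card S = p ^ r"
      using S(1) by (auto simp: P_def)
    note ext = additive_closure_extend[OF 0 a x]
    define T where "T = {s + of_nat i * x | s i. s \<in> S \<and> i < CHAR('k)}"
    obtain r where r: "card S = p ^ r" using c by blast
    have T: "0 \<in> T" "\<And>u v. u \<in> T \<Longrightarrow> v \<in> T \<Longrightarrow> u + v \<in> T" "card T = p * card S"
      unfolding T_def p_def using ext by auto
    have "P T" unfolding P_def using T r by (auto intro: exI[of _ "Suc r"])
    then have "p * card S \<le> card S" using S(2) T(3) by metis
    moreover have "card S > 0" using 0 card_gt_0_iff finite_class.finite by blast
    moreover have "p > 1" unfolding p_def by (rule prime_gt_1_nat[OF prime_CHAR_finite_field])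
    ultimately show False by simp
  qed
  then show ?thesis using S(1) by (auto simp: P_def p_def)
qed

definition moore :: "nat \<Rightarrow> nat \<Rightarrow> (nat \<Rightarrow> 'a) \<Rightarrow> 'a::comm_ring_1" where
  "moore q n z = det (mat n n (\<lambda>(j, i). z j ^ (q ^ i)))"

text \<open>By Cramer's rule this is \<open>moore q n z\<close> times the \<open>k\<close>-th coefficient of \<open>w\<close> in terms of the vectors
  \<open>(z j ^ (q ^ i))\<^sub>j\<close>; see \<open>moore_cramer\<close>.\<close>

definition moore_col :: "nat \<Rightarrow> nat \<Rightarrow> (nat \<Rightarrow> 'a) \<Rightarrow> (nat \<Rightarrow> 'a) \<Rightarrow> nat \<Rightarrow> 'a::comm_ring_1" where
  "moore_col q n z w k = det (mat n n (\<lambda>(j, i). if i = k then w j else z j ^ (q ^ i)))"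

text \<open>For independent \<open>z\<close> over a field with \<open>q\<close> elements this is the product of \<open>t - v\<close> over all \<open>v\<close> in
  the span of \<open>z 0, \<dots>, z (i - 1)\<close>. Unlike the product, the recursion shows at once that the
  polynomial is additive and that its coefficients are polynomials in the values
  \<open>span_poly q z j (z j)\<close> with \<open>j < i\<close>.\<close>

fun span_poly :: "nat \<Rightarrow> (nat \<Rightarrow> 'a) \<Rightarrow> nat \<Rightarrow> 'a \<Rightarrow> 'a::comm_ring_1" where
  "span_poly q z 0 t = t"
| "span_poly q z (Suc i) t = span_poly q z i t ^ q - span_poly q z i (z i) ^ (q - 1) * span_poly q z i t"

text \<open>The field of scalars is embedded by \<open>\<kappa>\<close> rather than being a subset, so that it can later be the
  coefficient field of polynomials. What matters is that \<open>y \<mapsto> y ^ q\<close> is linear over it.\<close>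

locale finite_subfield = field_hom \<kappa> for \<kappa> :: "'k::{field, finite} \<Rightarrow> 'f::field" +
  fixes q :: nat
  assumes q_card: "q = CARD('k)"
begin

lemma q_pos: "0 < q" and q_gt_1: "1 < q"
  using card_finite_field_ge_2[where 'k = 'k] by (auto simp: q_card)

lemma CHAR_extension: "CHAR('f) = CHAR('k)"
proof (rule CHAR_eqI)
  show "of_nat CHAR('k) = (0::'f)" using hom_of_nat[of "CHAR('k)"] by simp
next
  fix n assume "of_nat n = (0::'f)"
  then have "\<kappa> (of_nat n) = 0" using hom_of_nat[of n] by (simp only:)
  then show "CHAR('k) dvd n" by (simp add: of_nat_eq_0_iff_char_dvd)
qed

lemma frob_sum: "(\<Sum>i\<in>I. a i :: 'f) ^ (q ^ j) = (\<Sum>i\<in>I. a i ^ (q ^ j))"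
proof -
  obtain r where "q = CHAR('f) ^ r"
    using card_finite_field_CHAR_power[where 'k = 'k] CHAR_extension by (auto simp: q_card)
  then show ?thesis using prime_CHAR_finite_field[where 'k = 'k]
    by (intro freshmans_dream_sum'[where n = "r * j"]) (auto simp: CHAR_extension power_mult)
qed

lemma frob_add: "(a + b :: 'f) ^ (q ^ j) = a ^ (q ^ j) + b ^ (q ^ j)"
proof -
  have "(\<Sum>i\<in>{0,1::nat}. if i = 0 then a else b) ^ (q ^ j) = (\<Sum>i\<in>{0,1::nat}. (if i = 0 then a else b) ^ (q ^ j))"
    by (rule frob_sum)
  then show ?thesis by simp
qed

lemma scalar_frob: "\<kappa> c ^ (q ^ j) = \<kappa> c"
proof (induction j)
  case (Suc j)
  have "\<kappa> c ^ (q ^ Suc j) = (\<kappa> c ^ (q ^ j)) ^ q" by (simp only: power_Suc2 power_mult)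
  also have "\<dots> = \<kappa> (c ^ q)" by (simp only: Suc.IH hom_power)
  finally show ?case by (simp only: q_card finite_field_power_card)
qed simp

lemma frob_lin: "(\<Sum>l\<in>I. \<kappa> (c l) * z l) ^ (q ^ j) = (\<Sum>l\<in>I. \<kappa> (c l) * z l ^ (q ^ j))"
  by (simp add: frob_sum power_mult_distrib scalar_frob)

definition lspan :: "(nat \<Rightarrow> 'f) \<Rightarrow> nat \<Rightarrow> 'f set" where
  "lspan z i = range (\<lambda>c. \<Sum>j<i. \<kappa> (c j) * z j)"

definition indep :: "(nat \<Rightarrow> 'f) \<Rightarrow> nat \<Rightarrow> bool" where
  "indep z n \<longleftrightarrow> (\<forall>c. (\<Sum>j<n. \<kappa> (c j) * z j) = 0 \<longrightarrow> (\<forall>j<n. c j = 0))"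

lemma lspanI: "(\<Sum>j<i. \<kappa> (c j) * z j) \<in> lspan z i"
  by (auto simp: lspan_def)

lemma lspan_0: "0 \<in> lspan z i"
  using lspanI[of "\<lambda>_. 0" z i] by simp

lemma lspan_add: "u \<in> lspan z i \<Longrightarrow> v \<in> lspan z i \<Longrightarrow> u + v \<in> lspan z i"
  unfolding lspan_def
  by (auto simp: sum.distrib[symmetric] distrib_right[symmetric] hom_add[symmetric] simp del: hom_add)

lemma lspan_scale: "u \<in> lspan z i \<Longrightarrow> \<kappa> c * u \<in> lspan z i"
  unfolding lspan_def
  by (auto simp: sum_distrib_left mult.assoc[symmetric] hom_mult[symmetric] simp del: hom_mult)

lemma lspan_uminus: "u \<in> lspan z i \<Longrightarrow> - u \<in> lspan z i"
  using lspan_scale[of u z i "- 1"] by (simp add: hom_uminus)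

lemma lspan_diff: "u \<in> lspan z i \<Longrightarrow> v \<in> lspan z i \<Longrightarrow> u - v \<in> lspan z i"
  using lspan_add[OF _ lspan_uminus, of u z i v] by simp

lemma lspan_sum: "(\<And>j. j \<in> J \<Longrightarrow> u j \<in> lspan z i) \<Longrightarrow> (\<Sum>j\<in>J. u j) \<in> lspan z i"
  by (induction J rule: infinite_finite_induct) (auto intro: lspan_0 lspan_add)

lemma lspan_mono: "i \<le> j \<Longrightarrow> lspan z i \<subseteq> lspan z j"
proof
  fix u assume ij: "i \<le> j" and "u \<in> lspan z i"
  then obtain c where u: "u = (\<Sum>l<i. \<kappa> (c l) * z l)" by (auto simp: lspan_def)
  have "u = (\<Sum>l<j. \<kappa> (if l < i then c l else 0) * z l)" unfolding u
    using ij by (intro sum.mono_neutral_cong_left) auto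
  then show "u \<in> lspan z j" using lspanI by simp
qed

lemma lspan_base: "j < i \<Longrightarrow> z j \<in> lspan z i"
  using lspanI[of "\<lambda>l. if l = j then 1 else 0" z i] by (simp add: if_distrib[of \<kappa>] if_distrib[of "\<lambda>x. x * _"] cong: if_cong)

lemma lspan_Suc: "u \<in> lspan z (Suc i) \<Longrightarrow> \<exists>v c. v \<in> lspan z i \<and> u = v + \<kappa> c * z i"
  by (auto simp: lspan_def)

lemma lspan_subset: "(\<And>j. j < i \<Longrightarrow> w j \<in> lspan z n) \<Longrightarrow> lspan w i \<subseteq> lspan z n"
  by (auto simp: lspan_def[of w] intro!: lspan_sum lspan_scale)

lemma card_lspan:
  assumes "indep z n"
  shows "finite (lspan z n)" "card (lspan z n) = q ^ n"
proof -
  have "lspan z n = (\<lambda>c. \<Sum>j<n. \<kappa> (c j) * z j) ` (PiE {..<n} (\<lambda>_. UNIV))"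
  proof
    show "lspan z n \<subseteq> (\<lambda>c. \<Sum>j<n. \<kappa> (c j) * z j) ` (PiE {..<n} (\<lambda>_. UNIV))"
    proof
      fix u assume "u \<in> lspan z n"
      then obtain c where "u = (\<Sum>j<n. \<kappa> (c j) * z j)" by (auto simp: lspan_def)
      then have "u = (\<Sum>j<n. \<kappa> (restrict c {..<n} j) * z j)" by simp
      then show "u \<in> (\<lambda>c. \<Sum>j<n. \<kappa> (c j) * z j) ` (PiE {..<n} (\<lambda>_. UNIV))"
        by (intro image_eqI[of _ _ "restrict c {..<n}"]) auto
    qed
  qed (auto simp: lspan_def)
  moreover have "inj_on (\<lambda>c. \<Sum>j<n. \<kappa> (c j) * z j) (PiE {..<n} (\<lambda>_. UNIV))"
  proof (rule inj_onI)
    fix c e assume c: "c \<in> PiE {..<n} (\<lambda>_. UNIV)" and e: "e \<in> PiE {..<n} (\<lambda>_. UNIV)"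
      and eq: "(\<Sum>j<n. \<kappa> (c j) * z j) = (\<Sum>j<n. \<kappa> (e j) * z j)"
    then have "(\<Sum>j<n. \<kappa> (c j - e j) * z j) = 0"
      by (simp add: hom_minus left_diff_distrib sum_subtractf)
    then have "\<forall>j<n. c j - e j = 0" using assms unfolding indep_def by (elim allE[of _ "\<lambda>j. c j - e j"]) (rule mp)
    then have "\<forall>j<n. c j = e j" by simp
    then show "c = e" using c e by (intro PiE_ext[of c "{..<n}" _ e]) auto
  qed
  moreover have "finite (PiE {..<n} (\<lambda>_. UNIV :: 'k set))" by (intro finite_PiE) auto
  ultimately show "finite (lspan z n)" "card (lspan z n) = q ^ n"
    by (simp_all add: card_image card_PiE q_card)
qed

lemma indep_mono: "indep z n \<Longrightarrow> i \<le> n \<Longrightarrow> indep z i"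
  unfolding indep_def
proof (intro allI impI)
  fix c j assume n: "\<forall>c. (\<Sum>j<n. \<kappa> (c j) * z j) = 0 \<longrightarrow> (\<forall>j<n. c j = 0)" and i: "i \<le> n"
    and 0: "(\<Sum>j<i. \<kappa> (c j) * z j) = 0" and j: "j < i"
  have "(\<Sum>l<n. \<kappa> (if l < i then c l else 0) * z l) = 0"
    unfolding 0[symmetric] using i by (intro sum.mono_neutral_cong_right) auto
  then have "\<forall>l<n. (if l < i then c l else 0) = 0" using n by fast
  moreover have "j < n" using i j by simp
  ultimately show "c j = 0" using j by auto
qed

lemma indep_Suc:
  assumes z: "indep z i" and u: "z i \<notin> lspan z i"
  shows "indep z (Suc i)"
  unfolding indep_def
proof (intro allI impI)
  fix c j assume eq: "(\<Sum>j<Suc i. \<kappa> (c j) * z j) = 0" and j: "j < Suc i"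
  have "c i = 0"
  proof (rule ccontr)
    assume ci: "c i \<noteq> 0"
    have "z i = \<kappa> (- inverse (c i)) * (\<Sum>j<i. \<kappa> (c j) * z j)"
    proof -
      have "(\<Sum>j<i. \<kappa> (c j) * z j) = - (\<kappa> (c i) * z i)" using eq by (simp add: eq_neg_iff_add_eq_0)
      moreover have "\<kappa> (inverse (c i)) * \<kappa> (c i) = 1" using ci by (simp flip: hom_mult)
      ultimately show ?thesis by (simp add: hom_uminus)
    qed
    then have "z i \<in> lspan z i" using lspan_scale lspanI by metis
    with u show False by simp
  qed
  with eq have "(\<Sum>j<i. \<kappa> (c j) * z j) = 0" by simp
  with z j \<open>c i = 0\<close> show "c j = 0" unfolding indep_def less_Suc_eq by blast
qed

text \<open>Each of the two families is obtained from the other by adding combinations of earlier vectors.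
  This is how the orbit of a flag basis under the unitriangular group looks.\<close>

lemma unitriangular_span:
  assumes t: "\<And>i. i < n \<Longrightarrow> t i - z i \<in> lspan z i" and i: "i \<le> n"
  shows "lspan t i = lspan z i"
  using i
proof (induction i)
  case 0 then show ?case by (simp add: lspan_def)
next
  case (Suc i)
  then have IH: "lspan t i = lspan z i" and i: "i < n" by auto
  have "t i \<in> lspan z (Suc i)"
  proof -
    have "t i = (t i - z i) + z i" by simp
    also have "\<dots> \<in> lspan z (Suc i)"
      using t[OF i] lspan_mono[of i "Suc i" z] by (intro lspan_add lspan_base) auto
    finally show ?thesis .
  qed
  moreover have "z i \<in> lspan t (Suc i)"
  proof -
    have "z i = t i - (t i - z i)" by simp
    also have "\<dots> \<in> lspan t (Suc i)"
    proof (rule lspan_diff)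
      show "t i - z i \<in> lspan t (Suc i)" using t[OF i] lspan_mono[of i "Suc i" t] IH by auto
    qed (simp add: lspan_base)
    finally show ?thesis .
  qed
  moreover have "lspan t i \<subseteq> lspan z (Suc i)" "lspan z i \<subseteq> lspan t (Suc i)"
    using IH lspan_mono[of i "Suc i" z] lspan_mono[of i "Suc i" t] by auto
  ultimately show ?case
    by (intro subset_antisym lspan_subset) (auto simp: less_Suc_eq intro: lspan_base)
qed

text \<open>There are only \<open>q ^ n\<close> coefficient vectors, so a span of this size has no collisions.\<close>

lemma indep_if_card: 
  assumes c: "q ^ n \<le> card (lspan t n)"
  shows "indep t n"
proof -
  let ?P = "PiE {..<n} (\<lambda>_. UNIV :: 'k set)" and ?f = "\<lambda>c. \<Sum>j<n. \<kappa> (c j) * t j"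
  have fin: "finite ?P" by (intro finite_PiE) auto
  have "lspan t n \<subseteq> ?f ` ?P"
  proof
    fix u assume "u \<in> lspan t n"
    then obtain c where "u = ?f c" by (auto simp: lspan_def)
    then have "u = ?f (restrict c {..<n})" by simp
    then show "u \<in> ?f ` ?P" by (intro image_eqI[of _ _ "restrict c {..<n}"]) auto
  qed
  then have "card ?P \<le> card (?f ` ?P)"
    using c card_mono[of "?f ` ?P" "lspan t n"] fin by (simp add: card_PiE q_card)
  then have "card (?f ` ?P) = card ?P" by (rule antisym[OF card_image_le[OF fin]])
  then have inj: "inj_on ?f ?P" by (rule eq_card_imp_inj_on[OF fin])
  show ?thesis unfolding indep_def
  proof (intro allI impI)
    fix c j assume "?f c = 0" and j: "j < n"
    then have "?f (restrict c {..<n}) = ?f (restrict (\<lambda>_. 0) {..<n})" by simp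
    then have "restrict c {..<n} = restrict (\<lambda>_. 0) {..<n}" by (rule inj_onD[OF inj]) (auto split: if_splits)
    then have "restrict c {..<n} j = restrict (\<lambda>_. 0) {..<n} j" by (rule fun_cong)
    then show "c j = 0" using j by simp
  qed
qed

subsection \<open>Moore determinants\<close>

text \<open>A vector in the kernel of the Moore matrix consists of the coefficients of a nonzero additive
  polynomial of degree at most \<open>q ^ (n - 1)\<close> that vanishes on the whole span, which has \<open>q ^ n\<close>
  elements.\<close>

lemma moore_nonzero:
  assumes z: "indep z n"
  shows "moore q n z \<noteq> 0"
proof
  let ?M = "mat n n (\<lambda>(j, i). z j ^ (q ^ i))"
  assume "moore q n z = 0"
  then obtain v where v: "v \<in> carrier_vec n" "v \<noteq> 0\<^sub>v n" "?M *\<^sub>v v = 0\<^sub>v n"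
    unfolding moore_def using det_0_iff_vec_prod_zero_field[of ?M n] by auto
  obtain i where i: "i < n" "v $ i \<noteq> 0" using v by (metis eq_vecI carrier_vecD index_zero_vec)
  have row: "(\<Sum>i<n. v $ i * z j ^ (q ^ i)) = 0" if "j < n" for j
  proof -
    have "(?M *\<^sub>v v) $ j = (\<Sum>i<n. z j ^ (q ^ i) * v $ i)"
      using v(1) that by (simp add: scalar_prod_def lessThan_atLeast0 carrier_vecD)
    then show ?thesis using v(3) that by (simp add: mult.commute)
  qed
  define Q where "Q = (\<Sum>i<n. monom (v $ i) (q ^ i))"
  have inj: "q ^ a = q ^ b \<longleftrightarrow> a = b" for a b using q_gt_1 by (simp add: power_inject_exp)
  have "coeff Q (q ^ i) = v $ i" using i(1) inj by (simp add: Q_def coeff_sum if_distrib cong: if_cong)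
  then have Q0: "Q \<noteq> 0" using i by auto
  have "degree Q \<le> q ^ (n - 1)"
    unfolding Q_def using q_gt_1
    by (intro degree_sum_le) (auto intro!: order.trans[OF degree_monom_le] power_increasing)
  have "lspan z n \<subseteq> {t. poly Q t = 0}"
  proof
    fix t assume "t \<in> lspan z n"
    then obtain c where t: "t = (\<Sum>j<n. \<kappa> (c j) * z j)" by (auto simp: lspan_def)
    have "poly Q t = (\<Sum>i<n. v $ i * (\<Sum>j<n. \<kappa> (c j) * z j ^ (q ^ i)))"
      unfolding t Q_def by (simp add: poly_sum poly_monom frob_lin)
    also have "\<dots> = (\<Sum>j<n. \<kappa> (c j) * (\<Sum>i<n. v $ i * z j ^ (q ^ i)))"
      by (simp add: sum_distrib_left mult.left_commute) (rule sum.swap)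
    also have "\<dots> = 0" by (simp add: row)
    finally show "t \<in> {t. poly Q t = 0}" by simp
  qed
  then have "card (lspan z n) \<le> degree Q"
    using card_mono[OF poly_roots_finite[OF Q0]] card_poly_roots_bound[OF Q0] by (meson order.trans)
  then have "q ^ n \<le> q ^ (n - 1)" using \<open>degree Q \<le> q ^ (n - 1)\<close> card_lspan[OF z] by simp
  moreover have "q ^ (n - 1) < q ^ n" using q_gt_1 i by (intro power_strict_increasing) auto
  ultimately show False by simp
qed

lemma det_frob_transform:
  assumes C: "C \<in> carrier_mat n n" and N: "N \<in> carrier_mat n n" and N': "N' \<in> carrier_mat n n"
    and eq: "\<And>j i. j < n \<Longrightarrow> i < n \<Longrightarrow> N' $$ (j, i) = (\<Sum>l<n. \<kappa> (C $$ (j, l)) * N $$ (l, i))"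
  shows "det N' = \<kappa> (det C) * det N"
proof -
  have "N' = map_mat \<kappa> C * N"
    using C N N' eq by (intro eq_matI) (auto simp: scalar_prod_def lessThan_atLeast0)
  then show ?thesis using det_mult[of "map_mat \<kappa> C" n N] C N by (simp add: hom_det)
qed

text \<open>The \<open>q\<close>-power map fixes scalars, so a linear change of the vectors multiplies the whole matrix
  from the left by the matrix of the change.\<close>

lemma moore_col_transform:
  assumes C: "C \<in> carrier_mat n n" and t: "\<And>j. j < n \<Longrightarrow> t j = (\<Sum>l<n. \<kappa> (C $$ (j, l)) * z l)"
    and v: "\<And>j. j < n \<Longrightarrow> v j = (\<Sum>l<n. \<kappa> (C $$ (j, l)) * w l)"
  shows "moore_col q n t v k = \<kappa> (det C) * moore_col q n z w k"
  unfolding moore_col_def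
  by (rule det_frob_transform[OF C]) (auto simp: t v frob_lin)

lemma moore_transform:
  assumes C: "C \<in> carrier_mat n n" and t: "\<And>j. j < n \<Longrightarrow> t j = (\<Sum>l<n. \<kappa> (C $$ (j, l)) * z l)"
  shows "moore q n t = \<kappa> (det C) * moore q n z"
  unfolding moore_def
  by (rule det_frob_transform[OF C]) (auto simp: t frob_lin)

end

section \<open>Subrings and polynomial functions over them\<close>

lemma subring_simps:
  assumes "is_subring S"
  shows "1 \<in> S" "x \<in> S \<Longrightarrow> y \<in> S \<Longrightarrow> x - y \<in> S" "x \<in> S \<Longrightarrow> y \<in> S \<Longrightarrow> x * y \<in> S" "0 \<in> S"
    "x \<in> S \<Longrightarrow> - x \<in> S" "x \<in> S \<Longrightarrow> y \<in> S \<Longrightarrow> x + y \<in> S"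
proof -
  show 1: "1 \<in> S" and d: "\<And>x y. x \<in> S \<Longrightarrow> y \<in> S \<Longrightarrow> x - y \<in> S" and "x \<in> S \<Longrightarrow> y \<in> S \<Longrightarrow> x * y \<in> S"
    using assms by (auto simp: is_subring_def)
  show 0: "0 \<in> S" using d[OF 1 1] by simp
  show m: "x \<in> S \<Longrightarrow> - x \<in> S" for x using d[OF 0, of x] by simp
  show "x \<in> S \<Longrightarrow> y \<in> S \<Longrightarrow> x + y \<in> S" using d[OF _ m, of x y] by simp
qed

lemma subring_sum: "is_subring S \<Longrightarrow> (\<And>i. i \<in> I \<Longrightarrow> f i \<in> S) \<Longrightarrow> sum f I \<in> S"
  by (induction I rule: infinite_finite_induct) (auto simp: subring_simps)

lemma subring_prod: "is_subring S \<Longrightarrow> (\<And>i. i \<in> I \<Longrightarrow> f i \<in> S) \<Longrightarrow> prod f I \<in> S"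
  by (induction I rule: infinite_finite_induct) (auto simp: subring_simps)

lemma subring_power: "is_subring S \<Longrightarrow> x \<in> S \<Longrightarrow> x ^ e \<in> S"
  by (induction e) (auto simp: subring_simps)

lemma subring_signof: "is_subring S \<Longrightarrow> signof p \<in> S"
  by (auto simp: sign_def subring_simps)

lemma subring_det:
  assumes S: "is_subring S" and N: "N \<in> carrier_mat n n"
    and e: "\<And>i j. i < n \<Longrightarrow> j < n \<Longrightarrow> N $$ (i, j) \<in> S"
  shows "det N \<in> S"
  unfolding det_def'[OF N]
proof (intro subring_sum[OF S] subring_simps(3)[OF S] subring_prod[OF S] subring_signof[OF S] e)
  fix p i assume "p \<in> {p. p permutes {0..<n}}" "i \<in> {0..<n}"
  then show "i < n" "p i < n" using permutes_in_image[of p "{0..<n}" i] by auto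
qed

text \<open>Polynomial functions in \<open>n\<close> variables with coefficients in \<open>A\<close>. Instead of degrees, the set \<open>E\<close> of
  admitted exponent vectors is recorded: both total degree and degrees in single variables are
  needed below. Functions are used because only their values on finite grids matter.\<close>

inductive_set polyfun :: "'f::comm_ring_1 set \<Rightarrow> nat \<Rightarrow> (nat \<Rightarrow> nat) set \<Rightarrow> ((nat \<Rightarrow> 'f) \<Rightarrow> 'f) set"
  for A n E where
  zero: "(\<lambda>_. 0) \<in> polyfun A n E"
| add_monom: "\<psi> \<in> polyfun A n E \<Longrightarrow> c \<in> A \<Longrightarrow> a \<in> E \<Longrightarrow> (\<lambda>t. \<psi> t + c * (\<Prod>i<n. t i ^ a i)) \<in> polyfun A n E"

lemma polyfun_mono: "\<psi> \<in> polyfun A n E \<Longrightarrow> E \<subseteq> E' \<Longrightarrow> \<psi> \<in> polyfun A n E'"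
  by (induction rule: polyfun.induct) (auto intro: polyfun.intros)

lemma polyfun_monom: "c \<in> A \<Longrightarrow> a \<in> E \<Longrightarrow> (\<lambda>t. c * (\<Prod>i<n. t i ^ a i)) \<in> polyfun A n E"
  using polyfun.add_monom[OF polyfun.zero, of c A a E n] by simp

lemma polyfun_add:
  assumes "\<psi> \<in> polyfun A n E" "\<chi> \<in> polyfun A n E"
  shows "(\<lambda>t. \<psi> t + \<chi> t) \<in> polyfun A n E"
  using assms(2)
proof (induction rule: polyfun.induct)
  case (add_monom \<chi> c a)
  then show ?case using polyfun.add_monom[of "\<lambda>t. \<psi> t + \<chi> t" A n E c a] by (simp add: add.assoc)
qed (use assms(1) in simp)

lemma polyfun_sum:
  assumes "\<And>i. i \<in> I \<Longrightarrow> \<psi> i \<in> polyfun A n E"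
  shows "(\<lambda>t. \<Sum>i\<in>I. \<psi> i t) \<in> polyfun A n E"
  using assms by (induction I rule: infinite_finite_induct) (auto intro: polyfun.zero polyfun_add)

lemma polyfun_mult:
  assumes A: "is_subring A" and \<psi>: "\<psi> \<in> polyfun A n E\<^sub>1" and \<chi>: "\<chi> \<in> polyfun A n E\<^sub>2"
    and E: "\<And>a e. a \<in> E\<^sub>1 \<Longrightarrow> e \<in> E\<^sub>2 \<Longrightarrow> (\<lambda>i. a i + e i) \<in> E"
  shows "(\<lambda>t. \<psi> t * \<chi> t) \<in> polyfun A n E"
  using \<psi>
proof (induction rule: polyfun.induct)
  case zero then show ?case by (simp add: polyfun.zero)
next
  case (add_monom \<psi> c a)
  have "(\<lambda>t. c * (\<Prod>i<n. t i ^ a i) * \<chi> t) \<in> polyfun A n E"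
    using \<chi>
  proof (induction rule: polyfun.induct)
    case zero then show ?case by (simp add: polyfun.zero)
  next
    case (add_monom \<chi> e a')
    have "(\<lambda>t. c * (\<Prod>i<n. t i ^ a i) * \<chi> t + c * e * (\<Prod>i<n. t i ^ (a i + a' i))) \<in> polyfun A n E"
      using add_monom \<open>c \<in> A\<close> \<open>a \<in> E\<^sub>1\<close> by (intro polyfun.add_monom E subring_simps(3)[OF A]) auto
    then show ?case by (simp add: power_add prod.distrib algebra_simps)
  qed
  from polyfun_add[OF add_monom.IH this] show ?case by (simp add: distrib_right)
qed

lemma polyfun_hom:
  assumes h: "comm_ring_hom h" and fixed: "\<And>c. c \<in> A \<Longrightarrow> h c = c" and \<psi>: "\<psi> \<in> polyfun A n E"
  shows "h (\<psi> x) = \<psi> (\<lambda>i. h (x i))"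
proof -
  interpret comm_ring_hom h by (rule h)
  show ?thesis using \<psi> by (induction rule: polyfun.induct) (auto simp: hom_distribs fixed)
qed

lemma polyfun_cong:
  "\<psi> \<in> polyfun A n E \<Longrightarrow> (\<And>i. i < n \<Longrightarrow> s i = t i) \<Longrightarrow> \<psi> s = \<psi> t"
  by (induction rule: polyfun.induct) auto

definition adjoin :: "'f::comm_ring_1 set \<Rightarrow> nat \<Rightarrow> (nat \<Rightarrow> 'f) \<Rightarrow> 'f set" where
  "adjoin A n x = (\<lambda>\<psi>. \<psi> x) ` polyfun A n UNIV"

lemma adjoin_coefficient: "A \<subseteq> adjoin A n x"
proof
  fix c assume "c \<in> A"
  then have "(\<lambda>t. c * (\<Prod>i<n. t i ^ 0)) \<in> polyfun A n UNIV" by (rule polyfun_monom) simp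
  then show "c \<in> adjoin A n x" unfolding adjoin_def by (rule rev_image_eqI) simp
qed

lemma adjoin_generator:
  assumes "is_subring A" "j < n"
  shows "x j \<in> adjoin A n x"
proof -
  have "(\<lambda>t. 1 * (\<Prod>i<n. t i ^ (if i = j then 1 else 0))) \<in> polyfun A n UNIV"
    by (rule polyfun_monom) (auto simp: subring_simps assms)
  then show ?thesis unfolding adjoin_def
    by (rule rev_image_eqI) (use assms in \<open>simp add: if_distrib[of "\<lambda>e. _ ^ e"] cong: if_cong\<close>)
qed

lemma adjoin_subring:
  assumes A: "is_subring A"
  shows "is_subring (adjoin A n x)"
  unfolding is_subring_def
proof (intro conjI ballI)
  show "1 \<in> adjoin A n x" using adjoin_coefficient[of A n x] subring_simps(1)[OF A] by auto
next
  fix u v assume "u \<in> adjoin A n x" "v \<in> adjoin A n x"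
  then obtain \<psi> \<chi> where *: "\<psi> \<in> polyfun A n UNIV" "\<chi> \<in> polyfun A n UNIV" "u = \<psi> x" "v = \<chi> x"
    by (auto simp: adjoin_def)
  have m: "(\<lambda>t. (- 1) * (\<Prod>i<n. t i ^ 0)) \<in> polyfun A n UNIV"
    by (rule polyfun_monom) (auto simp: subring_simps A)
  have "(\<lambda>t. \<psi> t * \<chi> t) \<in> polyfun A n UNIV" by (rule polyfun_mult[OF A *(1,2)]) auto
  then show "u * v \<in> adjoin A n x" unfolding adjoin_def using * by (intro image_eqI[of _ _ "\<lambda>t. \<psi> t * \<chi> t"]) auto
  have "(\<lambda>t. \<psi> t + (- 1) * (\<Prod>i<n. t i ^ 0) * \<chi> t) \<in> polyfun A n UNIV"
    by (rule polyfun_add[OF *(1) polyfun_mult[OF A m *(2)]]) auto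
  then show "u - v \<in> adjoin A n x" unfolding adjoin_def using *
    by (intro image_eqI[of _ _ "\<lambda>t. \<psi> t + (- 1) * (\<Prod>i<n. t i ^ 0) * \<chi> t"]) auto
qed

section \<open>Descent from a grid\<close>

text \<open>The weight of \<open>t\<close> is the coefficient of degree \<open>b\<close> in the Lagrange basis polynomial of \<open>t\<close>: the
  sum is then the coefficient of degree \<open>b\<close> of the polynomial of degree below \<open>card R\<close> that agrees
  with the \<open>a\<close>-th power on \<open>R\<close>.\<close>

lemma interpolation_weights:
  fixes R :: "'f::field set"
  assumes fin: "finite R"
  shows "\<exists>w. \<forall>a<card R. (\<Sum>t\<in>R. w t * t ^ a) = (if a = b then 1 else 0)"
proof -
  define l where "l = (\<lambda>t. \<Prod>s\<in>R - {t}. smult (inverse (t - s)) [:- s, 1:])"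
  have at: "poly (l t) s = (if s = t then 1 else 0)" if "s \<in> R" "t \<in> R" for s t
  proof (cases "s = t")
    case True
    have "poly (smult (inverse (t - x)) [:- x, 1:]) t = 1" if "x \<in> R - {t}" for x
    proof -
      have "poly (smult (inverse (t - x)) [:- x, 1:]) t = inverse (t - x) * (t - x)" by (simp add: algebra_simps)
      also have "\<dots> = 1" using that by (intro left_inverse) auto
      finally show ?thesis .
    qed
    then show ?thesis unfolding l_def poly_prod using True by (simp only: if_True simp_thms) (intro prod.neutral ballI, blast)
  next
    case False
    then show ?thesis using that fin by (auto simp: l_def poly_prod)
  qed
  have deg: "degree (l t) < card R" if "t \<in> R" for t
  proof -
    have "degree (l t) \<le> (\<Sum>s\<in>R - {t}. degree (smult (inverse (t - s)) [:- s, 1:]))"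
      unfolding l_def using degree_prod_sum_le[of "R - {t}" "\<lambda>s. smult (inverse (t - s)) [:- s, 1:]"] fin
      by (simp add: o_def)
    also have "\<dots> \<le> (\<Sum>s\<in>R - {t}. 1)" by (intro sum_mono) (auto intro: order.trans[OF degree_smult_le])
    also have "\<dots> < card R" using that fin card_gt_0_iff[of R] by auto
    finally show ?thesis .
  qed
  have "(\<Sum>t\<in>R. coeff (l t) b * t ^ a) = (if a = b then 1 else 0)" if a: "a < card R" for a
  proof -
    define D where "D = (\<Sum>t\<in>R. smult (t ^ a) (l t)) - monom 1 a"
    have "D = 0"
    proof (rule ccontr)
      assume D0: "D \<noteq> 0"
      have "poly D s = 0" if s: "s \<in> R" for s
      proof -
        have "(\<Sum>t\<in>R. t ^ a * poly (l t) s) = (\<Sum>t\<in>R. if t = s then s ^ a else 0)"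
          by (rule sum.cong) (auto simp: at s)
        then show ?thesis using s fin by (simp add: D_def poly_sum poly_monom)
      qed
      then have "card R \<le> card {s. poly D s = 0}" by (intro card_mono poly_roots_finite D0) auto
      also have "\<dots> \<le> degree D" by (rule card_poly_roots_bound[OF D0])
      also have "\<dots> < card R"
      proof -
        have "degree (\<Sum>t\<in>R. smult (t ^ a) (l t)) \<le> card R - 1"
          using deg fin a by (intro degree_sum_le) (force intro: order.trans[OF degree_smult_le])+
        moreover have "degree (monom (1::'f) a) < card R" using a by (simp add: degree_monom_eq)
        ultimately show ?thesis unfolding D_def using a by (intro degree_diff_less) auto
      qed
      finally show False by simp
    qed
    then have "coeff D b = 0" by simp
    then show ?thesis by (simp add: D_def coeff_sum mult.commute)
  qed
  then show ?thesis by (intro exI[of _ "\<lambda>t. coeff (l t) b"] allI impI)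
qed

text \<open>The relation satisfied by all points of \<open>R\<close> expresses a high power by lower ones, with coefficients
  in \<open>A\<close>.\<close>

lemma weights_integral:
  assumes A: "is_subring A"
    and w: "\<And>a. a < e \<Longrightarrow> (\<Sum>t\<in>R. w t * t ^ a) = (if a = b then 1 else 0)"
    and rel: "\<And>s. s < e \<Longrightarrow> \<alpha> s \<in> A" "\<And>t. t \<in> R \<Longrightarrow> t ^ e = (\<Sum>s<e. \<alpha> s * t ^ s)"
  shows "(\<Sum>t\<in>R. w t * t ^ a) \<in> A"
proof (induction a rule: less_induct)
  case (less a)
  show ?case
  proof (cases "a < e")
    case True then show ?thesis using w A by (auto simp: subring_simps)
  next
    case False
    then obtain r where r: "a = e + r" using le_Suc_ex by (metis not_less)
    have "(\<Sum>t\<in>R. w t * t ^ a) = (\<Sum>t\<in>R. \<Sum>s<e. \<alpha> s * (w t * t ^ (r + s)))"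
      by (intro sum.cong) (auto simp: r power_add rel(2) sum_distrib_left sum_distrib_right algebra_simps)
    also have "\<dots> = (\<Sum>s<e. \<alpha> s * (\<Sum>t\<in>R. w t * t ^ (r + s)))"
      by (subst sum.swap) (simp add: sum_distrib_left)
    also have "\<dots> \<in> A"
    proof (rule subring_sum[OF A])
      fix s assume "s \<in> {..<e}"
      then show "\<alpha> s * (\<Sum>t\<in>R. w t * t ^ (r + s)) \<in> A"
        using less[of "r + s"] r by (intro subring_simps(3)[OF A] rel(1)) auto
    qed
    finally show ?thesis .
  qed
qed

text \<open>The weights of the single coordinates combine to a linear functional \<open>\<Lambda>\<close> on functions on the grid
  \<open>\<Prod>\<^sub>i R i\<close>. It maps polynomial functions over \<open>A\<close> into \<open>A\<close> and picks out the coefficient \<open>c\<close> of the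
  monomial \<open>T ^ b\<close> of \<open>H\<close>. As \<open>\<phi>\<close> has the constant value \<open>f\<close> where \<open>H\<close> does not vanish,
  \<open>f * c = f * \<Lambda> H = \<Lambda> (\<phi> * H) \<in> A\<close>.

  In the applications \<open>f = \<phi> x\<close> is invariant under a group, and \<open>H\<close> vanishes at the grid points outside
  the orbit of \<open>x\<close>. The theorem then replaces the Galois correspondence, and it works over rings.\<close>

theorem grid_descent:
  fixes A :: "'f::field set"
  assumes A: "is_subring A"
    and fin: "\<And>i. i < n \<Longrightarrow> finite (R i)"
    and b: "\<And>i. i < n \<Longrightarrow> b i < card (R i)"
    and rel: "\<And>i. i < n \<Longrightarrow> \<exists>\<alpha>. (\<forall>s<card (R i). \<alpha> s \<in> A) \<and>
                (\<forall>t\<in>R i. t ^ card (R i) = (\<Sum>s<card (R i). \<alpha> s * t ^ s))"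
    and H: "H = (\<lambda>t. c * (\<Prod>i<n. t i ^ b i) + H' t)" "c \<in> A" "u \<in> A" "u * c = 1"
      "H' \<in> polyfun A n {a. (\<forall>i<n. a i < card (R i)) \<and> (\<exists>i<n. a i \<noteq> b i)}"
    and \<phi>: "\<phi> \<in> polyfun A n UNIV"
    and grid: "\<And>t. t \<in> PiE {..<n} R \<Longrightarrow> H t \<noteq> 0 \<Longrightarrow> \<phi> t = f"
  shows "f \<in> A"
proof -
  have "\<forall>i. \<exists>w. i < n \<longrightarrow> (\<forall>a<card (R i). (\<Sum>t\<in>R i. w t * t ^ a) = (if a = b i then 1 else 0))"
    using interpolation_weights fin by blast
  then obtain w where w: "\<And>i a. i < n \<Longrightarrow> a < card (R i) \<Longrightarrow>
      (\<Sum>t\<in>R i. w i t * t ^ a) = (if a = b i then 1 else 0)" by metis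
  define \<Lambda> where "\<Lambda> = (\<lambda>\<psi>. \<Sum>t\<in>PiE {..<n} R. (\<Prod>i<n. w i (t i)) * \<psi> t)"
  have add: "\<Lambda> (\<lambda>t. \<psi> t + \<chi> t) = \<Lambda> \<psi> + \<Lambda> \<chi>" for \<psi> \<chi>
    by (simp add: \<Lambda>_def distrib_left sum.distrib)
  have monom: "\<Lambda> (\<lambda>t. c * (\<Prod>i<n. t i ^ a i)) = c * (\<Prod>i<n. \<Sum>t\<in>R i. w i t * t ^ a i)" for c a
  proof -
    have "(\<Prod>i<n. \<Sum>t\<in>R i. w i t * t ^ a i) = (\<Sum>t\<in>PiE {..<n} R. \<Prod>i<n. w i (t i) * t i ^ a i)"
      by (rule prod_sum_PiE) (use fin in auto)
    then show ?thesis by (simp add: \<Lambda>_def prod.distrib sum_distrib_left mult.left_commute)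
  qed
  have integral: "\<Lambda> \<psi> \<in> A" if "\<psi> \<in> polyfun A n UNIV" for \<psi>
    using that
  proof (induction rule: polyfun.induct)
    case zero then show ?case by (simp add: \<Lambda>_def subring_simps[OF A])
  next
    case (add_monom \<psi> c a)
    have "(\<Sum>t\<in>R i. w i t * t ^ a i) \<in> A" if i: "i < n" for i
    proof -
      obtain \<alpha> where "\<forall>s<card (R i). \<alpha> s \<in> A" "\<forall>t\<in>R i. t ^ card (R i) = (\<Sum>s<card (R i). \<alpha> s * t ^ s)"
        using rel[OF i] by blast
      then show ?thesis by (intro weights_integral[OF A, of "card (R i)" _ _ "b i" \<alpha>] w[OF i]) auto
    qed
    then show ?case unfolding add monom using add_monom
      by (intro subring_simps[OF A] subring_prod[OF A]) auto
  qed
  have vanish: "\<Lambda> \<psi> = 0" if "\<psi> \<in> polyfun A n {a. (\<forall>i<n. a i < card (R i)) \<and> (\<exists>i<n. a i \<noteq> b i)}" for \<psi>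
    using that
  proof (induction rule: polyfun.induct)
    case zero then show ?case by (simp add: \<Lambda>_def)
  next
    case (add_monom \<psi> c a)
    then have "(\<Prod>i<n. \<Sum>t\<in>R i. w i t * t ^ a i) = 0" by (auto simp: w)
    then show ?case using add_monom by (simp add: add monom)
  qed
  have "(\<Prod>i<n. \<Sum>t\<in>R i. w i t * t ^ b i) = 1" by (rule prod.neutral) (auto simp: w b)
  then have \<Lambda>H: "\<Lambda> H = c" unfolding H(1) add monom by (simp add: vanish[OF H(5)])
  have "H \<in> polyfun A n UNIV" unfolding H(1)
    by (intro polyfun_add polyfun_monom H(2) UNIV_I polyfun_mono[OF H(5)] subset_UNIV)
  then have "(\<lambda>t. \<phi> t * H t) \<in> polyfun A n UNIV" by (rule polyfun_mult[OF A \<phi>]) auto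
  then have "\<Lambda> (\<lambda>t. \<phi> t * H t) \<in> A" by (rule integral)
  moreover have "\<Lambda> (\<lambda>t. \<phi> t * H t) = f * \<Lambda> H"
    unfolding \<Lambda>_def sum_distrib_left using grid by (intro sum.cong) (fastforce simp: mult.left_commute)+
  ultimately have "f * c \<in> A" by (simp add: \<Lambda>H)
  then have "f * c * u \<in> A" using H(3) by (rule subring_simps(3)[OF A])
  moreover have "f * c * u = f" using H(4) by (simp add: mult.assoc mult.commute)
  ultimately show ?thesis by simp
qed

section \<open>Triangular determinants and Cramer's rule for Moore matrices\<close>

lemma det_lower_triangular_prod:
  assumes "N \<in> carrier_mat n n" "\<And>i j. i < j \<Longrightarrow> j < n \<Longrightarrow> N $$ (i, j) = 0"
  shows "det N = (\<Prod>i<n. N $$ (i, i))"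
proof -
  have "det N = prod_list (map (\<lambda>i. N $$ (i, i)) [0..<n])"
    using det_lower_triangular[of n N] assms by (simp add: diag_mat_def)
  also have "\<dots> = (\<Prod>i<n. N $$ (i, i))" by (subst prod.distinct_set_conv_list[symmetric]) (auto simp: lessThan_atLeast0)
  finally show ?thesis .
qed

text \<open>The coefficients \<open>c\<close> in \<open>w = M c\<close>, where \<open>M\<close> is the Moore matrix, are given by Cramer's rule.\<close>

lemma moore_cramer:
  fixes x :: "nat \<Rightarrow> 'f::field"
  assumes nz: "moore q n x \<noteq> 0" and j: "j < n"
  shows "moore q n x * w j = (\<Sum>i<n. moore_col q n x w i * x j ^ (q ^ i))"
proof -
  define M where "M = mat n n (\<lambda>(j, i). x j ^ (q ^ i))"
  have M: "M \<in> carrier_mat n n" and d: "det M = moore q n x" by (auto simp: M_def moore_def)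
  obtain B where B: "B \<in> carrier_mat n n" "M * B = 1\<^sub>m n"
    using det_non_zero_imp_unit[OF M, of "()"] nz d by (auto simp: Units_def ring_mat_def)
  \<comment> \<open>\<open>B\<close> is the inverse of the Moore matrix, so \<open>c\<close> solves \<open>M c = w\<close>.\<close>
  define c where "c = B *\<^sub>v vec n w"
  have c: "c \<in> carrier_vec n" using B by (auto simp: c_def)
  have Mc: "M *\<^sub>v c = vec n w" unfolding c_def
    using M B by (subst assoc_mult_mat_vec[symmetric, of _ n n _ n]) auto
  have P: "moore_col q n x w i = c $ i * moore q n x" if i: "i < n" for i
  proof -
    have "replace_col M (M *\<^sub>v c) i = mat n n (\<lambda>(j, l). if l = i then w j else x j ^ (q ^ l))"
      unfolding Mc using M i by (intro eq_matI) (auto simp: replace_col_def M_def)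
    then show ?thesis using cramer_lemma_mat[OF M c i] by (simp add: moore_col_def d)
  qed
  have "w j = (M *\<^sub>v c) $ j" using j Mc by simp
  also have "\<dots> = (\<Sum>i<n. x j ^ (q ^ i) * c $ i)"
    using j c by (simp add: M_def scalar_prod_def lessThan_atLeast0 carrier_vecD)
  finally show ?thesis by (simp add: P sum_distrib_left algebra_simps)
qed

text \<open>Cramer's rule for the transposed Moore matrix: it recovers \<open>y\<close> from the row vector of the sums
  \<open>\<Sum>r<n. y r * x r ^ (q ^ i)\<close>.\<close>

lemma moore_cramer_dual:
  fixes x :: "nat \<Rightarrow> 'f::field"
  assumes l: "l < n"
  shows "moore q n x * y l =
    det (mat n n (\<lambda>(i, j). if j = l then \<Sum>r<n. y r * x r ^ (q ^ i) else x j ^ (q ^ i)))"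
proof -
  define M where "M = mat n n (\<lambda>(i, j). x j ^ (q ^ i))"
  have M: "M \<in> carrier_mat n n" by (simp add: M_def)
  have "transpose_mat M = mat n n (\<lambda>(j, i). x j ^ (q ^ i))" by (intro eq_matI) (auto simp: M_def)
  then have d: "det M = moore q n x" using det_transpose[OF M] by (simp add: moore_def)
  have "replace_col M (M *\<^sub>v vec n y) l = mat n n (\<lambda>(i, j). if j = l then \<Sum>r<n. y r * x r ^ (q ^ i) else x j ^ (q ^ i))"
    using l by (intro eq_matI) (auto simp: replace_col_def M_def scalar_prod_def lessThan_atLeast0 mult.commute)
  then show ?thesis using cramer_lemma_mat[OF M, of "vec n y" l] l by (simp add: d mult.commute)
qed

section \<open>Descent for the three kinds of groups\<close>

context finite_subfield
begin

text \<open>This is the Leibniz formula with the identity permutation split off. Distinct permutations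
  give distinct exponent vectors, so the monomial of the identity occurs with coefficient 1.\<close>

lemma moore_expansion:
  fixes A :: "'f set"
  assumes A: "is_subring A" and n: "n > 0"
  shows "\<exists>H'. moore q n = (\<lambda>t. 1 * (\<Prod>i<n. t i ^ (q ^ i)) + H' t) \<and>
    H' \<in> polyfun A n {a. (\<Sum>i<n. a i) = (\<Sum>i<n. q ^ i) \<and> (\<forall>i<n. a i \<le> q ^ (n - 1)) \<and> (\<exists>i<n. a i \<noteq> q ^ i)}"
proof -
  define P where "P = {p. p permutes {0..<n}} - {id}"
  define H' where "H' = (\<lambda>t. \<Sum>p\<in>P. signof p * (\<Prod>i<n. t i ^ (q ^ p i)) :: 'f)"
  have inj: "q ^ a = q ^ b \<longleftrightarrow> a = b" for a b using q_gt_1 by (simp add: power_inject_exp)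
  have "moore q n t = 1 * (\<Prod>i<n. t i ^ (q ^ i)) + H' t" for t
  proof -
    have "moore q n t = (\<Sum>p | p permutes {0..<n}. signof p * (\<Prod>i = 0..<n. t i ^ (q ^ p i)))"
      unfolding moore_def using permutes_in_image
      by (subst det_def'[of _ n]) (auto intro!: sum.cong prod.cong simp: permutes_in_image)
    also have "\<dots> = (\<Sum>p\<in>insert id P. signof p * (\<Prod>i<n. t i ^ (q ^ p i)))"
      by (rule sum.cong) (auto simp: P_def permutes_id lessThan_atLeast0)
    also have "\<dots> = 1 * (\<Prod>i<n. t i ^ (q ^ i)) + H' t"
      using finite_permutations[of "{0..<n}"] by (subst sum.insert) (auto simp: P_def H'_def sign_id)
    finally show ?thesis .
  qed
  moreover have "H' \<in> polyfun A n {a. (\<Sum>i<n. a i) = (\<Sum>i<n. q ^ i) \<and> (\<forall>i<n. a i \<le> q ^ (n - 1)) \<and> (\<exists>i<n. a i \<noteq> q ^ i)}"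
    unfolding H'_def
  proof (intro polyfun_sum polyfun_monom subring_signof[OF A] CollectI conjI allI impI)
    fix p assume "p \<in> P"
    then have p: "p permutes {..<n}" and "p \<noteq> id" by (auto simp: P_def lessThan_atLeast0)
    show "(\<Sum>i<n. q ^ p i) = (\<Sum>i<n. q ^ i)" using sum.permute[OF p, of "\<lambda>i. q ^ i"] by (simp add: o_def)
    fix i assume "i < n"
    then have "p i < n" using permutes_in_image[OF p] by auto
    then show "q ^ p i \<le> q ^ (n - 1)" using q_gt_1 by (intro power_increasing) auto
  next
    fix p assume "p \<in> P"
    then have p: "p permutes {..<n}" and "p \<noteq> id" by (auto simp: P_def lessThan_atLeast0)
    then obtain i where "p i \<noteq> i" by fastforce
    with p have "i < n" by (auto simp: permutes_def)
    with \<open>p i \<noteq> i\<close> show "\<exists>i<n. q ^ p i \<noteq> q ^ i" using inj by auto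
  qed
  ultimately show ?thesis by (intro exI[of _ H'] conjI ext)
qed

text \<open>Both sides are additive in \<open>t\<close> and compatible with scalars, so the relation for the \<open>x i\<close> extends to
  their span. The right hand side is written with all exponents below \<open>q ^ n\<close> as required by
  \<open>grid_descent\<close>.\<close>

lemma span_relation:
  assumes rel: "\<And>i. i < n \<Longrightarrow> x i ^ (q ^ n) = (\<Sum>l<n. c l * x i ^ (q ^ l))" and t: "t \<in> lspan x n"
  shows "t ^ (q ^ n) = (\<Sum>s<q ^ n. (\<Sum>l<n. if s = q ^ l then c l else 0) * t ^ s)"
proof -
  obtain e where t: "t = (\<Sum>i<n. \<kappa> (e i) * x i)" using t by (auto simp: lspan_def)
  have "t ^ (q ^ n) = (\<Sum>i<n. \<kappa> (e i) * (\<Sum>l<n. c l * x i ^ (q ^ l)))"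
    unfolding t frob_lin by (simp add: rel)
  also have "\<dots> = (\<Sum>l<n. c l * t ^ (q ^ l))"
    unfolding t frob_lin sum_distrib_left by (subst sum.swap) (simp add: mult.left_commute)
  also have "\<dots> = (\<Sum>l<n. \<Sum>s<q ^ n. if s = q ^ l then c l * t ^ s else 0)"
    using q_gt_1 by (intro sum.cong refl) (simp add: power_strict_increasing)
  also have "\<dots> = (\<Sum>s<q ^ n. (\<Sum>l<n. if s = q ^ l then c l else 0) * t ^ s)"
    by (subst sum.swap) (auto simp: sum_distrib_right intro!: sum.cong)
  finally show ?thesis .
qed

lemma lspan_family_matrix:
  assumes t: "\<And>i. i < n \<Longrightarrow> t i \<in> lspan x n"
  shows "\<exists>C\<in>carrier_mat n n. \<forall>i<n. t i = (\<Sum>l<n. \<kappa> (C $$ (i, l)) * x l)"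
proof -
  have "\<forall>i. \<exists>c. i < n \<longrightarrow> t i = (\<Sum>l<n. \<kappa> (c l) * x l)" using t by (simp add: lspan_def image_iff)
  then obtain c where c: "\<And>i. i < n \<Longrightarrow> t i = (\<Sum>l<n. \<kappa> (c i l) * x l)" by metis
  show ?thesis by (rule bexI[of _ "mat n n (\<lambda>(i, l). c i l)"]) (auto simp: c)
qed

text \<open>The grid consists of all \<open>n\<close>-tuples of vectors in the span of \<open>x\<close>. By \<open>moore_transform\<close> the Moore
  determinant vanishes exactly at the tuples which are not the image of \<open>x\<close> under an invertible
  matrix, so it serves as the function \<open>H\<close>.\<close>

lemma GL_descent:
  assumes A: "is_subring A" and x: "indep x n" and n: "n > 0"
    and c: "\<And>l. l < n \<Longrightarrow> c l \<in> A"
    and rel: "\<And>i. i < n \<Longrightarrow> x i ^ (q ^ n) = (\<Sum>l<n. c l * x i ^ (q ^ l))"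
    and f: "f \<in> adjoin A n x"
    and inv: "\<And>C. C \<in> carrier_mat n n \<Longrightarrow> det C \<noteq> 0 \<Longrightarrow>
      \<exists>h. comm_ring_hom h \<and> (\<forall>a\<in>A. h a = a) \<and> h f = f \<and> (\<forall>i<n. h (x i) = (\<Sum>l<n. \<kappa> (C $$ (i, l)) * x l))"
  shows "f \<in> A"
proof -
  obtain \<phi> where \<phi>: "\<phi> \<in> polyfun A n UNIV" "f = \<phi> x" using f by (auto simp: adjoin_def)
  obtain H' where H': "moore q n = (\<lambda>t. 1 * (\<Prod>i<n. t i ^ (q ^ i)) + H' t)"
    "H' \<in> polyfun A n {a. (\<Sum>i<n. a i) = (\<Sum>i<n. q ^ i) \<and> (\<forall>i<n. a i \<le> q ^ (n - 1)) \<and> (\<exists>i<n. a i \<noteq> q ^ i)}"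
    using moore_expansion[OF A n] by blast
  have lt: "q ^ i < q ^ n" if "i < n" for i using that q_gt_1 by (simp add: power_strict_increasing)
  have le: "a < q ^ n" if "a \<le> q ^ (n - 1)" for a using that lt[of "n - 1"] n by simp
  show ?thesis
  proof (rule grid_descent[OF A, where R = "\<lambda>_. lspan x n" and b = "\<lambda>i. q ^ i" and c = 1 and u = 1
        and H = "moore q n" and \<phi> = \<phi>])
    show "\<exists>\<alpha>. (\<forall>s<card (lspan x n). \<alpha> s \<in> A) \<and>
        (\<forall>t\<in>lspan x n. t ^ card (lspan x n) = (\<Sum>s<card (lspan x n). \<alpha> s * t ^ s))"
      unfolding card_lspan(2)[OF x]
      by (rule exI[of _ "\<lambda>s. \<Sum>l<n. if s = q ^ l then c l else 0"])
         (auto intro!: subring_sum[OF A] c span_relation rel simp: subring_simps(4)[OF A])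
    show "H' \<in> polyfun A n {a. (\<forall>i<n. a i < card (lspan x n)) \<and> (\<exists>i<n. a i \<noteq> q ^ i)}"
      by (rule polyfun_mono[OF H'(2)]) (auto simp: card_lspan(2)[OF x] le)
    fix t assume t: "t \<in> PiE {..<n} (\<lambda>_. lspan x n)" and nz: "moore q n t \<noteq> 0"
    then obtain C where C: "C \<in> carrier_mat n n" "\<And>i. i < n \<Longrightarrow> t i = (\<Sum>l<n. \<kappa> (C $$ (i, l)) * x l)"
      using lspan_family_matrix[of n t x] by auto
    have "det C \<noteq> 0" using nz moore_transform[OF C] by auto
    then obtain h where h: "comm_ring_hom h" "\<forall>a\<in>A. h a = a" "h f = f" "\<forall>i<n. h (x i) = t i"
      using inv[OF C(1)] C(2) by auto
    have "\<phi> t = \<phi> (\<lambda>i. h (x i))" using h(4) by (intro polyfun_cong[OF \<phi>(1)]) auto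
    also have "\<dots> = h f" unfolding \<phi>(2) using h by (intro polyfun_hom[OF h(1) _ \<phi>(1), symmetric]) auto
    finally show "\<phi> t = f" using h(3) by simp
  qed (use card_lspan[OF x] lt H'(1) \<phi>(1) A in \<open>auto simp: subring_simps\<close>)
qed

lemma scalar_power_sum:
  fixes c :: 'k
  assumes "c \<noteq> 1"
  shows "(\<Sum>s=1..q - 1. c ^ s) = 0"
proof -
  have "(1 - c) * (\<Sum>s<q. c ^ s) = 1 - c"
    by (simp only: one_diff_power_eq[symmetric] q_card finite_field_power_card)
  then have "(\<Sum>s<q. c ^ s) = 1" using assms by simp
  moreover have "{..<q} = insert 0 {1..q - 1}" using q_pos by auto
  ultimately show ?thesis by simp
qed

text \<open>At the image of \<open>x\<close> under a matrix of determinant \<open>c\<close> the Moore determinant equals \<open>c L\<close>, where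
  \<open>L = moore q n x\<close>. Therefore \<open>H = \<Sum>\<^sub>s L ^ (q - 1 - s) * moore ^ s\<close>, for \<open>1 \<le> s < q\<close>, has the value
  \<open>(\<Sum>\<^sub>s c ^ s) * L ^ (q - 1)\<close> there, which is zero unless \<open>c = 1\<close>. The leading monomial of the Moore
  determinant still has an invertible coefficient in \<open>H\<close>, as the terms with \<open>s \<ge> 2\<close> have larger total
  degree.\<close>

lemma SL_descent:
  assumes A: "is_subring A" and x: "indep x n" and n: "n > 0"
    and c: "\<And>l. l < n \<Longrightarrow> c l \<in> A"
    and rel: "\<And>i. i < n \<Longrightarrow> x i ^ (q ^ n) = (\<Sum>l<n. c l * x i ^ (q ^ l))"
    and L: "moore q n x \<in> A" "inverse (moore q n x) \<in> A"
    and f: "f \<in> adjoin A n x"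
    and inv: "\<And>C. C \<in> carrier_mat n n \<Longrightarrow> det C = 1 \<Longrightarrow>
      \<exists>h. comm_ring_hom h \<and> (\<forall>a\<in>A. h a = a) \<and> h f = f \<and> (\<forall>i<n. h (x i) = (\<Sum>l<n. \<kappa> (C $$ (i, l)) * x l))"
  shows "f \<in> A"
proof -
  define L where "L = moore q n x"
  have L0: "L \<noteq> 0" unfolding L_def by (rule moore_nonzero[OF x])
  obtain \<phi> where \<phi>: "\<phi> \<in> polyfun A n UNIV" "f = \<phi> x" using f by (auto simp: adjoin_def)
  define D where "D = (\<Sum>i<n. q ^ i)"
  \<comment> \<open>Exponent vectors of the monomials in the \<open>s\<close>-th power of the Moore determinant.\<close>
  define E where "E = (\<lambda>s. {a. (\<Sum>i<n. a i) = s * D \<and> (\<forall>i<n. a i \<le> s * q ^ (n - 1))})"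
  obtain H' where H': "moore q n = (\<lambda>t. 1 * (\<Prod>i<n. t i ^ (q ^ i)) + H' t)"
    "H' \<in> polyfun A n {a. (\<Sum>i<n. a i) = D \<and> (\<forall>i<n. a i \<le> q ^ (n - 1)) \<and> (\<exists>i<n. a i \<noteq> q ^ i)}"
    using moore_expansion[OF A n] unfolding D_def by blast
  have D0: "D > 0" unfolding D_def using n q_pos by (intro sum_pos) auto
  have lt: "q ^ i < q ^ n" if "i < n" for i using that q_gt_1 by (simp add: power_strict_increasing)
  have le: "a < q ^ n" if "a \<le> s * q ^ (n - 1)" "s < q" for a s
  proof -
    have "s * q ^ (n - 1) < q * q ^ (n - 1)" using that q_pos by simp
    also have "\<dots> = q ^ n" using n by (cases n) auto
    finally show ?thesis using that by simp
  qed
  have m1: "moore q n \<in> polyfun A n (E 1)" unfolding H'(1)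
  proof (rule polyfun_add)
    show "(\<lambda>t. 1 * (\<Prod>i<n. t i ^ (q ^ i))) \<in> polyfun A n (E 1)"
      using q_gt_1 n by (intro polyfun_monom) (auto simp: E_def D_def subring_simps(1)[OF A] intro!: power_increasing)
    show "H' \<in> polyfun A n (E 1)" by (rule polyfun_mono[OF H'(2)]) (auto simp: E_def)
  qed
  have mpow: "(\<lambda>t. moore q n t ^ s) \<in> polyfun A n (E s)" for s
  proof (induction s)
    case 0
    have "(\<lambda>t. 1 * (\<Prod>i<n. t i ^ 0)) \<in> polyfun A n (E 0)"
      by (rule polyfun_monom) (auto simp: E_def subring_simps(1)[OF A])
    then show ?case by simp
  next
    case (Suc s)
    have "(\<lambda>t. moore q n t * moore q n t ^ s) \<in> polyfun A n (E (Suc s))"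
      by (rule polyfun_mult[OF A m1 Suc]) (auto simp: E_def sum.distrib add_mono)
    then show ?case by simp
  qed
  have const: "(\<lambda>_. a) \<in> polyfun A n {\<lambda>_. 0}" if "a \<in> A" for a
    using polyfun_monom[OF that, of "\<lambda>_. 0" "{\<lambda>_. 0}" n] by simp
  have scale: "(\<lambda>t. a * \<psi> t) \<in> polyfun A n E'" if "a \<in> A" "\<psi> \<in> polyfun A n E'" for a \<psi> E'
    by (rule polyfun_mult[OF A const[OF that(1)] that(2)]) auto
  have LA: "L ^ s \<in> A" for s unfolding L_def by (rule subring_power[OF A L(1)])
  define Z where "Z = {a. (\<forall>i<n. a i < q ^ n) \<and> (\<exists>i<n. a i \<noteq> q ^ i)}"
  define H where "H = (\<lambda>t. \<Sum>s=1..q - 1. L ^ (q - 1 - s) * moore q n t ^ s)"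
  \<comment> \<open>The part of \<open>H\<close> without the leading monomial of the Moore determinant.\<close>
  define K where "K = (\<lambda>t. L ^ (q - 2) * H' t + (\<Sum>s=2..q - 1. L ^ (q - 1 - s) * moore q n t ^ s))"
  have KZ: "K \<in> polyfun A n Z" unfolding K_def
  proof (intro polyfun_add polyfun_sum scale LA)
    show "H' \<in> polyfun A n Z"
      using le[of _ 1] q_gt_1 by (intro polyfun_mono[OF H'(2)]) (auto simp: Z_def)
    fix s assume s: "s \<in> {2..q - 1}"
    show "(\<lambda>t. moore q n t ^ s) \<in> polyfun A n Z"
    proof (rule polyfun_mono[OF mpow], rule subsetI)
      fix a assume a: "a \<in> E s"
      have "\<exists>i<n. a i \<noteq> q ^ i"
      proof (rule ccontr)
        assume "\<not> ?thesis"
        then have "(\<Sum>i<n. a i) = D" unfolding D_def by (intro sum.cong) auto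
        then show False using a s D0 by (auto simp: E_def)
      qed
      moreover have "a i < q ^ n" if "i < n" for i using a le[of "a i" s] s that by (auto simp: E_def)
      ultimately show "a \<in> Z" by (simp add: Z_def)
    qed
  qed
  have HK: "H = (\<lambda>t. L ^ (q - 2) * (\<Prod>i<n. t i ^ (q ^ i)) + K t)"
  proof
    fix t
    have "{1..q - 1} = insert 1 {2..q - 1}" using q_gt_1 by auto
    then have "H t = L ^ (q - 2) * moore q n t + (\<Sum>s=2..q - 1. L ^ (q - 1 - s) * moore q n t ^ s)"
      unfolding H_def by (simp add: numeral_2_eq_2)
    moreover have "moore q n t = (\<Prod>i<n. t i ^ (q ^ i)) + H' t" by (simp add: H'(1))
    ultimately show "H t = L ^ (q - 2) * (\<Prod>i<n. t i ^ (q ^ i)) + K t" by (simp only: K_def distrib_left add.assoc)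
  qed
  show ?thesis
  proof (rule grid_descent[OF A, where R = "\<lambda>_. lspan x n" and b = "\<lambda>i. q ^ i" and c = "L ^ (q - 2)"
        and u = "inverse L ^ (q - 2)" and H = H and H' = K and \<phi> = \<phi>])
    show "\<exists>\<alpha>. (\<forall>s<card (lspan x n). \<alpha> s \<in> A) \<and>
        (\<forall>t\<in>lspan x n. t ^ card (lspan x n) = (\<Sum>s<card (lspan x n). \<alpha> s * t ^ s))"
      unfolding card_lspan(2)[OF x]
      by (rule exI[of _ "\<lambda>s. \<Sum>l<n. if s = q ^ l then c l else 0"])
         (auto intro!: subring_sum[OF A] c span_relation rel simp: subring_simps(4)[OF A])
    show "K \<in> polyfun A n {a. (\<forall>i<n. a i < card (lspan x n)) \<and> (\<exists>i<n. a i \<noteq> q ^ i)}"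
      using KZ by (simp add: Z_def card_lspan(2)[OF x])
    show "inverse L ^ (q - 2) \<in> A" unfolding L_def by (rule subring_power[OF A L(2)])
    show "inverse L ^ (q - 2) * L ^ (q - 2) = 1" using L0 by (simp flip: power_mult_distrib)
    fix t assume t: "t \<in> PiE {..<n} (\<lambda>_. lspan x n)" and nz: "H t \<noteq> 0"
    then obtain C where C: "C \<in> carrier_mat n n" "\<And>i. i < n \<Longrightarrow> t i = (\<Sum>l<n. \<kappa> (C $$ (i, l)) * x l)"
      using lspan_family_matrix[of n t x] by auto
    have mt: "moore q n t = \<kappa> (det C) * L" using moore_transform[OF C] by (simp add: L_def)
    have "H t = (\<Sum>s=1..q - 1. \<kappa> (det C ^ s) * L ^ (q - 1))"
      unfolding H_def mt
    proof (rule sum.cong[OF refl])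
      fix s assume "s \<in> {1..q - 1}"
      then have "q - 1 = (q - 1 - s) + s" by (simp only: atLeastAtMost_iff) arith
      then have "L ^ (q - 1) = L ^ (q - 1 - s) * L ^ s" by (metis power_add)
      then show "L ^ (q - 1 - s) * (\<kappa> (det C) * L) ^ s = \<kappa> (det C ^ s) * L ^ (q - 1)"
        by (simp add: power_mult_distrib hom_power mult.left_commute)
    qed
    also have "\<dots> = \<kappa> (\<Sum>s=1..q - 1. det C ^ s) * L ^ (q - 1)" by (simp only: hom_sum sum_distrib_right)
    finally have "det C = 1" using nz scalar_power_sum[of "det C"] by auto
    then obtain h where h: "comm_ring_hom h" "\<forall>a\<in>A. h a = a" "h f = f" "\<forall>i<n. h (x i) = t i"
      using inv[OF C(1)] C(2) by auto
    have "\<phi> t = \<phi> (\<lambda>i. h (x i))" using h(4) by (intro polyfun_cong[OF \<phi>(1)]) auto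
    also have "\<dots> = h f" unfolding \<phi>(2) using h by (intro polyfun_hom[OF h(1) _ \<phi>(1), symmetric]) auto
    finally show "\<phi> t = f" using h(3) by simp
  qed (use card_lspan[OF x] lt HK LA \<phi>(1) A in \<open>auto simp: subring_simps\<close>)
qed

subsection \<open>Span polynomials\<close>

lemma frob_1: "(a + b :: 'f) ^ q = a ^ q + b ^ q" "\<kappa> c ^ q = \<kappa> c"
  using frob_add[of a b 1] scalar_frob[of c 1] by simp_all

lemma span_poly_add: "span_poly q z i (s + t) = span_poly q z i s + span_poly q z i (t :: 'f)"
  by (induction i arbitrary: s t) (simp_all add: frob_1 algebra_simps)

lemma span_poly_scale: "span_poly q z i (\<kappa> c * t) = \<kappa> c * span_poly q z i t"
  by (induction i arbitrary: t) (simp_all add: frob_1 power_mult_distrib algebra_simps)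

lemma span_poly_vanish: "v \<in> lspan z i \<Longrightarrow> span_poly q z i v = 0"
proof (induction i arbitrary: v)
  case 0 then show ?case by (simp add: lspan_def)
next
  case (Suc i)
  then obtain u c where v: "v = u + \<kappa> c * z i" and u: "u \<in> lspan z i" using lspan_Suc by blast
  have "span_poly q z (Suc i) u = 0" using Suc.IH[OF u] q_pos by (simp add: power_0_left)
  moreover have "span_poly q z (Suc i) (z i) = 0"
    using q_pos by (simp flip: power_Suc2)
  ultimately show ?case unfolding v span_poly_add span_poly_scale by simp
qed

text \<open>As the \<open>q\<close>-power map is additive, the recursion for the span polynomials becomes one for their
  coefficients, in which no other elements than the values \<open>span_poly q z j (z j)\<close> with \<open>j < i\<close> occur.\<close>

lemma span_poly_expansion:
  fixes A :: "'f set"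
  assumes A: "is_subring A" and N: "\<And>j. j < i \<Longrightarrow> span_poly q z j (z j) \<in> A"
  shows "\<exists>\<gamma>. (\<forall>l. \<gamma> l \<in> A) \<and> \<gamma> i = 1 \<and> (\<forall>t. span_poly q z i t = (\<Sum>l\<le>i. \<gamma> l * t ^ (q ^ l)))"
  using N
proof (induction i)
  case 0
  show ?case by (rule exI[of _ "\<lambda>_. 1"]) (simp add: subring_simps(1)[OF A])
next
  case (Suc i)
  then obtain \<gamma> where \<gamma>: "\<forall>l. \<gamma> l \<in> A" "\<gamma> i = 1" "\<forall>t. span_poly q z i t = (\<Sum>l\<le>i. \<gamma> l * t ^ (q ^ l))"
    by auto
  define N where "N = span_poly q z i (z i) ^ (q - 1)"
  have NA: "N \<in> A" unfolding N_def using Suc.prems[of i] by (intro subring_power[OF A]) auto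
  define \<delta> where "\<delta> = (\<lambda>l. (if l = 0 then 0 else \<gamma> (l - 1) ^ q) - (if l \<le> i then N * \<gamma> l else 0))"
  have "span_poly q z (Suc i) t = (\<Sum>l\<le>Suc i. \<delta> l * t ^ (q ^ l))" for t
  proof -
    have "span_poly q z i t ^ q = (\<Sum>l\<le>i. (\<gamma> l * t ^ (q ^ l)) ^ q)"
      using frob_sum[of "\<lambda>l. \<gamma> l * t ^ (q ^ l)" "{..i}" 1] by (simp add: \<gamma>(3))
    also have "\<dots> = (\<Sum>l\<le>i. \<gamma> l ^ q * t ^ (q ^ Suc l))"
      by (simp only: power_mult_distrib power_Suc2 power_mult)
    also have "\<dots> = (\<Sum>l\<le>Suc i. (if l = 0 then 0 else \<gamma> (l - 1) ^ q) * t ^ (q ^ l))"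
      by (subst sum.atMost_Suc_shift) simp
    finally have 1: "span_poly q z i t ^ q = \<dots>" .
    have 2: "N * span_poly q z i t = (\<Sum>l\<le>Suc i. (if l \<le> i then N * \<gamma> l else 0) * t ^ (q ^ l))"
      by (simp add: \<gamma>(3) sum_distrib_left mult.assoc)
    show ?thesis unfolding span_poly.simps N_def[symmetric] 1 2 \<delta>_def
      by (simp only: left_diff_distrib sum_subtractf)
  qed
  moreover have "\<delta> l \<in> A" for l unfolding \<delta>_def
    using \<gamma>(1) NA by (auto intro!: subring_simps[OF A] subring_power[OF A])
  moreover have "\<delta> (Suc i) = 1" by (simp add: \<delta>_def \<gamma>(2))
  ultimately show ?case by blast
qed

lemma span_poly_hom:
  assumes h: "comm_ring_hom h" and inv: "\<And>j. j < i \<Longrightarrow> h (span_poly q z j (z j)) = span_poly q z j (z j)"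
  shows "h (span_poly q z i t) = span_poly q z i (h t)"
proof -
  interpret h: comm_ring_hom h by (rule h)
  show ?thesis using inv
  proof (induction i arbitrary: t)
    case (Suc i)
    then show ?case by (simp add: h.hom_minus h.hom_mult h.hom_power del: Suc.IH flip: Suc.IH)
  qed simp
qed

text \<open>By induction the coefficients of the \<open>i\<close>-th span polynomial are fixed by \<open>h\<close>, and the change of
  \<open>z i\<close> lies in the span of its predecessors, where the additive polynomial vanishes.\<close>

lemma span_poly_invariant:
  assumes h: "comm_ring_hom h" and tri: "\<And>j. j < n \<Longrightarrow> h (z j) - z j \<in> lspan z j" and i: "i < n"
  shows "h (span_poly q z i (z i)) = span_poly q z i (z i)"
  using i
proof (induction i rule: less_induct)
  case (less i)
  have "h (span_poly q z i (z i)) = span_poly q z i (z i + (h (z i) - z i))"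
    using less by (subst span_poly_hom[OF h]) auto
  also have "\<dots> = span_poly q z i (z i)"
    unfolding span_poly_add using span_poly_vanish[OF tri[OF less.prems]] by simp
  finally show ?case .
qed

text \<open>Multiplying the Moore matrix by the unitriangular matrix of the coefficients of the span polynomials
  gives the matrix of all \<open>span_poly q z i (z j)\<close>, which vanish for \<open>j < i\<close>.\<close>

lemma moore_eq_prod_span_poly:
  fixes z :: "nat \<Rightarrow> 'f"
  shows "moore q n z = (\<Prod>i<n. span_poly q z i (z i))"
proof -
  have U: "is_subring (UNIV :: 'f set)" by (simp add: is_subring_def)
  have "\<exists>\<gamma>. \<gamma> i = 1 \<and> (\<forall>t. span_poly q z i t = (\<Sum>l\<le>i. \<gamma> l * t ^ (q ^ l)))" for i
    using span_poly_expansion[OF U, of i z] by auto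
  then obtain \<gamma> where \<gamma>: "\<And>i. \<gamma> i i = 1" "\<And>i t. span_poly q z i t = (\<Sum>l\<le>i. \<gamma> i l * t ^ (q ^ l))"
    by metis
  define M where "M = mat n n (\<lambda>(j, i). z j ^ (q ^ i))"
  define C where "C = mat n n (\<lambda>(l, i). if l \<le> i then \<gamma> i l else 0)"
  have MC: "M \<in> carrier_mat n n" "C \<in> carrier_mat n n" by (simp_all add: M_def C_def)
  have "det C = det (transpose_mat C)" using det_transpose[OF MC(2)] by simp
  also have "\<dots> = (\<Prod>i<n. transpose_mat C $$ (i, i))"
    by (rule det_lower_triangular_prod) (auto simp: C_def)
  also have "\<dots> = 1" by (rule prod.neutral) (simp add: C_def \<gamma>)
  finally have "moore q n z = det (M * C)" using det_mult[OF MC] by (simp add: moore_def M_def)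
  have entry: "(M * C) $$ (j, i) = span_poly q z i (z j)" if "i < n" "j < n" for i j
  proof -
    have "(M * C) $$ (j, i) = (\<Sum>l<n. if l \<le> i then z j ^ (q ^ l) * \<gamma> i l else 0)"
      using that by (simp add: M_def C_def scalar_prod_def lessThan_atLeast0 if_distrib cong: if_cong)
    also have "\<dots> = (\<Sum>l\<le>i. \<gamma> i l * z j ^ (q ^ l))"
      using that by (intro sum.mono_neutral_cong_right) (auto simp: mult.commute)
    finally show ?thesis by (simp add: \<gamma>(2))
  qed
  have "det (M * C) = (\<Prod>i<n. (M * C) $$ (i, i))"
  proof (rule det_lower_triangular_prod)
    show "M * C \<in> carrier_mat n n" using MC by simp
    fix i j assume ij: "i < j" "j < n"
    then show "(M * C) $$ (i, j) = 0" by (simp add: entry span_poly_vanish lspan_base)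
  qed
  also have "\<dots> = (\<Prod>i<n. span_poly q z i (z i))" by (rule prod.cong) (auto simp: entry)
  finally show ?thesis using \<open>moore q n z = det (M * C)\<close> by simp
qed

text \<open>Here the orbit of \<open>z\<close> under the unitriangular group is itself the grid \<open>\<Prod>\<^sub>i (z i + lspan z i)\<close>, so
  \<open>grid_descent\<close> applies with \<open>H = 1\<close>. The points of the \<open>i\<close>-th factor are the roots of the span
  polynomial minus its value at \<open>z i\<close>.\<close>

lemma unitriangular_descent:
  fixes A :: "'f set"
  assumes A: "is_subring A" and z: "indep z n"
    and N: "\<And>i. i < n \<Longrightarrow> span_poly q z i (z i) \<in> A"
    and f: "f \<in> adjoin A n z"
    and inv: "\<And>t. (\<And>i. i < n \<Longrightarrow> t i - z i \<in> lspan z i) \<Longrightarrow>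
      \<exists>h. comm_ring_hom h \<and> (\<forall>a\<in>A. h a = a) \<and> h f = f \<and> (\<forall>i<n. h (z i) = t i)"
  shows "f \<in> A"
proof -
  obtain \<phi> where \<phi>: "\<phi> \<in> polyfun A n UNIV" "f = \<phi> z" using f by (auto simp: adjoin_def)
  define R where "R = (\<lambda>i. (\<lambda>v. z i + v) ` lspan z i)"
  have R: "finite (R i)" "card (R i) = q ^ i" if "i < n" for i
    using card_lspan[OF indep_mono[OF z, of i]] that by (simp_all add: R_def card_image)
  show ?thesis
  proof (rule grid_descent[OF A, where R = R and b = "\<lambda>_. 0" and c = 1 and u = 1
        and H = "\<lambda>_. 1" and H' = "\<lambda>_. 0" and \<phi> = \<phi>])
    fix i assume i: "i < n"
    obtain \<gamma> where \<gamma>: "\<forall>l. \<gamma> l \<in> A" "\<gamma> i = 1" "\<forall>t. span_poly q z i t = (\<Sum>l\<le>i. \<gamma> l * t ^ (q ^ l))"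
      using span_poly_expansion[OF A, of i z] N i by auto
    define N where "N = span_poly q z i (z i)"
    have NA: "N \<in> A" unfolding N_def by (rule N[OF i])
    define \<alpha> where "\<alpha> = (\<lambda>s. (if s = 0 then N else 0) - (\<Sum>l<i. if s = q ^ l then \<gamma> l else 0))"
    have "t ^ (q ^ i) = (\<Sum>s<q ^ i. \<alpha> s * t ^ s)" if t: "t \<in> R i" for t
    proof -
      obtain v where v: "t = z i + v" "v \<in> lspan z i" using t by (auto simp: R_def)
      have "N = span_poly q z i t" unfolding v(1) span_poly_add N_def using span_poly_vanish[OF v(2)] by simp
      also have "\<dots> = (\<Sum>l<i. \<gamma> l * t ^ (q ^ l)) + t ^ (q ^ i)"
        using \<gamma>(2,3) by (simp flip: lessThan_Suc_atMost)
      finally have "t ^ (q ^ i) = N - (\<Sum>l<i. \<gamma> l * t ^ (q ^ l))" by (simp add: algebra_simps)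
      also have "N = (\<Sum>s<q ^ i. (if s = 0 then N else 0) * t ^ s)"
        using q_pos by (subst sum.remove[of _ 0]) auto
      also have "(\<Sum>l<i. \<gamma> l * t ^ (q ^ l)) = (\<Sum>l<i. \<Sum>s<q ^ i. if s = q ^ l then \<gamma> l * t ^ s else 0)"
        using q_gt_1 by (intro sum.cong refl) (simp add: power_strict_increasing)
      also have "\<dots> = (\<Sum>s<q ^ i. (\<Sum>l<i. if s = q ^ l then \<gamma> l else 0) * t ^ s)"
        by (subst sum.swap) (auto simp: sum_distrib_right intro!: sum.cong)
      finally show ?thesis by (simp only: \<alpha>_def left_diff_distrib sum_subtractf)
    qed
    moreover have "\<alpha> s \<in> A" for s unfolding \<alpha>_def
      using \<gamma>(1) NA by (intro subring_simps(2)[OF A] subring_sum[OF A]) (auto simp: subring_simps(4)[OF A])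
    ultimately show "\<exists>\<alpha>. (\<forall>s<card (R i). \<alpha> s \<in> A) \<and>
        (\<forall>t\<in>R i. t ^ card (R i) = (\<Sum>s<card (R i). \<alpha> s * t ^ s))"
      unfolding R(2)[OF i] by blast
  next
    fix t assume t: "t \<in> PiE {..<n} R"
    have "t i - z i \<in> lspan z i" if "i < n" for i using PiE_mem[OF t, of i] that by (auto simp: R_def)
    then obtain h where h: "comm_ring_hom h" "\<forall>a\<in>A. h a = a" "h f = f" "\<forall>i<n. h (z i) = t i"
      using inv[of t] by auto
    have "\<phi> t = \<phi> (\<lambda>i. h (z i))" using h(4) by (intro polyfun_cong[OF \<phi>(1)]) auto
    also have "\<dots> = h f" unfolding \<phi>(2) using h by (intro polyfun_hom[OF h(1) _ \<phi>(1), symmetric]) auto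
    finally show "\<phi> t = f" using h(3) by simp
  qed (use R q_pos \<phi>(1) A in \<open>auto simp: subring_simps intro: polyfun.zero\<close>)
qed

end

section \<open>Homogeneous polynomials and the ring of polynomials\<close>

text \<open>Homogeneity with a given degree, which unlike bare homogeneity is preserved by sums. The zero
  polynomial has every degree.\<close>

definition has_degree :: "nat \<Rightarrow> 'k::field mpoly \<Rightarrow> bool" where
  "has_degree e p \<longleftrightarrow>
     (\<forall>t \<in> Poly_Mapping.keys p. (\<Sum>v \<in> Poly_Mapping.keys t. Poly_Mapping.lookup t v) = e)"

lemma has_degree_homogeneous: "has_degree e p \<Longrightarrow> homogeneous p"
  by (auto simp: has_degree_def homogeneous_def)

lemma has_degree_0: "has_degree e 0"
  by (simp add: has_degree_def)

lemma has_degree_Const: "has_degree 0 (Const c)"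
  by (simp add: has_degree_def Const_def)

lemma has_degree_1: "has_degree 0 1"
  using has_degree_Const[of 1] by (simp add: Const_1)

lemma has_degree_Var: "has_degree 1 (Var v)"
  by (simp add: has_degree_def Var_def)

lemma has_degree_add: "has_degree e p \<Longrightarrow> has_degree e r \<Longrightarrow> has_degree e (p + r)"
  using Poly_Mapping.keys_add[of p r] unfolding has_degree_def by blast

lemma has_degree_uminus: "has_degree e p \<Longrightarrow> has_degree e (- p)"
  by (simp add: has_degree_def)

lemma has_degree_diff: "has_degree e p \<Longrightarrow> has_degree e r \<Longrightarrow> has_degree e (p - r)"
  using has_degree_add[of e p "- r"] has_degree_uminus by auto

lemma has_degree_sum: "(\<And>i. i \<in> I \<Longrightarrow> has_degree e (f i)) \<Longrightarrow> has_degree e (sum f I)"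
  by (induction I rule: infinite_finite_induct) (auto intro: has_degree_add has_degree_0)

lemma total_degree_add:
  fixes s t :: "nat \<times> nat \<Rightarrow>\<^sub>0 nat"
  shows "(\<Sum>v\<in>Poly_Mapping.keys (s + t). Poly_Mapping.lookup (s + t) v) =
    (\<Sum>v\<in>Poly_Mapping.keys s. Poly_Mapping.lookup s v) + (\<Sum>v\<in>Poly_Mapping.keys t. Poly_Mapping.lookup t v)"
proof -
  let ?A = "Poly_Mapping.keys s \<union> Poly_Mapping.keys t"
  have *: "(\<Sum>v\<in>Poly_Mapping.keys r. Poly_Mapping.lookup r v) = (\<Sum>v\<in>?A. Poly_Mapping.lookup r v)"
    if "Poly_Mapping.keys r \<subseteq> ?A" for r :: "nat \<times> nat \<Rightarrow>\<^sub>0 nat"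
    using that by (intro sum.mono_neutral_left) (auto simp: in_keys_iff)
  show ?thesis
    unfolding *[OF Poly_Mapping.keys_add] *[of s, OF Un_upper1] *[of t, OF Un_upper2]
    by (simp add: lookup_add sum.distrib)
qed

lemma has_degree_mult:
  assumes "has_degree e p" "has_degree e' r"
  shows "has_degree (e + e') (p * r)"
  unfolding has_degree_def
proof
  fix t assume "t \<in> Poly_Mapping.keys (p * r)"
  then obtain u v where "t = u + v" "u \<in> Poly_Mapping.keys p" "v \<in> Poly_Mapping.keys r"
    using keys_mult[of p r] by blast
  then show "(\<Sum>v \<in> Poly_Mapping.keys t. Poly_Mapping.lookup t v) = e + e'"
    using assms by (simp add: total_degree_add has_degree_def)
qed

lemma has_degree_power: "has_degree e p \<Longrightarrow> has_degree (e * s) (p ^ s)"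
  by (induction s) (auto simp: has_degree_1 intro: has_degree_mult)

lemma has_degree_prod: "(\<And>i. i \<in> I \<Longrightarrow> has_degree (e i) (f i)) \<Longrightarrow> has_degree (sum e I) (prod f I)"
  by (induction I rule: infinite_finite_induct) (auto intro: has_degree_mult has_degree_1)

lemma has_degree_signof: "has_degree 0 (signof p)"
  by (auto simp: sign_def has_degree_1 has_degree_uminus)

lemma has_degree_det:
  assumes N: "N \<in> carrier_mat n n" and e: "\<And>i j. i < n \<Longrightarrow> j < n \<Longrightarrow> has_degree (e j) (N $$ (i, j))"
  shows "has_degree (\<Sum>j<n. e j) (det N)"
  unfolding det_def'[OF N]
proof (rule has_degree_sum)
  fix p assume "p \<in> {p. p permutes {0..<n}}"
  then have p: "p permutes {0..<n}" by simp
  have "has_degree (0 + (\<Sum>i = 0..<n. e (p i))) (signof p * (\<Prod>i = 0..<n. N $$ (i, p i)))"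
    using permutes_in_image[OF p] by (intro has_degree_mult has_degree_signof has_degree_prod e) auto
  moreover have "(\<Sum>i = 0..<n. e (p i)) = (\<Sum>j<n. e j)"
    using sum.permute[OF p, of e] by (simp add: o_def lessThan_atLeast0)
  ultimately show "has_degree (\<Sum>j<n. e j) (signof p * (\<Prod>i = 0..<n. N $$ (i, p i)))" by simp
qed

lemma poly_ring_Const: "Const c \<in> poly_ring n m d"
  by (auto simp: poly_ring_def Const_def split: if_splits)

lemma poly_ring_Var: "k < m + d \<Longrightarrow> i < n \<Longrightarrow> Var (k, i) \<in> poly_ring n m d"
  by (auto simp: poly_ring_def Var_def)

lemma poly_ring_subring: "is_subring (poly_ring n m d)"
  unfolding is_subring_def
proof (intro conjI ballI)
  show "1 \<in> poly_ring n m d" using poly_ring_Const[of 1] by (simp add: Const_1)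
next
  fix x y :: "'a mpoly" assume xy: "x \<in> poly_ring n m d" "y \<in> poly_ring n m d"
  have "Poly_Mapping.keys (x - y) \<subseteq> Poly_Mapping.keys x \<union> Poly_Mapping.keys y"
    using Poly_Mapping.keys_add[of x "- y"] by simp
  with xy show "x - y \<in> poly_ring n m d" unfolding poly_ring_def by blast
  show "x * y \<in> poly_ring n m d" unfolding poly_ring_def
  proof (intro CollectI ballI)
    fix t assume "t \<in> Poly_Mapping.keys (x * y)"
    then obtain u v where t: "t = u + v" "u \<in> Poly_Mapping.keys x" "v \<in> Poly_Mapping.keys y"
      using keys_mult[of x y] by blast
    then have "Poly_Mapping.keys u \<subseteq> {..<m + d} \<times> {..<n}" "Poly_Mapping.keys v \<subseteq> {..<m + d} \<times> {..<n}"
      using xy by (auto simp: poly_ring_def)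
    then show "Poly_Mapping.keys t \<subseteq> {..<m + d} \<times> {..<n}"
      unfolding t using Poly_Mapping.keys_add[of u v] by blast
  qed
qed

lemma poly_expand:
  "p = (\<Sum>t\<in>Poly_Mapping.keys p. Const (Poly_Mapping.lookup p t) *
         (\<Prod>v\<in>Poly_Mapping.keys t. Var v ^ Poly_Mapping.lookup t v))"
  using poly_subst_Var_id[of p] by (simp add: poly_subst_def)

lemma to_fract_prod: "to_fract (prod f I) = (\<Prod>i\<in>I. to_fract (f i))"
  by (induction I rule: infinite_finite_induct) auto

lemma to_fract_power: "to_fract (p ^ e) = to_fract p ^ e"
  by (induction e) auto

lemma to_fract_hom: "comm_ring_hom to_fract"
  by unfold_locales auto

lemma poly_ring_generated:
  assumes S: "is_subring S" and C: "\<And>c. to_fract (Const c) \<in> S"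
    and V: "\<And>k i. k < m + d \<Longrightarrow> i < n \<Longrightarrow> to_fract (Var (k, i)) \<in> S"
    and p: "p \<in> poly_ring n m d"
  shows "to_fract p \<in> S"
proof -
  have "to_fract (Var v) \<in> S" if "t \<in> Poly_Mapping.keys p" "v \<in> Poly_Mapping.keys t" for t v
    using V[of "fst v" "snd v"] p that by (force simp: poly_ring_def)
  then show ?thesis
    by (subst poly_expand) (auto simp: to_fract_prod to_fract_power
      intro!: subring_sum[OF S] subring_simps(3)[OF S] subring_prod[OF S] subring_power[OF S] C)
qed

definition scalar :: "'k::field \<Rightarrow> 'k mpoly fract" where
  "scalar c = to_fract (Const c)"

definition xvar :: "nat \<Rightarrow> nat \<Rightarrow> 'k::field mpoly fract" where
  "xvar k i = to_fract (Var (k, i))"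

lemma Const_eq_iff: "Const c = Const e \<longleftrightarrow> c = e"
  by (metis Const_def lookup_single_eq)

interpretation scalar: finite_subfield "scalar :: 'k::{field, finite} \<Rightarrow> 'k mpoly fract" "CARD('k)"
  by unfold_locales
     (auto simp: scalar_def Const_0 Const_1 Const_add Const_mult)

lemma xvar_independent: "scalar.indep (xvar k :: nat \<Rightarrow> 'k::{field, finite} mpoly fract) n"
  unfolding scalar.indep_def
proof (intro allI impI)
  fix c :: "nat \<Rightarrow> 'k" and j assume eq: "(\<Sum>j<n. scalar (c j) * xvar k j) = 0" and j: "j < n"
  have "to_fract (\<Sum>j<n. Const (c j) * Var (k, j)) = 0"
    using eq by (simp add: scalar_def xvar_def)
  then have "(\<Sum>j<n. Const (c j) * Var (k, j)) = 0" by (simp only: to_fract_eq_0_iff)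
  then have "Poly_Mapping.lookup (\<Sum>l<n. Const (c l) * Var (k, l)) (Poly_Mapping.single (k, j) 1) = 0" by simp
  moreover have "Const (c l) * Var (k, l) = Poly_Mapping.single (Poly_Mapping.single (k, l) 1) (c l)" for l
    by (simp add: Const_def Var_def mult_single)
  moreover have "Poly_Mapping.single (k, l) (1::nat) = Poly_Mapping.single (k, j) 1 \<longleftrightarrow> l = j" for l
    by (metis lookup_single_eq lookup_single_not_eq one_neq_zero prod.inject)
  ultimately show "c j = 0" using j
    by (simp add: Poly_Mapping.lookup_sum lookup_single when_def)
qed

section \<open>The general linear group as a matrix group\<close>

locale linear_invariants =
  fixes scale :: "'k::{field, finite} \<Rightarrow> 'w::ab_group_add \<Rightarrow> 'w"
    and n :: nat and b :: "nat \<Rightarrow> 'w" and m d :: nat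
  assumes V: "vector_space scale" and B: "ordered_basis scale n b"
begin

abbreviation GLW :: "('w \<Rightarrow> 'w) set" where "GLW \<equiv> carrier (GL scale)"
abbreviation act :: "('w \<Rightarrow> 'w) \<Rightarrow> 'k mpoly \<Rightarrow> 'k mpoly" where "act \<equiv> poly_act scale n b m d"
abbreviation ract :: "('w \<Rightarrow> 'w) \<Rightarrow> 'k mpoly fract \<Rightarrow> 'k mpoly fract" where "ract \<equiv> rat_act scale n b m d"

lemma GL_D: "g \<in> GLW \<Longrightarrow> Vector_Spaces.linear scale scale g" "g \<in> GLW \<Longrightarrow> bij g"
  by (auto simp: GL_def)

lemma GL_inverse:
  assumes "g \<in> GLW"
  shows "inv_into UNIV g \<in> GLW" "g \<circ> inv_into UNIV g = id" "inv_into UNIV g \<circ> g = id"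
    "inv_into UNIV (inv_into UNIV g) = g"
  using GL_inv[OF V assms] GL_D(2)[OF assms]
  by (auto simp: bij_is_surj surj_iff[symmetric] bij_is_inj inv_inv_eq)

lemma linear_comp:
  assumes "Vector_Spaces.linear scale scale g" "Vector_Spaces.linear scale scale h"
  shows "Vector_Spaces.linear scale scale (g \<circ> h)"
  by (rule Vector_Spaces.linear_compose[OF assms(2,1)])

lemma GL_comp: "g \<in> GLW \<Longrightarrow> h \<in> GLW \<Longrightarrow> g \<circ> h \<in> GLW"
  by (auto simp: GL_def bij_comp linear_comp)

lemma linear_ident: "Vector_Spaces.linear scale scale id"
  using vector_space.linear_id[OF V] by (simp add: id_def)

lemma GL_id: "id \<in> GLW"
  using linear_ident by (simp add: GL_def)

lemma GL_group: "group (GL scale)"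
proof (rule groupI)
  fix g assume "g \<in> GLW"
  then show "\<exists>h\<in>GLW. h \<otimes>\<^bsub>GL scale\<^esub> g = \<one>\<^bsub>GL scale\<^esub>"
    using GL_inverse[of g] by (intro bexI[of _ "inv_into UNIV g"]) (auto simp: GL_def)
qed (use GL_comp GL_id in \<open>auto simp: GL_def\<close>)

definition matr :: "('w \<Rightarrow> 'w) \<Rightarrow> 'k mat" where
  "matr g = mat n n (\<lambda>(i, j). coord scale n b i (g (b j)))"

lemma matr_carrier [simp]: "matr g \<in> carrier_mat n n" by (simp add: matr_def)

lemma matr_comp:
  assumes "Vector_Spaces.linear scale scale g"
  shows "matr (g \<circ> h) = matr g * matr h"
  by (intro eq_matI)
     (auto simp: matr_def scalar_prod_def lessThan_atLeast0 coord_linear_sum[OF V B assms, of _ "h (b _)"] mult.commute)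

lemma matr_id: "matr id = 1\<^sub>m n"
  by (intro eq_matI) (auto simp: matr_def coord_b[OF V B])

lemma matr_eqD:
  assumes "Vector_Spaces.linear scale scale g" "Vector_Spaces.linear scale scale h" "matr g = matr h"
  shows "g = h"
proof
  fix w
  have "coord scale n b i (g w) = coord scale n b i (h w)" if i: "i < n" for i
  proof -
    have "coord scale n b i (g (b j)) = coord scale n b i (h (b j))" if "j < n" for j
      using arg_cong[OF assms(3), of "\<lambda>M. M $$ (i, j)"] i that by (simp add: matr_def)
    then show ?thesis
      using i by (simp add: coord_linear_sum[OF V B assms(1), of i w] coord_linear_sum[OF V B assms(2), of i w])
  qed
  then show "g w = h w"
    by (subst (1 2) combination_coord[OF V B]) simp
qed

definition linmap :: "'k mat \<Rightarrow> 'w \<Rightarrow> 'w" where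
  "linmap C w = (\<Sum>i<n. scale (\<Sum>j<n. C $$ (i, j) * coord scale n b j w) (b i))"

lemma linmap_linear: "Vector_Spaces.linear scale scale (linmap C)"
proof -
  interpret vector_space scale by (rule V)
  from B have ind: "independent (b ` {..<n})" and sp: "span (b ` {..<n}) = UNIV"
    by (auto simp: ordered_basis_def)
  have c: "coord scale n b j (u + v) = coord scale n b j u + coord scale n b j v"
    "coord scale n b j (scale r u) = r * coord scale n b j u" for j u v r
    by (simp_all add: coord_def representation_add[OF ind] representation_scale[OF ind] sp)
  show ?thesis
    by unfold_locales
       (simp_all add: linmap_def c distrib_left sum.distrib scale_left_distrib scale_sum_right
         sum_distrib_left mult.left_commute)
qed

lemma matr_linmap: "C \<in> carrier_mat n n \<Longrightarrow> matr (linmap C) = C"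
  by (intro eq_matI) (auto simp: matr_def linmap_def coord_combination[OF V B] coord_b[OF V B]
    if_distrib[of "\<lambda>x. _ * x"] cong: if_cong)

lemma linmap_GL:
  assumes C: "C \<in> carrier_mat n n" and d: "det C \<noteq> 0"
  shows "linmap C \<in> GLW"
proof -
  obtain D where D: "D \<in> carrier_mat n n" "C * D = 1\<^sub>m n" "D * C = 1\<^sub>m n"
    using det_non_zero_imp_unit[OF C d, of "()"] by (auto simp: Units_def ring_mat_def)
  have "linmap C \<circ> linmap D = id" "linmap D \<circ> linmap C = id"
    using C D by (intro matr_eqD linear_comp linmap_linear linear_ident;
      simp add: matr_comp linmap_linear matr_linmap matr_id)+
  then have "bij (linmap C)" by (intro o_bij)
  then show ?thesis using linmap_linear by (simp add: GL_def)
qed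

lemma matr_inv:
  assumes g: "g \<in> GLW"
  shows "matr g * matr (inv_into UNIV g) = 1\<^sub>m n" "matr (inv_into UNIV g) * matr g = 1\<^sub>m n"
  using matr_comp[OF GL_D(1)[OF g], of "inv_into UNIV g"] GL_inverse[OF g]
    matr_comp[OF GL_D(1)[OF GL_inverse(1)[OF g]], of g] by (simp_all add: matr_id)

lemma finite_GL: "finite GLW"
proof -
  interpret vector_space scale by (rule V)
  have "(UNIV :: 'w set) \<subseteq> (\<lambda>c. \<Sum>j<n. scale (c j) (b j)) ` PiE {..<n} (\<lambda>_. UNIV)"
  proof
    fix w
    have "w = (\<Sum>j<n. scale (restrict (\<lambda>j. coord scale n b j w) {..<n} j) (b j))"
      using combination_coord[OF V B, of w] by simp
    then show "w \<in> (\<lambda>c. \<Sum>j<n. scale (c j) (b j)) ` PiE {..<n} (\<lambda>_. UNIV)"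
      by (intro image_eqI[of _ _ "restrict (\<lambda>j. coord scale n b j w) {..<n}"]) auto
  qed
  then have "finite (UNIV :: 'w set)" by (rule finite_subset) (intro finite_imageI finite_PiE; simp)
  then have "finite (PiE (UNIV :: 'w set) (\<lambda>_. UNIV :: 'w set))" by (intro finite_PiE) auto
  then show ?thesis by (rule finite_subset[rotated]) auto
qed

subsection \<open>The action on variables\<close>

text \<open>The matrix by which \<open>g\<close> transforms the coordinate functions on the \<open>k\<close>-th copy; see \<open>act_Var\<close>. On a
  copy of \<open>W\<close> a coordinate function is composed with \<open>g\<^sup>-\<^sup>1\<close>, on a copy of the dual it is evaluation at
  a basis vector and hence transforms like the vector itself.\<close>

definition copy_matr :: "nat \<Rightarrow> ('w \<Rightarrow> 'w) \<Rightarrow> 'k mat" where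
  "copy_matr k g = (if k < m then matr (inv_into UNIV g) else transpose_mat (matr g))"

lemma copy_matr_carrier [simp]: "copy_matr k g \<in> carrier_mat n n"
  by (simp add: copy_matr_def)

lemma act_Var:
  assumes g: "g \<in> GLW" and k: "k < m + d" and i: "i < n"
  shows "act g (Var (k, i)) = (\<Sum>j<n. Const (copy_matr k g $$ (i, j)) * Var (k, j))"
  using k i GL_inverse(4)[OF g]
  by (auto simp: poly_act_def poly_subst_Var var_act_def copy_matr_def matr_def dual_act_def intro!: sum.cong)

lemma act_hom: "comm_ring_hom (act g)"
  by unfold_locales (auto simp: poly_act_def poly_subst_add poly_subst_mult poly_subst_1 poly_subst_0)

lemma ract_hom:
  assumes g: "g \<in> GLW"
  shows "comm_ring_hom (ract g)"
proof -
  interpret a: comm_ring_hom "act g" by (rule act_hom)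
  note F = rat_act_Fract[OF V B g]
  have nz: "act g r \<noteq> 0" if "r \<noteq> 0" for r
  proof
    assume "act g r = 0"
    then have "act (inv_into UNIV g) (act g r) = 0" by (simp add: poly_act_def poly_subst_0)
    then show False using that GL_inverse[OF g] g
      by (simp add: poly_act_comp[OF V B] poly_act_id[OF V B])
  qed
  show ?thesis
  proof
    show "ract g 0 = 0" using F[of 1 m d 0] by (simp add: Zero_fract_def eq_fract a.hom_one)
    show "ract g 1 = 1" using F[of 1 m d 1] by (simp add: One_fract_def a.hom_one)
    fix y z :: "'k mpoly fract"
    obtain p r s t where yz: "y = Fract p r" "z = Fract s t" "r \<noteq> 0" "t \<noteq> 0" by (metis Fract_cases)
    show "ract g (y + z) = ract g y + ract g z" "ract g (y * z) = ract g y * ract g z"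
      using yz nz by (simp_all add: F a.hom_add a.hom_mult)
  qed
qed

lemma ract_to_fract: "g \<in> GLW \<Longrightarrow> ract g (to_fract p) = to_fract (act g p)"
  using rat_act_Fract[OF V B, of g 1 m d p]
  by (simp add: to_fract_def poly_act_def poly_subst_1)

lemma ract_scalar: "g \<in> GLW \<Longrightarrow> ract g (scalar c) = scalar c"
  by (simp add: scalar_def ract_to_fract poly_act_def poly_subst_Const)

lemma ract_comp: "g \<in> GLW \<Longrightarrow> h \<in> GLW \<Longrightarrow> ract g (ract h y) = ract (g \<circ> h) y"
proof -
  assume gh: "g \<in> GLW" "h \<in> GLW"
  obtain p r where y: "y = Fract p r" "r \<noteq> 0" by (metis Fract_cases)
  interpret a: comm_ring_hom "act h" by (rule act_hom)
  have nz: "act h r \<noteq> 0"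
  proof
    assume "act h r = 0"
    then have "act (inv_into UNIV h) (act h r) = 0" by (simp add: poly_act_def poly_subst_0)
    then show False using y GL_inverse[OF gh(2)] gh
      by (simp add: poly_act_comp[OF V B] poly_act_id[OF V B])
  qed
  show ?thesis unfolding y
    using gh nz y by (simp add: rat_act_Fract[OF V B] GL_comp poly_act_comp[OF V B])
qed

lemma ract_id: "ract id y = y"
proof -
  obtain p r where "y = Fract p r" "r \<noteq> 0" by (metis Fract_cases)
  then show ?thesis by (simp add: rat_act_Fract[OF V B GL_id] poly_act_id[OF V B])
qed

lemma ract_xvar:
  assumes "g \<in> GLW" "k < m + d" "i < n"
  shows "ract g (xvar k i) = (\<Sum>j<n. scalar (copy_matr k g $$ (i, j)) * xvar k j)"
  using assms by (simp add: xvar_def scalar_def ract_to_fract act_Var)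

lemma base_transitive:
  assumes C: "C \<in> carrier_mat n n" "det C \<noteq> 0"
  shows "\<exists>g\<in>GLW. copy_matr k g = C"
proof (cases "k < m")
  case True
  have "inv_into UNIV (linmap C) \<in> GLW" "inv_into UNIV (inv_into UNIV (linmap C)) = linmap C"
    using GL_inverse[OF linmap_GL[OF C]] by auto
  then show ?thesis using True C
    by (intro bexI[of _ "inv_into UNIV (linmap C)"]) (auto simp: copy_matr_def matr_linmap)
next
  case False
  have "linmap (transpose_mat C) \<in> GLW" using C by (intro linmap_GL) (auto simp: det_transpose)
  then show ?thesis using False C
    by (intro bexI[of _ "linmap (transpose_mat C)"]) (auto simp: copy_matr_def matr_linmap)
qed

lemma copy_matr_det: "g \<in> GLW \<Longrightarrow> det (copy_matr k g) \<noteq> 0"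
  using matr_inv[of g] det_mult[of "matr g" n "matr (inv_into UNIV g)"]
  by (auto simp: copy_matr_def det_transpose[of _ n])

lemma SL_iff:
  assumes g: "g \<in> GLW"
  shows "g \<in> SL scale n b \<longleftrightarrow> det (copy_matr k g) = 1"
proof -
  have "det (matr g) * det (matr (inv_into UNIV g)) = 1"
    using matr_inv[OF g] det_mult[of "matr g" n "matr (inv_into UNIV g)"] by simp
  then show ?thesis using g by (auto simp: SL_def matr_def[symmetric] copy_matr_def det_transpose[of _ n])
qed

lemma copy_matr_same: "k < m \<longleftrightarrow> l < m \<Longrightarrow> copy_matr k g = copy_matr l g"
  by (simp add: copy_matr_def)

text \<open>The coordinate functions on \<open>W\<close> and on its dual transform contragrediently to each other.\<close>

lemma copy_matr_opposite:
  assumes g: "g \<in> GLW" and kl: "k < m \<longleftrightarrow> \<not> l < m"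
  shows "transpose_mat (copy_matr k g) * copy_matr l g = 1\<^sub>m n"
proof (cases "l < m")
  case True then show ?thesis using kl matr_inv(1)[OF g] by (simp add: copy_matr_def)
next
  case False
  then have "transpose_mat (copy_matr k g) * copy_matr l g = transpose_mat (matr g * matr (inv_into UNIV g))"
    using kl by (simp add: copy_matr_def transpose_mult[of _ n n _ n])
  then show ?thesis using matr_inv(1)[OF g] by simp
qed

lemma copy_matr_inj:
  assumes "g \<in> GLW" "h \<in> GLW" "copy_matr k g = copy_matr k h"
  shows "g = h"
proof (cases "k < m")
  case True
  then have "inv_into UNIV g = inv_into UNIV h"
    using assms GL_inverse GL_D by (intro matr_eqD) (auto simp: copy_matr_def)
  then show ?thesis using GL_inverse(4) assms by metis
next
  case False
  then have "matr g = matr h" using assms by (simp add: copy_matr_def)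
  then show ?thesis using assms GL_D by (intro matr_eqD) auto
qed

end

section \<open>Sylow subgroups are unitriangular groups\<close>

lemma group_actionI:
  assumes G: "group \<Gamma>"
    and closed: "\<And>g s. g \<in> carrier \<Gamma> \<Longrightarrow> s \<in> E \<Longrightarrow> a g s \<in> E"
    and one: "\<And>s. s \<in> E \<Longrightarrow> a \<one>\<^bsub>\<Gamma>\<^esub> s = s"
    and mult: "\<And>g h s. g \<in> carrier \<Gamma> \<Longrightarrow> h \<in> carrier \<Gamma> \<Longrightarrow> s \<in> E \<Longrightarrow> a (g \<otimes>\<^bsub>\<Gamma>\<^esub> h) s = a g (a h s)"
  shows "group_action \<Gamma> E (\<lambda>g. \<lambda>s\<in>E. a g s)"
proof -
  interpret group \<Gamma> by (rule G)
  have bij: "(\<lambda>s\<in>E. a g s) \<in> Bij E" if g: "g \<in> carrier \<Gamma>" for g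
  proof -
    have "bij_betw (a g) E E"
    proof (rule bij_betw_byWitness[where f' = "a (inv\<^bsub>\<Gamma>\<^esub> g)"])
      show "\<forall>s\<in>E. a (inv\<^bsub>\<Gamma>\<^esub> g) (a g s) = s" "\<forall>s\<in>E. a g (a (inv\<^bsub>\<Gamma>\<^esub> g) s) = s"
        using g by (simp_all add: mult[symmetric] one)
      show "a g ` E \<subseteq> E" "a (inv\<^bsub>\<Gamma>\<^esub> g) ` E \<subseteq> E" using g closed by auto
    qed
    then show ?thesis by (simp add: Bij_def bij_betw_restrict_eq)
  qed
  have "(\<lambda>g. \<lambda>s\<in>E. a g s) \<in> hom \<Gamma> (BijGroup E)"
  proof (rule homI)
    fix g h assume gh: "g \<in> carrier \<Gamma>" "h \<in> carrier \<Gamma>"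
    then show "(\<lambda>s\<in>E. a (g \<otimes>\<^bsub>\<Gamma>\<^esub> h) s) = (\<lambda>s\<in>E. a g s) \<otimes>\<^bsub>BijGroup E\<^esub> (\<lambda>s\<in>E. a h s)"
      using bij closed mult by (auto simp: BijGroup_def compose_def fun_eq_iff restrict_def)
  qed (simp add: bij BijGroup_def)
  then show ?thesis
    by (intro group_action.intro group_hom.intro group_hom_axioms.intro G group_BijGroup)
qed

text \<open>Orbits other than fixed points have a size divisible by \<open>p\<close>. As \<open>card E\<close> is divisible by \<open>p\<close>, so
  is the number of fixed points, and there cannot be just one of them.\<close>

lemma p_group_fixed_point:
  assumes act: "group_action \<Gamma> E \<phi>" and fin: "finite E" and p: "prime p" "Coset.order \<Gamma> = p ^ r"
    and dvd: "p dvd card E" and s0: "s0 \<in> E" "\<And>g. g \<in> carrier \<Gamma> \<Longrightarrow> \<phi> g s0 = s0"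
  shows "\<exists>s\<in>E. s \<noteq> s0 \<and> (\<forall>g\<in>carrier \<Gamma>. \<phi> g s = s)"
proof (rule ccontr)
  assume neg: "\<not> ?thesis"
  interpret group_action \<Gamma> E \<phi> by (rule act)
  interpret G: group \<Gamma> using group_hom by (simp add: group_hom_def)
  have orb0: "orbit \<Gamma> \<phi> s0 = {s0}" 
  proof
    show "orbit \<Gamma> \<phi> s0 \<subseteq> {s0}" using s0(2) by (auto simp: orbit_def)
    show "{s0} \<subseteq> orbit \<Gamma> \<phi> s0" using orbit_refl[OF s0(1)] by simp
  qed
  have fo: "finite (orbits \<Gamma> E \<phi>)" using fin by (simp add: orbits_def)
  have "p dvd card X" if X: "X \<in> orbits \<Gamma> E \<phi> - {{s0}}" for X
  proof -
    obtain s where s: "s \<in> E" "X = orbit \<Gamma> \<phi> s" using X by (auto simp: orbits_def)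
    have "s \<noteq> s0" using X s orb0 by auto
    have "card X dvd p ^ r" using orbit_stabilizer_theorem[OF s(1)] s(2) p(2) by (metis dvd_triv_left)
    then obtain j where j: "card X = p ^ j" using divides_primepow_nat[OF p(1)] by blast
    have "j \<noteq> 0"
    proof
      assume "j = 0"
      then obtain y where "X = {y}" using j card_1_singletonE by auto
      moreover have "s \<in> X" using orbit_refl s by auto
      ultimately have X: "X = {s}" by auto
      have "\<phi> g s = s" if "g \<in> carrier \<Gamma>" for g
      proof -
        have "\<phi> g s \<in> X" using that s(2) by (auto simp: orbit_def)
        then show ?thesis using X by simp
      qed
      then show False using neg s(1) \<open>s \<noteq> s0\<close> by auto
    qed
    then show ?thesis using j by simp
  qed
  then have S: "p dvd (\<Sum>X\<in>orbits \<Gamma> E \<phi> - {{s0}}. card X)" by (rule dvd_sum)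
  moreover have "card E = (\<Sum>X\<in>orbits \<Gamma> E \<phi>. card X)"
    using disjoint_sum[OF fin, of "\<lambda>_. 1 :: nat"] by simp
  moreover have "{s0} \<in> orbits \<Gamma> E \<phi>" using s0(1) orb0 by (auto simp: orbits_def)
  ultimately have "card E = 1 + (\<Sum>X\<in>orbits \<Gamma> E \<phi> - {{s0}}. card X)"
    using fo by (simp add: sum.remove)
  then have "p dvd 1" using dvd dvd_add_left_iff[OF S] by metis
  then show False using p(1) by simp
qed

context finite_subfield
begin

lemma lspan_hom:
  assumes h: "comm_ring_hom h" and s: "\<And>c. h (\<kappa> c) = \<kappa> c" and z: "\<And>j. j < i \<Longrightarrow> h (z j) \<in> lspan y l"
    and v: "v \<in> lspan z i"
  shows "h v \<in> lspan y l"
proof -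
  interpret h: comm_ring_hom h by (rule h)
  obtain c where v: "v = (\<Sum>j<i. \<kappa> (c j) * z j)" using v by (auto simp: lspan_def)
  have "h v = (\<Sum>j<i. \<kappa> (c j) * h (z j))" unfolding v by (simp add: h.hom_sum h.hom_mult s)
  also have "\<dots> \<in> lspan y l" using z by (intro lspan_sum lspan_scale) auto
  finally show ?thesis .
qed

lemma lspan_cong: "(\<And>j. j < i \<Longrightarrow> z j = y j) \<Longrightarrow> lspan z i = lspan y i"
  by (simp add: lspan_def)

lemma indep_cong: "(\<And>j. j < i \<Longrightarrow> z j = y j) \<Longrightarrow> indep z i = indep y i"
  by (simp add: indep_def)

lemma lspan_eq_of_indep:
  assumes x: "indep x n" and z: "indep z n" and zx: "\<And>i. i < n \<Longrightarrow> z i \<in> lspan x n"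
  shows "lspan z n = lspan x n"
  using card_lspan[OF x] card_lspan[OF z] by (intro card_subset_eq lspan_subset zx) auto

lemma lspan_translate: "u \<in> lspan z i \<Longrightarrow> (\<lambda>v. u + v) ` lspan z i = lspan z i"
proof (intro subset_antisym subsetI)
  fix v assume u: "u \<in> lspan z i" and v: "v \<in> lspan z i"
  show "v \<in> (\<lambda>v. u + v) ` lspan z i" using lspan_diff[OF v u] by (intro image_eqI[of _ _ "v - u"]) auto
qed (auto intro: lspan_add)

end

context linear_invariants
begin

abbreviation "xv \<equiv> (xvar 0 :: nat \<Rightarrow> 'k mpoly fract)"

lemma ract_diff: "g \<in> GLW \<Longrightarrow> ract g (y - z) = ract g y - ract g z"
  and ract_add: "g \<in> GLW \<Longrightarrow> ract g (y + z) = ract g y + ract g z"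
proof -
  assume g: "g \<in> GLW"
  interpret h: comm_ring_hom "ract g" by (rule ract_hom[OF g])
  show "ract g (y - z) = ract g y - ract g z" "ract g (y + z) = ract g y + ract g z"
    by (simp_all add: h.hom_minus h.hom_add)
qed

lemma ract_inj: "g \<in> GLW \<Longrightarrow> ract g y = ract g z \<Longrightarrow> y = z"
  by (metis GL_inverse(1,3) ract_comp ract_id)

lemma ract_lspan_xv:
  assumes g: "g \<in> GLW" and md: "0 < m + d" and v: "v \<in> scalar.lspan xv n"
  shows "ract g v \<in> scalar.lspan xv n"
proof (rule scalar.lspan_hom[OF ract_hom[OF g] ract_scalar[OF g] _ v])
  fix j assume "j < n"
  then show "ract g (xv j) \<in> scalar.lspan xv n"
    using ract_xvar[OF g md, of j] by (simp add: scalar.lspanI)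
qed

text \<open>The matrix expressing \<open>t\<close> by the coordinate functions is invertible because the Moore determinant of \<open>t\<close>
  is nonzero.\<close>

lemma transitive_xv:
  assumes md: "0 < m + d" and t: "scalar.indep t n" "\<And>i. i < n \<Longrightarrow> t i \<in> scalar.lspan xv n"
  shows "\<exists>g\<in>GLW. \<forall>i<n. ract g (xv i) = t i"
proof -
  obtain C where C: "C \<in> carrier_mat n n" "\<And>i. i < n \<Longrightarrow> t i = (\<Sum>l<n. scalar (C $$ (i, l)) * xv l)"
    using scalar.lspan_family_matrix[of n t xv] t(2) by auto
  have "det C \<noteq> 0" using scalar.moore_nonzero[OF t(1)] scalar.moore_transform[OF C] by auto
  then obtain g where "g \<in> GLW" "copy_matr 0 g = C" using base_transitive[OF C(1), of 0] by auto
  then show ?thesis using ract_xvar[of g 0] md C(2) by (intro bexI[of _ g]) auto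
qed

lemma transitive_family:
  assumes md: "0 < m + d" and t: "scalar.indep t n" "\<And>i. i < n \<Longrightarrow> t i \<in> scalar.lspan xv n"
    and z: "scalar.indep z n" "\<And>i. i < n \<Longrightarrow> z i \<in> scalar.lspan xv n"
  shows "\<exists>g\<in>GLW. \<forall>i<n. ract g (z i) = t i"
proof -
  obtain g where g: "g \<in> GLW" "\<forall>i<n. ract g (xv i) = t i" using transitive_xv[OF md t] by blast
  obtain h where h: "h \<in> GLW" "\<forall>i<n. ract h (xv i) = z i" using transitive_xv[OF md z] by blast
  have "ract (g \<circ> inv_into UNIV h) (z i) = t i" if "i < n" for i
  proof -
    have "ract (inv_into UNIV h) (z i) = ract (inv_into UNIV h) (ract h (xv i))" using h that by simp
    also have "\<dots> = xv i" using h by (simp add: ract_comp GL_inverse ract_id)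
    finally show ?thesis using g that by (simp add: ract_comp[symmetric] GL_inverse h)
  qed
  then show ?thesis using g h by (intro bexI[of _ "g \<circ> inv_into UNIV h"]) (auto intro: GL_comp GL_inverse)
qed

lemma ract_faithful:
  assumes md: "0 < m + d" and z: "scalar.indep z n" "\<And>i. i < n \<Longrightarrow> z i \<in> scalar.lspan xv n"
    and g: "g \<in> GLW" and h: "h \<in> GLW" and eq: "\<And>i. i < n \<Longrightarrow> ract g (z i) = ract h (z i)"
  shows "g = h"
proof -
  have ex: "ract g (xv i) = ract h (xv i)" if i: "i < n" for i
  proof -
    have "xv i \<in> scalar.lspan z n"
      using scalar.lspan_eq_of_indep[OF xvar_independent z] scalar.lspan_base[OF i, of xv] by blast
    then obtain c where c: "xv i = (\<Sum>j<n. scalar (c j) * z j)" by (auto simp: scalar.lspan_def)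
    interpret g: comm_ring_hom "ract g" by (rule ract_hom[OF g])
    interpret h: comm_ring_hom "ract h" by (rule ract_hom[OF h])
    show ?thesis unfolding c using g h eq
      by (simp add: g.hom_sum g.hom_mult h.hom_sum h.hom_mult ract_scalar)
  qed
  have "copy_matr 0 g $$ (i, j) = copy_matr 0 h $$ (i, j)" if ij: "i < n" "j < n" for i j
  proof -
    have "(\<Sum>j<n. scalar (copy_matr 0 g $$ (i, j) - copy_matr 0 h $$ (i, j)) * xv j) = 0"
      using ex[OF ij(1)] ract_xvar[OF g md ij(1)] ract_xvar[OF h md ij(1)]
      by (simp add: scalar.hom_minus left_diff_distrib sum_subtractf)
    then have "copy_matr 0 g $$ (i, j) - copy_matr 0 h $$ (i, j) = 0"
      using xvar_independent[of 0 n, unfolded scalar.indep_def, rule_format,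
        of "\<lambda>j. copy_matr 0 g $$ (i, j) - copy_matr 0 h $$ (i, j)" j] ij(2) by blast
    then show ?thesis by simp
  qed
  then have "copy_matr 0 g = copy_matr 0 h" by (intro eq_matI) (auto simp: copy_matr_def matr_def)
  then show ?thesis using copy_matr_inj g h by blast
qed

text \<open>A \<open>p\<close>-group acting on the cosets of \<open>U = lspan z i\<close> in the space \<open>V\<close> of linear forms fixes the coset
  \<open>U\<close>. The number of cosets is a positive power of \<open>q\<close>, so it also fixes another coset \<open>v + U\<close>.\<close>

lemma flag_step:
  assumes md: "0 < m + d" and P: "subgroup P (GL scale)" and card: "card P = CHAR('k) ^ r"
    and z: "scalar.indep z i" "\<And>j. j < i \<Longrightarrow> z j \<in> scalar.lspan xv n" and i: "i < n"
    and tri: "\<And>g j. g \<in> P \<Longrightarrow> j < i \<Longrightarrow> ract g (z j) - z j \<in> scalar.lspan z j"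
  shows "\<exists>v\<in>scalar.lspan xv n - scalar.lspan z i. \<forall>g\<in>P. ract g v - v \<in> scalar.lspan z i"
proof -
  define V where "V = scalar.lspan xv n"
  define U where "U = scalar.lspan z i"
  define cos where "cos = (\<lambda>v. (\<lambda>u. v + u) ` U)"
  define E where "E = cos ` V"
  have PG: "g \<in> GLW" if "g \<in> P" for g using subgroup.mem_carrier[OF P that] .
  have V: "finite V" "card V = CARD('k) ^ n" unfolding V_def by (rule scalar.card_lspan[OF xvar_independent])+
  have U: "finite U" "card U = CARD('k) ^ i" unfolding U_def by (rule scalar.card_lspan[OF z(1)])+
  have UV: "U \<subseteq> V" unfolding U_def V_def by (rule scalar.lspan_subset[OF z(2)])
  have gU: "ract g ` U = U" if g: "g \<in> P" for g
  proof (rule card_subset_eq[OF U(1)])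
    show "ract g ` U \<subseteq> U"
    proof
      fix y assume "y \<in> ract g ` U"
      then obtain u where u: "y = ract g u" "u \<in> U" by blast
      have "ract g (z j) \<in> U" if j: "j < i" for j
      proof -
        have "ract g (z j) = (ract g (z j) - z j) + z j" by simp
        also have "\<dots> \<in> U" unfolding U_def
          using tri[OF g j] scalar.lspan_mono[of j i z] j by (intro scalar.lspan_add scalar.lspan_base) auto
        finally show ?thesis .
      qed
      then show "y \<in> U" unfolding u(1) U_def
        by (rule scalar.lspan_hom[OF ract_hom[OF PG[OF g]] ract_scalar[OF PG[OF g]] _ u(2)[unfolded U_def]])
    qed
    show "card (ract g ` U) = card U"
      using ract_inj[OF PG[OF g]] by (intro card_image inj_onI)
  qed
  have gcos: "ract g ` cos v = cos (ract g v)" if g: "g \<in> P" for g v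
  proof -
    have "ract g ` cos v = (\<lambda>u. ract g v + u) ` (ract g ` U)"
      unfolding cos_def image_image by (simp add: ract_add PG[OF g])
    then show ?thesis by (simp add: gU[OF g] cos_def)
  qed
  have cos_eq: "cos v = cos w \<longleftrightarrow> v - w \<in> U" for v w
  proof
    assume "cos v = cos w"
    moreover have "v \<in> cos v" using scalar.lspan_0 by (force simp: cos_def U_def)
    ultimately obtain u where "v = w + u" "u \<in> U" by (auto simp: cos_def)
    then show "v - w \<in> U" by simp
  next
    assume vw: "v - w \<in> U"
    have "cos v = (\<lambda>u. w + u) ` (\<lambda>u. (v - w) + u) ` U" by (simp add: cos_def image_image)
    also have "\<dots> = cos w" using scalar.lspan_translate[of "v - w" z i] vw by (simp add: U_def cos_def)
    finally show "cos v = cos w" .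
  qed
  have "card U * card E = card (\<Union>E)"
  proof (rule card_partition)
    show "finite E" using V by (simp add: E_def)
    show "finite (\<Union>E)" using V U by (auto simp: E_def cos_def)
    show "card c = card U" if "c \<in> E" for c using that by (auto simp: E_def cos_def card_image)
    fix c c' assume c: "c \<in> E" "c' \<in> E" "c \<noteq> c'"
    show "c \<inter> c' = {}"
    proof (rule ccontr)
      assume "c \<inter> c' \<noteq> {}"
      then obtain y where y: "y \<in> c" "y \<in> c'" by blast
      obtain v w where vw: "c = cos v" "c' = cos w" using c by (auto simp: E_def)
      obtain u where u: "y = v + u" "u \<in> U" using y(1) by (auto simp: vw cos_def)
      obtain u' where u': "y = w + u'" "u' \<in> U" using y(2) by (auto simp: vw cos_def)
      have *: "c = cos v" "c' = cos w" "v + u = w + u'" "u \<in> U" "u' \<in> U" using vw u u' by simp_all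
      have "v - w = u' - u" using *(3) by (simp add: algebra_simps)
      then have "v - w \<in> U" using scalar.lspan_diff *(4,5) unfolding U_def by metis
      then show False using c * cos_eq by simp
    qed
  qed
  moreover have "\<Union>E = V"
  proof
    show "\<Union>E \<subseteq> V" using UV by (auto simp: E_def cos_def V_def intro!: scalar.lspan_add)
    show "V \<subseteq> \<Union>E" using scalar.lspan_0[of z i] by (force simp: E_def cos_def U_def)
  qed
  ultimately have cE: "CARD('k) ^ i * card E = CARD('k) ^ i * CARD('k) ^ (n - i)"
    using V U i by (simp flip: power_add)
  then have cE: "card E = CARD('k) ^ (n - i)" using scalar.q_pos[where 'k = 'k] by simp
  have "CHAR('k) dvd CARD('k)"
  proof -
    obtain e where e: "CARD('k) = CHAR('k) ^ e" using card_finite_field_CHAR_power by blast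
    then have "e \<noteq> 0" using card_finite_field_ge_2[where 'k = 'k] by (intro notI) simp
    then show ?thesis using e by simp
  qed
  then have dvd: "CHAR('k) dvd card E" unfolding cE using i
    by (meson dvd_power dvd_trans zero_less_diff)
  define \<Gamma> where "\<Gamma> = (GL scale)\<lparr>carrier := P\<rparr>"
  have \<Gamma>: "group \<Gamma>" unfolding \<Gamma>_def by (rule subgroup.subgroup_is_group[OF P GL_group])
  have \<Gamma>s: "carrier \<Gamma> = P" "\<one>\<^bsub>\<Gamma>\<^esub> = id" "\<And>g h. g \<otimes>\<^bsub>\<Gamma>\<^esub> h = g \<circ> h" by (simp_all add: \<Gamma>_def GL_def)
  have act: "group_action \<Gamma> E (\<lambda>g. \<lambda>X\<in>E. ract g ` X)"
  proof (rule group_actionI[OF \<Gamma>])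
    show "ract g ` X \<in> E" if "g \<in> carrier \<Gamma>" "X \<in> E" for g X
      using that ract_lspan_xv[OF PG md] gcos by (auto simp: \<Gamma>s E_def V_def)
    show "ract \<one>\<^bsub>\<Gamma>\<^esub> ` X = X" for X by (simp add: \<Gamma>s ract_id)
    show "ract (g \<otimes>\<^bsub>\<Gamma>\<^esub> h) ` X = ract g ` ract h ` X" if "g \<in> carrier \<Gamma>" "h \<in> carrier \<Gamma>" for g h X
      using that by (simp add: \<Gamma>s image_image ract_comp PG)
  qed
  have U0: "cos 0 = U" by (simp add: cos_def)
  have "\<exists>X\<in>E. X \<noteq> U \<and> (\<forall>g\<in>carrier \<Gamma>. (\<lambda>X\<in>E. ract g ` X) X = X)"
  proof (rule p_group_fixed_point[OF act _ prime_CHAR_finite_field _ dvd])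
    show "finite E" using V by (simp add: E_def)
    show "Coset.order \<Gamma> = CHAR('k) ^ r" by (simp add: Coset.order_def \<Gamma>s card)
    show UE: "U \<in> E" using U0 scalar.lspan_0 by (auto simp: E_def V_def)
    show "(\<lambda>X\<in>E. ract g ` X) U = U" if "g \<in> carrier \<Gamma>" for g using that UE gU by (simp add: \<Gamma>s)
  qed
  then obtain v where v: "v \<in> V" "cos v \<noteq> U" "\<forall>g\<in>P. ract g ` cos v = cos v"
    by (auto simp: E_def \<Gamma>s)
  have "v \<notin> U" using v(2) cos_eq[of v 0] U0 by auto
  moreover have "ract g v - v \<in> U" if "g \<in> P" for g using v(3) that gcos cos_eq by metis
  ultimately show ?thesis using v(1) unfolding U_def V_def by blast
qed

lemma p_subgroup_flag:
  assumes md: "0 < m + d" and P: "subgroup P (GL scale)" and card: "card P = CHAR('k) ^ r"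
  shows "\<exists>z. scalar.indep z n \<and> (\<forall>i<n. z i \<in> scalar.lspan xv n) \<and>
    (\<forall>g\<in>P. \<forall>i<n. ract g (z i) - z i \<in> scalar.lspan z i)"
proof -
  have "\<exists>z. scalar.indep z i \<and> (\<forall>j<i. z j \<in> scalar.lspan xv n) \<and>
    (\<forall>g\<in>P. \<forall>j<i. ract g (z j) - z j \<in> scalar.lspan z j)" if "i \<le> n" for i
    using that
  proof (induction i)
    case 0 then show ?case by (auto simp: scalar.indep_def)
  next
    case (Suc i)
    then obtain z where z: "scalar.indep z i" "\<forall>j<i. z j \<in> scalar.lspan xv n"
      "\<forall>g\<in>P. \<forall>j<i. ract g (z j) - z j \<in> scalar.lspan z j" by auto
    obtain v where v: "v \<in> scalar.lspan xv n" "v \<notin> scalar.lspan z i" "\<forall>g\<in>P. ract g v - v \<in> scalar.lspan z i"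
      using flag_step[OF md P card z(1)] z Suc.prems by auto
    define z' where "z' = z(i := v)"
    have sp: "scalar.lspan z' j = scalar.lspan z j" if "j \<le> i" for j
      using that by (intro scalar.lspan_cong) (simp add: z'_def)
    have "scalar.indep z' i" using z(1) scalar.indep_cong[of i z' z] by (simp add: z'_def)
    then have "scalar.indep z' (Suc i)" using sp[of i] v(2) by (intro scalar.indep_Suc) (auto simp: z'_def)
    moreover have "\<forall>j<Suc i. z' j \<in> scalar.lspan xv n" using z(2) v(1) by (auto simp: z'_def less_Suc_eq)
    moreover have "\<forall>g\<in>P. \<forall>j<Suc i. ract g (z' j) - z' j \<in> scalar.lspan z' j"
      using z(3) v(3) sp by (auto simp: z'_def less_Suc_eq)
    ultimately show ?case by blast
  qed
  then show ?thesis by blast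
qed

text \<open>The stabiliser of the flag spanned by \<open>z\<close> that acts trivially on its factors.\<close>

definition unitriangular :: "(nat \<Rightarrow> 'k mpoly fract) \<Rightarrow> ('w \<Rightarrow> 'w) set" where
  "unitriangular z = {g \<in> GLW. \<forall>i<n. ract g (z i) - z i \<in> scalar.lspan z i}"

lemma unitriangular_transitive:
  assumes md: "0 < m + d" and z: "scalar.indep z n" "\<And>i. i < n \<Longrightarrow> z i \<in> scalar.lspan xv n"
    and t: "\<And>i. i < n \<Longrightarrow> t i - z i \<in> scalar.lspan z i"
  shows "\<exists>g\<in>unitriangular z. \<forall>i<n. ract g (z i) = t i"
proof -
  have sp: "scalar.lspan t n = scalar.lspan z n" by (rule scalar.unitriangular_span[OF t]) auto
  then have "scalar.indep t n" using scalar.card_lspan[OF z(1)] by (intro scalar.indep_if_card) simp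
  moreover have "t i \<in> scalar.lspan xv n" if "i < n" for i
    using scalar.lspan_base[OF that, of t] sp scalar.lspan_eq_of_indep[OF xvar_independent z] by blast
  ultimately obtain g where "g \<in> GLW" "\<forall>i<n. ract g (z i) = t i" using transitive_family[OF md _ _ z] by blast
  then show ?thesis using t by (intro bexI[of _ g]) (auto simp: unitriangular_def)
qed

text \<open>A unitriangular map is determined by the differences \<open>g z\<^sub>i - z\<^sub>i\<close>, which can be prescribed
  freely in the spans.\<close>

lemma card_unitriangular:
  assumes md: "0 < m + d" and z: "scalar.indep z n" "\<And>i. i < n \<Longrightarrow> z i \<in> scalar.lspan xv n"
  shows "card (unitriangular z) = CARD('k) ^ (\<Sum>i<n. i)"
proof -
  let ?f = "\<lambda>g. \<lambda>i\<in>{..<n}. ract g (z i) - z i"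
  have "bij_betw ?f (unitriangular z) (PiE {..<n} (\<lambda>i. scalar.lspan z i))"
  proof (rule bij_betw_imageI)
    show "inj_on ?f (unitriangular z)"
    proof (rule inj_onI)
      fix g h assume g: "g \<in> unitriangular z" and h: "h \<in> unitriangular z" and eq: "?f g = ?f h"
      have "ract g (z i) = ract h (z i)" if "i < n" for i using fun_cong[OF eq, of i] that by simp
      then show "g = h" using g h by (intro ract_faithful[OF md z]) (auto simp: unitriangular_def)
    qed
    show "?f ` unitriangular z = PiE {..<n} (\<lambda>i. scalar.lspan z i)"
    proof
      show "PiE {..<n} (\<lambda>i. scalar.lspan z i) \<subseteq> ?f ` unitriangular z"
      proof
        fix v assume v: "v \<in> PiE {..<n} (\<lambda>i. scalar.lspan z i)"
        then have "(z i + v i) - z i \<in> scalar.lspan z i" if "i < n" for i using that by (auto simp: PiE_mem)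
        then obtain g where g: "g \<in> unitriangular z" "\<forall>i<n. ract g (z i) = z i + v i"
          using unitriangular_transitive[OF md z, of "\<lambda>i. z i + v i"] by blast
        have "v i = ?f g i" for i
        proof (cases "i < n")
          case True then show ?thesis using g(2) by simp
        next
          case False
          then have "v i = undefined" by (intro PiE_arb[OF v]) simp
          then show ?thesis using False by simp
        qed
        then have "v = ?f g" by (rule ext)
        then show "v \<in> ?f ` unitriangular z" using g(1) by (rule image_eqI)
      qed
    qed (auto simp: unitriangular_def split: if_splits)
  qed
  then have "card (unitriangular z) = card (PiE {..<n} (\<lambda>i. scalar.lspan z i))" by (rule bij_betw_same_card)
  also have "\<dots> = (\<Prod>i<n. card (scalar.lspan z i))" by (simp add: card_PiE)
  also have "\<dots> = (\<Prod>i<n. CARD('k) ^ i)"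
    using scalar.card_lspan(2)[OF scalar.indep_mono[OF z(1)]] by (intro prod.cong) auto
  finally show ?thesis by (simp add: power_sum)
qed

text \<open>Inverses come for free: composition with \<open>g\<close> is an injection of the finite set of unitriangular
  maps into itself, so the identity is in its image.\<close>

lemma unitriangular_subgroup:
  assumes md: "0 < m + d"
  shows "subgroup (unitriangular z) (GL scale)"
proof -
  let ?U = "unitriangular z"
  have id: "id \<in> ?U" by (simp add: unitriangular_def GL_id ract_id scalar.lspan_0)
  have comp: "g \<circ> h \<in> ?U" if g: "g \<in> ?U" and h: "h \<in> ?U" for g h
  proof -
    have G: "g \<in> GLW" "h \<in> GLW" using g h by (auto simp: unitriangular_def)
    have "ract (g \<circ> h) (z i) - z i \<in> scalar.lspan z i" if i: "i < n" for i
    proof -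
      have gj: "ract g (z j) \<in> scalar.lspan z i" if j: "j < i" for j
      proof -
        have "ract g (z j) = (ract g (z j) - z j) + z j" by simp
        also have "\<dots> \<in> scalar.lspan z i"
        proof (rule scalar.lspan_add)
          show "ract g (z j) - z j \<in> scalar.lspan z i"
            using g i j scalar.lspan_mono[of j i z] by (auto simp: unitriangular_def)
        qed (rule scalar.lspan_base[OF j])
        finally show ?thesis .
      qed
      have "ract g (ract h (z i) - z i) \<in> scalar.lspan z i"
      proof (rule scalar.lspan_hom[OF ract_hom[OF G(1)] ract_scalar[OF G(1)] gj])
        show "ract h (z i) - z i \<in> scalar.lspan z i" using h i by (simp add: unitriangular_def)
      qed
      then have "ract g (ract h (z i) - z i) + (ract g (z i) - z i) \<in> scalar.lspan z i"
        using g i by (intro scalar.lspan_add) (auto simp: unitriangular_def)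
      then show ?thesis using G by (simp add: ract_diff ract_comp)
    qed
    then show ?thesis using GL_comp[OF G] by (simp add: unitriangular_def)
  qed
  have inv: "inv_into UNIV g \<in> ?U" if g: "g \<in> ?U" for g
  proof -
    have G: "g \<in> GLW" using g by (auto simp: unitriangular_def)
    have "finite ?U" using finite_GL by (auto simp: unitriangular_def)
    moreover have "(\<lambda>h. g \<circ> h) ` ?U \<subseteq> ?U" using comp[OF g] by auto
    moreover have "inj_on (\<lambda>h. g \<circ> h) ?U"

    proof (intro inj_onI ext)
      fix h h' w assume "g \<circ> h = g \<circ> h'"
      from fun_cong[OF this, of w] show "h w = h' w"
        using bij_is_inj[OF GL_D(2)[OF G]] by (simp add: inj_eq)
    qed
    ultimately have "(\<lambda>h. g \<circ> h) ` ?U = ?U" by (rule endo_inj_surj)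
    then obtain h where h: "h \<in> ?U" "g \<circ> h = id" using id by (metis imageE)
    have "inv_into UNIV g = inv_into UNIV g \<circ> (g \<circ> h)" by (simp add: h(2))
    also have "\<dots> = h" by (simp only: comp_assoc[symmetric] GL_inverse(3)[OF G] id_comp)
    finally have "inv_into UNIV g = h" .
    then show ?thesis using h by simp
  qed
  interpret group "GL scale" by (rule GL_group)
  show ?thesis
  proof (rule subgroupI)
    show "?U \<subseteq> GLW" by (auto simp: unitriangular_def)
    show "?U \<noteq> {}" using id by auto
    fix g assume g: "g \<in> ?U"
    then have G: "g \<in> GLW" by (auto simp: unitriangular_def)
    have "inv\<^bsub>GL scale\<^esub> g = inv_into UNIV g"
      using G GL_inverse[OF G] by (intro inv_equality) (auto simp: GL_def)
    then show "inv\<^bsub>GL scale\<^esub> g \<in> ?U" using inv[OF g] by simp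
    fix h assume "h \<in> ?U"
    then show "g \<otimes>\<^bsub>GL scale\<^esub> h \<in> ?U" using comp[OF g] by (simp add: GL_def)
  qed
qed

text \<open>A \<open>p\<close>-subgroup stabilises a flag, so it is contained in the unitriangular group of a flag basis. That
  group has \<open>p\<close>-power order, which divides the order of the general linear group and hence is at most
  the order of a Sylow subgroup.\<close>

theorem sylow_unitriangular:
  assumes md: "0 < m + d" and P: "sylow_subgroup CHAR('k) (GL scale) P"
  shows "\<exists>z. scalar.indep z n \<and> (\<forall>i<n. z i \<in> scalar.lspan xv n) \<and> P = unitriangular z"
proof -
  define p where "p = CHAR('k)"
  have p: "prime p" unfolding p_def by (rule prime_CHAR_finite_field)
  have sub: "subgroup P (GL scale)" and card: "card P = p ^ multiplicity p (Coset.order (GL scale))"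
    using P by (auto simp: sylow_subgroup_def p_def)
  obtain z where z: "scalar.indep z n" "\<forall>i<n. z i \<in> scalar.lspan xv n"
    "\<forall>g\<in>P. \<forall>i<n. ract g (z i) - z i \<in> scalar.lspan z i"
    using p_subgroup_flag[OF md sub card[unfolded p_def]] by blast
  have PU: "P \<subseteq> unitriangular z" using z(3) subgroup.mem_carrier[OF sub] by (auto simp: unitriangular_def)
  obtain e where e: "CARD('k) = p ^ e" unfolding p_def using card_finite_field_CHAR_power by blast
  have cU: "card (unitriangular z) = p ^ (e * (\<Sum>i<n. i))"
    using card_unitriangular[OF md z(1)] z(2) e by (simp add: power_mult)
  have "card (unitriangular z) dvd Coset.order (GL scale)"
    using group.lagrange[OF GL_group unitriangular_subgroup[OF md, of z]] by (metis dvd_triv_right)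
  moreover have "Coset.order (GL scale) \<noteq> 0"
    using finite_GL GL_id by (auto simp: Coset.order_def)
  ultimately have "e * (\<Sum>i<n. i) \<le> multiplicity p (Coset.order (GL scale))"
    unfolding cU using p by (intro multiplicity_geI) (auto simp: prime_gt_1_nat)
  then have "card (unitriangular z) \<le> card P" unfolding card cU
    using prime_gt_1_nat[OF p] by (intro power_increasing) auto
  moreover have "finite (unitriangular z)" using finite_GL by (auto simp: unitriangular_def)
  ultimately have "P = unitriangular z" using PU by (intro card_seteq) auto
  then show ?thesis using z by blast
qed

end

section \<open>Generated rings and fields\<close>

lemma is_subring_hull: "is_subring (is_subring hull S)"
  by (rule hull_in) (auto simp: is_subring_def)

lemma is_subfield_hull: "is_subfield (is_subfield hull S)"
  by (rule hull_in) (auto simp: is_subfield_def is_subring_def)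

lemma adjoin_minimal:
  assumes S: "is_subring S" and A: "A \<subseteq> S" and x: "\<And>i. i < n \<Longrightarrow> x i \<in> S"
  shows "adjoin A n x \<subseteq> S"
proof -
  have "\<psi> x \<in> S" if "\<psi> \<in> polyfun A n UNIV" for \<psi>
    using that
  proof (induction rule: polyfun.induct)
    case (add_monom \<psi> c a)
    have "c * (\<Prod>i<n. x i ^ a i) \<in> S"
      using add_monom A x by (intro subring_simps(3)[OF S] subring_prod[OF S] subring_power[OF S]) auto
    then show ?case using add_monom by (intro subring_simps(6)[OF S])
  qed (simp add: subring_simps(4)[OF S])
  then show ?thesis by (auto simp: adjoin_def)
qed

section \<open>Moore determinants and span polynomials under homomorphisms\<close>

lemma det_hom: "comm_ring_hom h \<Longrightarrow> N \<in> carrier_mat n n \<Longrightarrow> h (det N) = det (mat n n (\<lambda>(i, j). h (N $$ (i, j))))"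
proof -
  assume h: "comm_ring_hom h" and N: "N \<in> carrier_mat n n"
  have "map_mat h N = mat n n (\<lambda>(i, j). h (N $$ (i, j)))" using N by (intro eq_matI) auto
  then show ?thesis using comm_ring_hom.hom_det[OF h, of N] by simp
qed

lemma comm_ring_hom_power: "comm_ring_hom h \<Longrightarrow> h (y ^ e) = h y ^ e"
proof -
  assume "comm_ring_hom h"
  then interpret h: comm_ring_hom h .
  show ?thesis by (rule h.hom_power)
qed

lemma moore_hom:
  assumes h: "comm_ring_hom h"
  shows "h (moore q n z) = moore q n (\<lambda>i. h (z i))"
  unfolding moore_def
  by (subst det_hom[OF h, of _ n]) (auto simp: comm_ring_hom_power[OF h] intro!: arg_cong[of _ _ det] eq_matI)

lemma moore_col_hom:
  assumes h: "comm_ring_hom h"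
  shows "h (moore_col q n z w k) = moore_col q n (\<lambda>i. h (z i)) (\<lambda>i. h (w i)) k"
  unfolding moore_col_def
  by (subst det_hom[OF h, of _ n]) (auto simp: comm_ring_hom_power[OF h] intro!: arg_cong[of _ _ det] eq_matI)

lemma span_poly_map:
  assumes h: "comm_ring_hom h"
  shows "h (span_poly q z i t) = span_poly q (\<lambda>i. h (z i)) i (h t)"
proof -
  interpret h: comm_ring_hom h by (rule h)
  show ?thesis by (induction i arbitrary: t) (simp_all add: h.hom_minus h.hom_mult h.hom_power)
qed

lemma has_degree_moore:
  assumes "\<And>i. i < n \<Longrightarrow> has_degree 1 (z i)"
  shows "has_degree (\<Sum>i<n. q ^ i) (moore q n z)"
  unfolding moore_def
proof (rule has_degree_det)
  fix i j assume "i < n" "j < n"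
  then show "has_degree (q ^ j) (mat n n (\<lambda>(j, i). z j ^ (q ^ i)) $$ (i, j))"
    using has_degree_power[OF assms, of i "q ^ j"] by simp
qed simp

lemma has_degree_moore_col:
  assumes "\<And>i. i < n \<Longrightarrow> has_degree 1 (z i)" "\<And>i. i < n \<Longrightarrow> has_degree e (w i)"
  shows "has_degree (\<Sum>i<n. if i = k then e else q ^ i) (moore_col q n z w k)"
  unfolding moore_col_def
proof (rule has_degree_det)
  fix i j assume "i < n" "j < n"
  then show "has_degree (if j = k then e else q ^ j) (mat n n (\<lambda>(j, i). if i = k then w j else z j ^ (q ^ i)) $$ (i, j))"
    using has_degree_power[OF assms(1), of i "q ^ j"] assms(2)[of i] by simp
qed simp

lemma has_degree_span_poly:
  assumes q: "q > 0" and z: "\<And>j. j < i \<Longrightarrow> has_degree 1 (z j)" and t: "has_degree 1 t"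
  shows "has_degree (q ^ i) (span_poly q z i t)"
  using z t
proof (induction i arbitrary: t)
  case (Suc i)
  have 1: "has_degree (q ^ i) (span_poly q z i t)" "has_degree (q ^ i) (span_poly q z i (z i))"
    using Suc by auto
  have "q ^ i * (q - 1) + q ^ i = q ^ Suc i" using q by (cases q) auto
  then have "has_degree (q ^ Suc i) (span_poly q z i (z i) ^ (q - 1) * span_poly q z i t)"
    using has_degree_mult[OF has_degree_power[OF 1(2), of "q - 1"] 1(1)] by simp
  moreover have "has_degree (q ^ Suc i) (span_poly q z i t ^ q)"
    using has_degree_power[OF 1(1), of q] by (simp add: mult.commute)
  ultimately show ?case by (simp add: has_degree_diff)
qed simp

lemma subring_moore: "is_subring S \<Longrightarrow> (\<And>i. i < n \<Longrightarrow> z i \<in> S) \<Longrightarrow> moore q n z \<in> S"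
  unfolding moore_def by (rule subring_det[of _ _ n]) (auto intro: subring_power)

lemma subring_moore_col:
  "is_subring S \<Longrightarrow> (\<And>i. i < n \<Longrightarrow> z i \<in> S) \<Longrightarrow> (\<And>i. i < n \<Longrightarrow> w i \<in> S) \<Longrightarrow> moore_col q n z w k \<in> S"
  unfolding moore_col_def by (rule subring_det[of _ _ n]) (auto intro: subring_power)

lemma subring_span_poly:
  "is_subring S \<Longrightarrow> (\<And>j. j < i \<Longrightarrow> z j \<in> S) \<Longrightarrow> t \<in> S \<Longrightarrow> span_poly q z i t \<in> S"
  by (induction i arbitrary: t) (auto intro!: subring_simps(2,3) subring_power)

context finite_subfield
begin

lemma frob_hom: "comm_ring_hom (\<lambda>y :: 'f. y ^ q)"
  using q_pos by unfold_locales (auto simp: frob_1 power_mult_distrib)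

text \<open>The columns \<open>x ^ (q ^ n), x ^ q, \<dots>, x ^ (q ^ (n - 1))\<close> are a cyclic permutation of the columns of the
  Moore matrix of the vectors \<open>x i ^ q\<close>.\<close>

lemma moore_col_frob:
  fixes x :: "nat \<Rightarrow> 'f"
  assumes n: "n > 0"
  shows "moore_col q n x (\<lambda>i. x i ^ (q ^ n)) 0 \<in> {moore q n x ^ q, - (moore q n x ^ q)}"
proof -
  define p where "p = (\<lambda>i. if i = 0 then n - 1 else if i < n then i - 1 else i)"
  have p: "p permutes {0..<n}"
  proof (rule bij_imp_permutes)
    show "bij_betw p {0..<n} {0..<n}"
      by (rule bij_betw_byWitness[where f' = "\<lambda>i. if i = n - 1 then 0 else Suc i"])
         (use n in \<open>auto simp: p_def\<close>)
  qed (use n in \<open>auto simp: p_def\<close>)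
  define N where "N = mat n n (\<lambda>(i, j). x j ^ (q ^ Suc i))"
  have N: "N \<in> carrier_mat n n" by (simp add: N_def)
  have "moore q n x ^ q = moore q n (\<lambda>i. x i ^ q)" by (rule moore_hom[OF frob_hom])
  also have "\<dots> = det (transpose_mat N)"
    unfolding moore_def by (intro arg_cong[of _ _ det] eq_matI) (auto simp: N_def power_mult)
  also have "\<dots> = det N" by (rule det_transpose[OF N])
  finally have 1: "det N = moore q n x ^ q" by simp
  let ?P = "mat n n (\<lambda>(i, j). N $$ (p i, j))"
  have "transpose_mat ?P = mat n n (\<lambda>(j, i). if i = 0 then x j ^ (q ^ n) else x j ^ (q ^ i))"
    using n by (intro eq_matI) (auto simp: N_def p_def simp flip: power_Suc)
  then have "moore_col q n x (\<lambda>i. x i ^ (q ^ n)) 0 = det (transpose_mat ?P)" by (simp add: moore_col_def)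
  also have "\<dots> = det ?P" by (rule det_transpose[of _ n]) simp
  also have "\<dots> = signof p * det N" by (rule det_permute_rows[OF N p])
  finally show ?thesis using 1 by (auto simp: sign_def)
qed

lemma scalar_power_order: "c \<noteq> 0 \<Longrightarrow> (c :: 'k) ^ (q - 1) = 1"
proof -
  assume c: "c \<noteq> 0"
  have "c * c ^ (q - 1) = c ^ q" using q_pos by (simp flip: power_Suc)
  also have "\<dots> = c * 1" by (simp add: q_card finite_field_power_card)
  finally show ?thesis using c by simp
qed

end

section \<open>Invariant polynomials and fractions\<close>

context linear_invariants
begin

abbreviation Xp :: "nat \<Rightarrow> 'k mpoly" where "Xp \<equiv> \<lambda>i. Var (0, i)"
abbreviation Lp :: "'k mpoly" where "Lp \<equiv> moore CARD('k) n Xp"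

lemma scalars_eq: "scalars = range scalar"
  by (simp add: scalars_def scalar_def)

lemma act_poly_ring:
  assumes g: "g \<in> GLW" and p: "p \<in> poly_ring n m d"
  shows "act g p \<in> poly_ring n m d"
proof -
  note R = poly_ring_subring[where n = n and m = m and d = d and ?'a = 'k]
  have v: "var_act scale n b m d g v \<in> poly_ring n m d" if vn: "v \<in> {..<m + d} \<times> {..<n}" for v
  proof -
    obtain k i where ki: "v = (k, i)" "k < m + d" "i < n" using vn by (cases v) auto
    have "var_act scale n b m d g v = act g (Var v)" by (simp add: poly_act_def poly_subst_Var)
    also have "\<dots> \<in> poly_ring n m d"
      unfolding ki(1) act_Var[OF g ki(2,3)]
      using ki by (intro subring_sum[OF R] subring_simps(3)[OF R] poly_ring_Const poly_ring_Var) auto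
    finally show ?thesis .
  qed
  show ?thesis unfolding poly_act_def poly_subst_def
  proof (intro subring_sum[OF R] subring_simps(3)[OF R] poly_ring_Const subring_prod[OF R] subring_power[OF R] v)
    fix t v assume "t \<in> Poly_Mapping.keys p" "v \<in> Poly_Mapping.keys t"
    then show "v \<in> {..<m + d} \<times> {..<n}" using p by (auto simp: poly_ring_def)
  qed
qed

lemma act_eqI: "g \<in> GLW \<Longrightarrow> ract g (to_fract p) = to_fract p \<Longrightarrow> act g p = p"
  by (simp add: ract_to_fract)

lemma poly_invariants_subring:
  "is_subring (poly_invariants scale n b m d G)"
proof -
  note R = poly_ring_subring[where n = n and m = m and d = d and ?'a = 'k]
  have "act g (x - y) = act g x - act g y \<and> act g (x * y) = act g x * act g y \<and> act g 1 = 1" for g x y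
  proof -
    interpret h: comm_ring_hom "act g" by (rule act_hom)
    show ?thesis by (simp add: h.hom_minus h.hom_mult)
  qed
  then show ?thesis unfolding is_subring_def poly_invariants_def
    using subring_simps(1-3)[OF R] by simp
qed

lemma subring_image: "comm_ring_hom h \<Longrightarrow> is_subring S \<Longrightarrow> is_subring (h ` S)"
proof -
  assume "comm_ring_hom h" and S: "is_subring S"
  then interpret h: comm_ring_hom h by simp
  show ?thesis unfolding is_subring_def
  proof (intro conjI ballI)
    show "1 \<in> h ` S" using subring_simps(1)[OF S] h.hom_one by (metis imageI)
    fix u v assume "u \<in> h ` S" "v \<in> h ` S"
    then obtain x y where "u = h x" "v = h y" "x \<in> S" "y \<in> S" by auto
    then show "u - v \<in> h ` S" "u * v \<in> h ` S"
      using subring_simps(2,3)[OF S] h.hom_minus[of x y] h.hom_mult[of x y] by (metis imageI)+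
  qed
qed

lemma ract_inverse:
  assumes g: "g \<in> GLW"
  shows "ract g (inverse y) = inverse (ract g y)"
proof -
  interpret h: comm_ring_hom "ract g" by (rule ract_hom[OF g])
  show ?thesis
  proof (cases "y = 0")
    case False
    then have "ract g y * ract g (inverse y) = 1" by (simp flip: h.hom_mult)
    then show ?thesis by (metis inverse_unique)
  qed simp
qed

lemma fixed_subfield:
  assumes G: "G \<subseteq> GLW"
  shows "is_subfield {y. \<forall>g\<in>G. ract g y = y}"
proof -
  have "ract g 1 = 1 \<and> ract g (y - z) = ract g y - ract g z \<and> ract g (y * z) = ract g y * ract g z"
    if "g \<in> G" for g y z
  proof -
    interpret h: comm_ring_hom "ract g" using that G by (intro ract_hom) auto
    show ?thesis by (simp add: h.hom_minus h.hom_mult)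
  qed
  then show ?thesis using ract_inverse G by (auto simp: is_subfield_def is_subring_def subset_iff)
qed

lemma rat_field_subfield: "is_subfield (rat_field n m d :: 'k mpoly fract set)"
proof -
  note R = poly_ring_subring[where n = n and m = m and d = d and ?'a = 'k]
  have I: "to_fract p / to_fract r \<in> rat_field n m d" if "p \<in> poly_ring n m d" "r \<in> poly_ring n m d" "r \<noteq> 0" for p r :: "'k mpoly"
    using that by (auto simp: rat_field_def Fract_conv_to_fract)
  have E: "\<exists>p r. y = to_fract p / to_fract r \<and> p \<in> poly_ring n m d \<and> r \<in> poly_ring n m d \<and> r \<noteq> 0"
    if "y \<in> rat_field n m d" for y :: "'k mpoly fract" using that by (auto simp: rat_field_def Fract_conv_to_fract)
  show ?thesis unfolding is_subfield_def is_subring_def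
  proof (intro conjI ballI)
    show "(1 :: 'k mpoly fract) \<in> rat_field n m d" using I[of 1 1] subring_simps(1)[OF R] by simp
    fix y :: "'k mpoly fract" assume y: "y \<in> rat_field n m d"
    then obtain p r where p: "y = to_fract p / to_fract r" "p \<in> poly_ring n m d" "r \<in> poly_ring n m d" "r \<noteq> 0"
      using E by blast
    show "inverse y \<in> rat_field n m d"
    proof (cases "p = 0")
      case True
      then show ?thesis using y p by simp
    next
      case False
      then show ?thesis using I[of r p] p by simp
    qed
    fix z :: "'k mpoly fract" assume "z \<in> rat_field n m d"
    then obtain s t where s: "z = to_fract s / to_fract t" "s \<in> poly_ring n m d" "t \<in> poly_ring n m d" "t \<noteq> 0"
      using E by blast
    have "y - z = to_fract (p * t - s * r) / to_fract (r * t)" using p s by (simp add: diff_frac_eq)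
    also have "\<dots> \<in> rat_field n m d" using p s by (intro I subring_simps(2,3)[OF R]) auto
    finally show "y - z \<in> rat_field n m d" .
    have "y * z = to_fract (p * s) / to_fract (r * t)" using p s by simp
    also have "\<dots> \<in> rat_field n m d" using p s by (intro I subring_simps(2,3)[OF R]) auto
    finally show "y * z \<in> rat_field n m d" .
  qed
qed

lemma rat_invariants_subfield:
  assumes G: "G \<subseteq> GLW"
  shows "is_subfield (rat_invariants scale n b m d G)"
proof -
  have "rat_invariants scale n b m d G = rat_field n m d \<inter> {y. \<forall>g\<in>G. ract g y = y}"
    by (auto simp: rat_invariants_def)
  then show ?thesis using rat_field_subfield fixed_subfield[OF G]
    by (auto simp: is_subfield_def is_subring_def)
qed

lemma poly_invariants_in_rat:
  assumes "G \<subseteq> GLW" "p \<in> poly_invariants scale n b m d G"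
  shows "to_fract p \<in> rat_invariants scale n b m d G"
proof -
  have "to_fract p = Fract p 1" by (simp add: to_fract_def)
  then have "to_fract p \<in> rat_field n m d"
    using assms(2) subring_simps(1)[OF poly_ring_subring[where n = n and m = m and d = d and ?'a = 'k]] unfolding rat_field_def
    by (intro CollectI exI[of _ p] exI[of _ 1]) (simp add: poly_invariants_def)
  then show ?thesis using assms by (auto simp: rat_invariants_def poly_invariants_def ract_to_fract)
qed

text \<open>The denominator is replaced by its norm over the whole general linear group. The numerator is then
  invariant as well, being the product of an invariant fraction and an invariant polynomial.\<close>

lemma rat_invariants_quotient:
  assumes G: "G \<subseteq> GLW" and y: "y \<in> rat_invariants scale n b m d G"
  shows "\<exists>p\<in>poly_invariants scale n b m d G. \<exists>r\<in>poly_invariants scale n b m d G.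
    r \<noteq> 0 \<and> y = to_fract p / to_fract r"
proof -
  note R = poly_ring_subring[where n = n and m = m and d = d and ?'a = 'k]
  obtain p r where pr: "y = to_fract p / to_fract r" "p \<in> poly_ring n m d" "r \<in> poly_ring n m d" "r \<noteq> 0"
    using y by (auto simp: rat_invariants_def rat_field_def Fract_conv_to_fract)
  define N where "N = (\<Prod>g\<in>GLW. act g r)"
  \<comment> \<open>The cofactor of the denominator in its norm.\<close>
  define N' where "N' = (\<Prod>g\<in>GLW - {id}. act g r)"
  have N: "N = r * N'" unfolding N_def N'_def
    using prod.remove[OF finite_GL GL_id, of "\<lambda>g. act g r"] by (simp add: poly_act_id[OF V B])
  have N_ring: "N \<in> poly_ring n m d" "N' \<in> poly_ring n m d"
    unfolding N_def N'_def using act_poly_ring pr by (auto intro!: subring_prod[OF R])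
  have N0: "N \<noteq> 0" unfolding N_def
  proof (subst prod_zero_iff[OF finite_GL], intro notI, elim bexE)
    fix g assume g: "g \<in> GLW" "act g r = 0"
    then have "ract g (to_fract r) = ract g (to_fract 0)"
      by (simp only: ract_to_fract poly_act_def poly_subst_0)
    then show False using ract_inj[OF g(1)] pr(4) to_fract_eq_iff by blast
  qed
  have inv: "act h N = N" if h: "h \<in> GLW" for h
  proof -
    have "act h N = (\<Prod>g\<in>GLW. act (h \<circ> g) r)"
      unfolding N_def poly_act_def poly_subst_prod
      by (rule prod.cong) (simp_all add: poly_act_comp[OF V B h, unfolded poly_act_def])
    also have "\<dots> = N" unfolding N_def
      by (rule prod.reindex_bij_witness[of _ "\<lambda>g. inv_into UNIV h \<circ> g" "\<lambda>g. h \<circ> g"])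
         (use h in \<open>auto simp: GL_comp GL_inverse comp_assoc[symmetric]\<close>)
    finally show ?thesis .
  qed
  have y2: "y = to_fract (p * N') / to_fract N" using pr N N0 by simp
  then have y3: "to_fract (p * N') = y * to_fract N" using N0 by simp
  have "act h (p * N') = p * N'" if "h \<in> G" for h
  proof (rule act_eqI)
    show h: "h \<in> GLW" using that G by auto
    interpret h: comm_ring_hom "ract h" by (rule ract_hom[OF h])
    show "ract h (to_fract (p * N')) = to_fract (p * N')"
      unfolding y3 using y that h by (simp add: h.hom_mult ract_to_fract inv rat_invariants_def)
  qed
  then have "p * N' \<in> poly_invariants scale n b m d G"
    using pr N_ring by (auto simp: poly_invariants_def intro!: subring_simps(3)[OF R])
  moreover have "N \<in> poly_invariants scale n b m d G" using N_ring inv G by (auto simp: poly_invariants_def)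
  ultimately show ?thesis using y2 N0 by blast
qed

section \<open>The generators\<close>

lemma xvar_fun: "xvar k = (\<lambda>i. to_fract (Var (k, i)))"
  by (rule ext) (simp add: xvar_def)

lemma to_fract_Lp: "to_fract Lp = moore CARD('k) n xv"
  by (simp add: moore_hom[OF to_fract_hom] xvar_fun)

lemma Lp_nonzero: "Lp \<noteq> 0"
proof
  assume "Lp = 0"
  then have "moore CARD('k) n xv = 0" using to_fract_Lp by simp
  then show False using scalar.moore_nonzero[OF xvar_independent] by blast
qed

lemma ract_xv:
  assumes g: "g \<in> GLW" and md: "0 < m + d" and i: "i < n"
  shows "ract g (xv i) = (\<Sum>j<n. scalar (copy_matr 0 g $$ (i, j)) * xv j)"
  by (rule ract_xvar[OF g md i])

lemma ract_Lp:
  assumes g: "g \<in> GLW" and md: "0 < m + d"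
  shows "ract g (to_fract Lp) = scalar (det (copy_matr 0 g)) * to_fract Lp"
  unfolding to_fract_Lp moore_hom[OF ract_hom[OF g]]
  by (rule scalar.moore_transform) (simp_all add: ract_xv[OF g md])

lemma ract_moore_col:
  assumes g: "g \<in> GLW" and md: "0 < m + d"
    and w: "\<And>i. i < n \<Longrightarrow> ract g (w i) = (\<Sum>j<n. scalar (copy_matr 0 g $$ (i, j)) * w j)"
  shows "ract g (moore_col CARD('k) n xv w k) = scalar (det (copy_matr 0 g)) * moore_col CARD('k) n xv w k"
  unfolding moore_col_hom[OF ract_hom[OF g]]
  by (rule scalar.moore_col_transform) (simp_all add: ract_xv[OF g md] w)

text \<open>Both \<open>y\<close> and the Moore determinant are multiplied by \<open>c = det g\<close>, and \<open>c * c ^ (q - 2) = 1\<close>.\<close>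

lemma twist_invariant:
  assumes g: "g \<in> GLW" and md: "0 < m + d"
    and y: "ract g y = scalar (det (copy_matr 0 g)) * y"
  shows "ract g (y * to_fract Lp ^ (CARD('k) - 2)) = y * to_fract Lp ^ (CARD('k) - 2)"
proof -
  interpret h: comm_ring_hom "ract g" by (rule ract_hom[OF g])
  let ?c = "det (copy_matr 0 g)"
  have "CARD('k) - 1 = Suc (CARD('k) - 2)" using card_finite_field_ge_2[where 'k = 'k] by simp
  then have "?c * ?c ^ (CARD('k) - 2) = 1"
    using scalar.scalar_power_order[OF copy_matr_det[OF g, of 0]] by simp
  then have "scalar ?c * scalar ?c ^ (CARD('k) - 2) = 1" by (simp flip: scalar.hom_power scalar.hom_mult)
  moreover have "ract g (y * to_fract Lp ^ (CARD('k) - 2)) = (scalar ?c * scalar ?c ^ (CARD('k) - 2)) * (y * to_fract Lp ^ (CARD('k) - 2))"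
    by (simp only: h.hom_mult h.hom_power y ract_Lp[OF g md] power_mult_distrib mult_ac)
  ultimately show ?thesis by simp
qed

lemma Lp_power_invariant:
  assumes g: "g \<in> GLW" and md: "0 < m + d"
  shows "act g (Lp ^ (CARD('k) - 1)) = Lp ^ (CARD('k) - 1)"
proof (rule act_eqI[OF g])
  have "CARD('k) - 1 = Suc (CARD('k) - 2)" using card_finite_field_ge_2[where 'k = 'k] by simp
  then show "ract g (to_fract (Lp ^ (CARD('k) - 1))) = to_fract (Lp ^ (CARD('k) - 1))"
    using twist_invariant[OF g md ract_Lp[OF g md]] by (simp add: to_fract_power)
qed

text \<open>On a copy of the type of copy 0, these are the coefficients of its coordinate vector in terms of the
  columns of the Moore matrix, multiplied by \<open>Lp ^ (q - 1)\<close>, which clears the denominator \<open>Lp\<close> and keeps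
  them invariant under the general linear group. On a copy of the opposite type, they are the natural
  pairings of its coordinate vector with the columns.\<close>

definition copy_gen :: "nat \<Rightarrow> nat \<Rightarrow> 'k mpoly" where
  "copy_gen k j = (if k < m \<longleftrightarrow> 0 < m
     then moore_col CARD('k) n Xp (\<lambda>i. Var (k, i)) j * Lp ^ (CARD('k) - 2)
     else \<Sum>l<n. Var (k, l) * Xp l ^ (CARD('k) ^ j))"

text \<open>The Dickson invariant which is the \<open>j\<close>-th coefficient of the additive polynomial with the span of
  the coordinate functions as its roots, up to sign and the factor \<open>Lp ^ (q - 1)\<close>; see
  \<open>dickson_relation\<close>. It arises by the same recipe as \<open>copy_gen\<close>, applied to the vector of
  \<open>q ^ n\<close>-th powers.\<close>

definition dickson :: "nat \<Rightarrow> 'k mpoly" where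
  "dickson j = moore_col CARD('k) n Xp (\<lambda>i. Xp i ^ (CARD('k) ^ n)) j * Lp ^ (CARD('k) - 2)"

lemma Xp_poly_ring: "0 < m + d \<Longrightarrow> i < n \<Longrightarrow> Xp i \<in> poly_ring n m d"
  by (rule poly_ring_Var)

lemma Lp_poly_ring: "0 < m + d \<Longrightarrow> Lp \<in> poly_ring n m d"
  by (intro subring_moore poly_ring_subring Xp_poly_ring)

lemma homogeneous_Lp_power: "homogeneous (Lp ^ e)"
  by (rule has_degree_homogeneous[OF has_degree_power[OF has_degree_moore[OF has_degree_Var]]])

lemma homogeneous_twist:
  assumes "\<And>i. i < n \<Longrightarrow> has_degree e (w i)"
  shows "homogeneous (moore_col CARD('k) n Xp w j * Lp ^ (CARD('k) - 2))"
  by (rule has_degree_homogeneous[OF has_degree_mult[OF has_degree_moore_col[OF has_degree_Var assms]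
      has_degree_power[OF has_degree_moore[OF has_degree_Var]]]])

lemma copy_gen_homogeneous: "homogeneous (copy_gen k j)"
proof (cases "k < m \<longleftrightarrow> 0 < m")
  case True
  have "homogeneous (moore_col CARD('k) n Xp (\<lambda>i. Var (k, i)) j * Lp ^ (CARD('k) - 2))"
    by (rule homogeneous_twist[OF has_degree_Var])
  then show ?thesis using True by (simp add: copy_gen_def)
next
  case False
  have "has_degree (1 + 1 * CARD('k) ^ j) (Var (k, l) * Xp l ^ (CARD('k) ^ j) :: 'k mpoly)" for l
    by (intro has_degree_mult has_degree_power has_degree_Var)
  then show ?thesis using False
    by (auto simp: copy_gen_def intro!: has_degree_homogeneous[OF has_degree_sum])
qed

text \<open>In the first case the factors \<open>det g\<close> cancel; in the second case the matrices of the two copies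
  cancel as they are contragredient.\<close>

lemma copy_gen_invariant:
  assumes g: "g \<in> GLW" and k: "k < m + d"
  shows "act g (copy_gen k j) = copy_gen k j"
proof (rule act_eqI[OF g])
  have md: "0 < m + d" using k by auto
  interpret h: comm_ring_hom "ract g" by (rule ract_hom[OF g])
  show "ract g (to_fract (copy_gen k j)) = to_fract (copy_gen k j)"
  proof (cases "k < m \<longleftrightarrow> 0 < m")
    case True
    have "to_fract (copy_gen k j) = moore_col CARD('k) n xv (xvar k) j * to_fract Lp ^ (CARD('k) - 2)"
      using True by (simp add: copy_gen_def to_fract_power moore_col_hom[OF to_fract_hom] xvar_fun)
    moreover have "ract g (moore_col CARD('k) n xv (xvar k) j) = scalar (det (copy_matr 0 g)) * moore_col CARD('k) n xv (xvar k) j"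
      using ract_xvar[OF g k] copy_matr_same[OF True, of g] by (intro ract_moore_col[OF g md]) simp
    ultimately show ?thesis using twist_invariant[OF g md] by simp
  next
    case False
    define C where "C = copy_matr 0 g"
    define D where "D = copy_matr k g"
    have DC: "(\<Sum>l<n. D $$ (l, a) * C $$ (l, c)) = (if a = c then 1 else 0)" if "a < n" "c < n" for a c
    proof -
      have "transpose_mat D * C = 1\<^sub>m n" unfolding C_def D_def
        using False by (intro copy_matr_opposite[OF g]) auto
      then have "(transpose_mat D * C) $$ (a, c) = 1\<^sub>m n $$ (a, c)" by simp
      moreover have "D \<in> carrier_mat n n" "C \<in> carrier_mat n n" by (auto simp: C_def D_def)
      ultimately show ?thesis using that
        by (simp add: scalar_prod_def lessThan_atLeast0)
    qed
    have u: "to_fract (copy_gen k j) = (\<Sum>l<n. xvar k l * xv l ^ (CARD('k) ^ j))"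
      unfolding copy_gen_def if_not_P[OF False] by (simp add: to_fract_power xvar_def)
    have "ract g (to_fract (copy_gen k j)) =
      (\<Sum>l<n. (\<Sum>a<n. scalar (D $$ (l, a)) * xvar k a) * (\<Sum>c<n. scalar (C $$ (l, c)) * xv c ^ (CARD('k) ^ j)))"
      unfolding u h.hom_sum h.hom_mult h.hom_power
      by (intro sum.cong refl) (simp add: ract_xvar[OF g k] ract_xv[OF g md] scalar.frob_lin C_def D_def)
    also have "\<dots> = (\<Sum>l<n. \<Sum>a<n. \<Sum>c<n. scalar (D $$ (l, a) * C $$ (l, c)) * (xvar k a * xv c ^ (CARD('k) ^ j)))"
      by (simp only: sum_product scalar.hom_mult mult_ac)
    also have "\<dots> = (\<Sum>a<n. \<Sum>l<n. \<Sum>c<n. scalar (D $$ (l, a) * C $$ (l, c)) * (xvar k a * xv c ^ (CARD('k) ^ j)))"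
      by (rule sum.swap)
    also have "\<dots> = (\<Sum>a<n. \<Sum>c<n. \<Sum>l<n. scalar (D $$ (l, a) * C $$ (l, c)) * (xvar k a * xv c ^ (CARD('k) ^ j)))"
      by (intro sum.cong refl sum.swap)
    also have "\<dots> = (\<Sum>a<n. \<Sum>c<n. scalar (\<Sum>l<n. D $$ (l, a) * C $$ (l, c)) * (xvar k a * xv c ^ (CARD('k) ^ j)))"
      by (simp only: scalar.hom_sum sum_distrib_right)
    also have "\<dots> = (\<Sum>a<n. \<Sum>c<n. if a = c then xvar k a * xv c ^ (CARD('k) ^ j) else 0)"
      by (intro sum.cong refl) (simp add: DC)
    also have "\<dots> = to_fract (copy_gen k j)" unfolding u by (intro sum.cong refl) simp
    finally show ?thesis .
  qed
qed

lemma copy_gen_poly_ring: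
  assumes k: "k < m + d"
  shows "copy_gen k j \<in> poly_ring n m d"
proof -
  note R = poly_ring_subring[where n = n and m = m and d = d and ?'a = 'k]
  have md: "0 < m + d" using k by auto
  show ?thesis
  proof (cases "k < m \<longleftrightarrow> 0 < m")
    case True
    have "moore_col CARD('k) n Xp (\<lambda>i. Var (k, i)) j * Lp ^ (CARD('k) - 2) \<in> poly_ring n m d"
      by (intro subring_simps(3)[OF R] subring_moore_col[OF R] subring_power[OF R] poly_ring_Var k md Lp_poly_ring)
    then show ?thesis using True by (simp add: copy_gen_def)
  next
    case False
    then show ?thesis unfolding copy_gen_def
      using k md by (auto intro!: subring_sum[OF R] subring_simps(3)[OF R] subring_power[OF R] poly_ring_Var)
  qed
qed

lemma dickson_homogeneous: "homogeneous (dickson j)"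
  unfolding dickson_def by (rule homogeneous_twist[OF has_degree_power[OF has_degree_Var]])

lemma dickson_poly_ring:
  assumes md: "0 < m + d"
  shows "dickson j \<in> poly_ring n m d"
proof -
  note R = poly_ring_subring[where n = n and m = m and d = d and ?'a = 'k]
  show ?thesis unfolding dickson_def
    by (intro subring_simps(3)[OF R] subring_moore_col[OF R] subring_power[OF R] poly_ring_Var md Lp_poly_ring)
qed

lemma to_fract_dickson:
  "to_fract (dickson j) = moore_col CARD('k) n xv (\<lambda>i. xv i ^ (CARD('k) ^ n)) j * to_fract Lp ^ (CARD('k) - 2)"
  by (simp add: dickson_def to_fract_power moore_col_hom[OF to_fract_hom] xvar_fun)

lemma dickson_invariant:
  assumes g: "g \<in> GLW" and md: "0 < m + d"
  shows "act g (dickson j) = dickson j"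
proof (rule act_eqI[OF g])
  interpret h: comm_ring_hom "ract g" by (rule ract_hom[OF g])
  have "ract g (moore_col CARD('k) n xv (\<lambda>i. xv i ^ (CARD('k) ^ n)) j) =
    scalar (det (copy_matr 0 g)) * moore_col CARD('k) n xv (\<lambda>i. xv i ^ (CARD('k) ^ n)) j"
    by (rule ract_moore_col[OF g md]) (simp add: h.hom_power ract_xv[OF g md] scalar.frob_lin)
  then show "ract g (to_fract (dickson j)) = to_fract (dickson j)"
    unfolding to_fract_dickson by (rule twist_invariant[OF g md])
qed

end

context linear_invariants
begin

section \<open>From the base copy to all copies\<close>

definition homogeneously_generated :: "('w \<Rightarrow> 'w) set \<Rightarrow> bool" where
  "homogeneously_generated G \<longleftrightarrow> (\<exists>F :: nat \<Rightarrow> 'k mpoly.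
    (\<forall>i \<in> {1..(m + d) * n}. homogeneous (F i) \<and> F i \<in> poly_invariants scale n b m d G) \<and>
    rat_invariants scale n b m d G = generated_field (to_fract ` F ` {1..(m + d) * n}) \<and>
    (\<exists>f \<in> poly_invariants scale n b m d G. f \<noteq> 0 \<and>
      adjoin_inverse (to_fract ` poly_invariants scale n b m d G) (to_fract f) =
      adjoin_inverse (generated_algebra (to_fract ` F ` {1..(m + d) * n})) (to_fract f)))"

text \<open>The linear systems that define the generators of the other copies are solved by Cramer's rule. The
  denominator \<open>Lp\<close> is invertible since \<open>1 / Lp = Lp ^ (q - 2) / Lp ^ (q - 1)\<close>.\<close>

lemma span_recovers_copy:
  assumes A: "is_subring A" and sc: "scalars \<subseteq> A" and md: "0 < m + d"
    and inv: "inverse (to_fract Lp ^ (CARD('k) - 1)) \<in> A"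
    and gen: "\<And>k j. 0 < k \<Longrightarrow> k < m + d \<Longrightarrow> j < n \<Longrightarrow> to_fract (copy_gen k j) \<in> A"
    and k: "k < m + d" and i: "i < n"
  shows "xvar k i \<in> adjoin A n xv"
proof (cases "k = 0")
  case True
  then show ?thesis using adjoin_generator[OF A i, of xv] by simp
next
  case False
  define T where "T = adjoin A n xv"
  have T: "is_subring T" unfolding T_def by (rule adjoin_subring[OF A])
  have AT: "A \<subseteq> T" unfolding T_def by (rule adjoin_coefficient)
  have x: "xv j \<in> T" if "j < n" for j unfolding T_def by (rule adjoin_generator[OF A that])
  have gen: "to_fract (copy_gen k j) \<in> T" if "j < n" for j using gen False k that AT by auto
  define L where "L = to_fract Lp"
  have Lm: "L = moore CARD('k) n xv" unfolding L_def by (rule to_fract_Lp)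
  have L0: "L \<noteq> 0" unfolding L_def using Lp_nonzero by simp
  have LT: "L \<in> T" unfolding Lm by (intro subring_moore[OF T] x)
  have invT: "inverse (L ^ (CARD('k) - 1)) \<in> T" using inv AT by (auto simp: L_def)
  have q: "CARD('k) - 1 = Suc (CARD('k) - 2)" using card_finite_field_ge_2[where 'k = 'k] by simp
  have split: "L * L ^ (CARD('k) - 2) * inverse (L ^ (CARD('k) - 1)) = 1"
    using L0 unfolding q power_Suc by (intro right_inverse) simp
  have expand: "y = (L * y) * (L ^ (CARD('k) - 2) * inverse (L ^ (CARD('k) - 1)))" for y
  proof -
    have "(L * y) * (L ^ (CARD('k) - 2) * inverse (L ^ (CARD('k) - 1))) =
      (L * L ^ (CARD('k) - 2) * inverse (L ^ (CARD('k) - 1))) * y" by (simp only: mult_ac)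
    then show ?thesis unfolding split by simp
  qed
  show ?thesis
  proof (cases "k < m \<longleftrightarrow> 0 < m")
    case True
    have g: "to_fract (copy_gen k j) = moore_col CARD('k) n xv (xvar k) j * L ^ (CARD('k) - 2)" for j
      using True by (simp add: copy_gen_def to_fract_power moore_col_hom[OF to_fract_hom] xvar_fun L_def)
    have "xvar k i = (L * xvar k i) * (L ^ (CARD('k) - 2) * inverse (L ^ (CARD('k) - 1)))"
      by (rule expand)
    also have "L * xvar k i = (\<Sum>j<n. moore_col CARD('k) n xv (xvar k) j * xv i ^ (CARD('k) ^ j))"
      using moore_cramer[of "CARD('k)" n xv i "xvar k"] L0 i by (simp add: Lm)
    also have "\<dots> * (L ^ (CARD('k) - 2) * inverse (L ^ (CARD('k) - 1))) =
      (\<Sum>j<n. to_fract (copy_gen k j) * inverse (L ^ (CARD('k) - 1)) * xv i ^ (CARD('k) ^ j))"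
      unfolding sum_distrib_right by (rule sum.cong) (simp_all only: g mult_ac)
    also have "\<dots> \<in> T"
      using gen x i invT by (intro subring_sum[OF T] subring_simps(3)[OF T] subring_power[OF T]) auto
    finally show ?thesis unfolding T_def .
  next
    case False
    have g: "(\<Sum>l<n. xvar k l * xv l ^ (CARD('k) ^ j)) = to_fract (copy_gen k j)" for j
      unfolding copy_gen_def if_not_P[OF False] by (simp add: to_fract_power xvar_def)
    have "xvar k i = (L * xvar k i) * (L ^ (CARD('k) - 2) * inverse (L ^ (CARD('k) - 1)))"
      by (rule expand)
    also have "L * xvar k i = det (mat n n (\<lambda>(r, j). if j = i then to_fract (copy_gen k r) else xv j ^ (CARD('k) ^ r)))"
      unfolding Lm using moore_cramer_dual[OF i, of "CARD('k)" xv "xvar k"] by (simp only: g)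
    also have "\<dots> * (L ^ (CARD('k) - 2) * inverse (L ^ (CARD('k) - 1))) \<in> T"
    proof (intro subring_simps(3)[OF T] subring_power[OF T] LT invT)
      show "det (mat n n (\<lambda>(r, j). if j = i then to_fract (copy_gen k r) else xv j ^ (CARD('k) ^ r))) \<in> T"
        using gen x by (intro subring_det[OF T, of _ n]) (auto intro: subring_power[OF T])
    qed
    finally show ?thesis unfolding T_def .
  qed
qed

text \<open>Let \<open>A\<close> be the algebra generated by the invariants \<open>\<beta>\<close> of copy 0, by \<open>copy_gen\<close> for the other copies
  and by \<open>1 / Lp ^ (q - 1)\<close>. All coordinate functions lie in \<open>A[x]\<close> for the coordinates \<open>x\<close> of copy 0,
  so the hypothesis \<open>descent\<close> shows that all invariant polynomials lie in \<open>A\<close>. This gives the localised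
  equality of rings, and the equality of fields follows as invariant fractions are quotients of invariant
  polynomials and \<open>A\<close> is contained in the field generated by the invariants.\<close>

theorem generators_from_base_copy:
  fixes \<beta> :: "nat \<Rightarrow> 'k mpoly"
  assumes md: "0 < m + d" and n: "0 < n" and G: "G \<subseteq> GLW"
    and \<beta>: "\<And>j. j < n \<Longrightarrow> homogeneous (\<beta> j)" "\<And>j. j < n \<Longrightarrow> \<beta> j \<in> poly_invariants scale n b m d G"
    and L\<beta>: "to_fract Lp ^ (CARD('k) - 1) \<in> generated_field (to_fract ` \<beta> ` {..<n})"
    and descent: "\<And>A f. is_subring A \<Longrightarrow> scalars \<subseteq> A \<Longrightarrow> to_fract ` \<beta> ` {..<n} \<subseteq> A \<Longrightarrow>
      inverse (to_fract Lp ^ (CARD('k) - 1)) \<in> A \<Longrightarrow> (\<And>a g. a \<in> A \<Longrightarrow> g \<in> G \<Longrightarrow> ract g a = a) \<Longrightarrow>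
      f \<in> adjoin A n xv \<Longrightarrow> (\<And>g. g \<in> G \<Longrightarrow> ract g f = f) \<Longrightarrow> f \<in> A"
  shows "homogeneously_generated G"
proof -
  define I where "I = poly_invariants scale n b m d G"
  define K where "K = rat_invariants scale n b m d G"
  define gen where "gen = (\<lambda>k j. if k = 0 then \<beta> j else copy_gen k j)"
  \<comment> \<open>Generators are numbered from 1, so \<open>gen k j\<close> has number \<open>k * n + j + 1\<close>.\<close>
  define F where "F = (\<lambda>i. gen ((i - 1) div n) ((i - 1) mod n))"
  define S where "S = to_fract ` F ` {1..(m + d) * n}"
  define f where "f = Lp ^ (CARD('k) - 1)"
  define A where "A = adjoin_inverse (generated_algebra S) (to_fract f)"
  have gen_I: "gen k j \<in> I" and gen_hom: "homogeneous (gen k j)" if "k < m + d" "j < n" for k j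
    using that \<beta> copy_gen_invariant copy_gen_poly_ring copy_gen_homogeneous G
    by (auto simp: gen_def I_def poly_invariants_def)
  have idx: "(i - 1) div n < m + d \<and> (i - 1) mod n < n" if "i \<in> {1..(m + d) * n}" for i
    using that n by (auto simp: less_mult_imp_div_less)
  have gen_F: "to_fract (gen k j) \<in> S" if kj: "k < m + d" "j < n" for k j
  proof -
    have "k * n + j + 1 \<le> (m + d) * n"
    proof -
      have "k * n + j + 1 \<le> Suc k * n" using kj by simp
      also have "\<dots> \<le> (m + d) * n" using kj by (intro mult_le_mono1) auto
      finally show ?thesis .
    qed
    then have "F (k * n + j + 1) \<in> F ` {1..(m + d) * n}" by (intro imageI) auto
    moreover have "F (k * n + j + 1) = gen k j" using kj by (simp add: F_def)
    ultimately show ?thesis by (auto simp: S_def)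
  qed
  have F_I: "F i \<in> I" "homogeneous (F i)" if "i \<in> {1..(m + d) * n}" for i
    using idx[OF that] gen_I gen_hom by (auto simp: F_def)
  have I_sub: "is_subring I" unfolding I_def by (rule poly_invariants_subring)
  have fI: "f \<in> I"
    using Lp_power_invariant md G subring_power[OF poly_ring_subring Lp_poly_ring[OF md]]
    by (auto simp: f_def I_def poly_invariants_def)
  have f0: "f \<noteq> 0" unfolding f_def using Lp_nonzero by simp
  have scI: "scalars \<subseteq> to_fract ` I"
    using G by (auto simp: scalars_def I_def poly_invariants_def poly_ring_Const poly_act_def poly_subst_Const)
  have SI: "S \<subseteq> to_fract ` I" using F_I by (auto simp: S_def)
  have IK: "to_fract ` I \<subseteq> K" using poly_invariants_in_rat[OF G] by (auto simp: I_def K_def)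
  have K: "is_subfield K" unfolding K_def by (rule rat_invariants_subfield[OF G])
  have toI: "is_subring (to_fract ` I)" by (rule subring_image[OF to_fract_hom I_sub])
  have algI: "generated_algebra S \<subseteq> to_fract ` I"
    unfolding generated_algebra_def using scI SI toI by (intro hull_minimal) auto
  have A_sub: "is_subring A" unfolding A_def adjoin_inverse_def by (rule is_subring_hull)
  have alg_A: "generated_algebra S \<subseteq> A" and inv_A: "inverse (to_fract f) \<in> A"
    unfolding A_def adjoin_inverse_def using hull_subset[of "insert (inverse (to_fract f)) (generated_algebra S)" is_subring] by auto
  have sc_alg: "scalars \<subseteq> generated_algebra S" "S \<subseteq> generated_algebra S"
    unfolding generated_algebra_def using hull_subset[of "scalars \<union> S" is_subring] by auto
  have invK: "inverse (to_fract f) \<in> K" using K IK fI by (auto simp: is_subfield_def)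
  have AK: "A \<subseteq> K" unfolding A_def adjoin_inverse_def
    using algI IK invK K by (intro hull_minimal) (auto simp: is_subfield_def)
  have fix_K: "ract g a = a" if "a \<in> K" "g \<in> G" for a g using that by (auto simp: K_def rat_invariants_def)
  have IA: "to_fract ` I \<subseteq> A"
  proof
    fix y assume "y \<in> to_fract ` I"
    then obtain p where p: "y = to_fract p" "p \<in> I" by auto
    have "y \<in> adjoin A n xv" unfolding p(1)
    proof (rule poly_ring_generated[OF adjoin_subring[OF A_sub]])
      show "p \<in> poly_ring n m d" using p(2) by (simp add: I_def poly_invariants_def)
      show "to_fract (Const c) \<in> adjoin A n xv" for c
        using sc_alg alg_A adjoin_coefficient[of A n xv] by (auto simp: scalars_def)
      fix k i assume ki: "k < m + d" "i < n"
      have "xvar k i \<in> adjoin A n xv"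
      proof (rule span_recovers_copy[OF A_sub _ md _ _ ki])
        show "scalars \<subseteq> A" using sc_alg alg_A by auto
        show "inverse (to_fract Lp ^ (CARD('k) - 1)) \<in> A" using inv_A by (simp add: f_def to_fract_power)
        show "to_fract (copy_gen k j) \<in> A" if "0 < k" "k < m + d" "j < n" for k j
          using gen_F[OF that(2,3)] that(1) sc_alg alg_A by (auto simp: gen_def)
      qed
      then show "to_fract (Var (k, i)) \<in> adjoin A n xv" by (simp add: xvar_def)
    qed
    then show "y \<in> A"
    proof (rule descent[OF A_sub, rotated 4])
      show "scalars \<subseteq> A" using sc_alg alg_A by auto
      show "to_fract ` \<beta> ` {..<n} \<subseteq> A"
        using gen_F[of 0] md sc_alg alg_A by (auto simp: gen_def)
      show "inverse (to_fract Lp ^ (CARD('k) - 1)) \<in> A" using inv_A by (simp add: f_def to_fract_power)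
      show "ract g a = a" if "a \<in> A" "g \<in> G" for a g using that AK fix_K by auto
      show "ract g y = y" if "g \<in> G" for g using p IK fix_K that by auto
    qed
  qed
  have A_eq: "A = adjoin_inverse (to_fract ` I) (to_fract f)"
  proof
    show "A \<subseteq> adjoin_inverse (to_fract ` I) (to_fract f)"
      unfolding A_def adjoin_inverse_def using algI by (intro hull_mono) auto
    show "adjoin_inverse (to_fract ` I) (to_fract f) \<subseteq> A"
      unfolding adjoin_inverse_def using IA inv_A A_sub by (intro hull_minimal) auto
  qed
  define E where "E = generated_field S"
  have E: "is_subfield E" unfolding E_def generated_field_def by (rule is_subfield_hull)
  have SE: "scalars \<subseteq> E" "S \<subseteq> E"
    unfolding E_def generated_field_def using hull_subset[of "scalars \<union> S" is_subfield] by auto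
  have Esub: "is_subring E" using E by (simp add: is_subfield_def)
  have "to_fract ` \<beta> ` {..<n} \<subseteq> S" using gen_F[of 0] md by (auto simp: gen_def)
  then have "generated_field (to_fract ` \<beta> ` {..<n}) \<subseteq> E"
    unfolding E_def generated_field_def by (intro hull_mono) auto
  then have "to_fract f \<in> E" using L\<beta> by (auto simp: f_def to_fract_power)
  then have "inverse (to_fract f) \<in> E" using E by (simp add: is_subfield_def)
  moreover have "generated_algebra S \<subseteq> E"
    unfolding generated_algebra_def using SE Esub by (intro hull_minimal) auto
  ultimately have AE: "A \<subseteq> E" unfolding A_def adjoin_inverse_def using Esub by (intro hull_minimal) auto
  have "K = E"
  proof
    show "E \<subseteq> K" unfolding E_def generated_field_def
      using scI SI IK K by (intro hull_minimal) auto
    show "K \<subseteq> E"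
    proof
      fix y assume "y \<in> K"
      then obtain p r where pr: "p \<in> I" "r \<in> I" "y = to_fract p / to_fract r"
        using rat_invariants_quotient[OF G] unfolding K_def I_def by blast
      then have "to_fract p \<in> E" "to_fract r \<in> E" using IA AE by auto
      then show "y \<in> E" using E subring_simps(3)[OF Esub] unfolding pr(3) divide_inverse is_subfield_def by blast
    qed
  qed
  then show ?thesis using F_I fI f0 A_eq
    unfolding homogeneously_generated_def K_def E_def A_def I_def S_def by blast
qed

section \<open>The three groups\<close>

lemma Lp_inverse:
  assumes A: "is_subring A" and y: "to_fract p = y * to_fract Lp ^ (CARD('k) - 2)" "to_fract p \<in> A"
    and inv: "inverse (to_fract Lp ^ (CARD('k) - 1)) \<in> A"
  shows "y / to_fract Lp \<in> A"
proof -
  have q: "CARD('k) - 1 = Suc (CARD('k) - 2)" using card_finite_field_ge_2[where 'k = 'k] by simp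
  have "y / to_fract Lp = to_fract p * inverse (to_fract Lp ^ (CARD('k) - 1))"
    using Lp_nonzero unfolding y(1) q by (simp add: field_simps)
  then show ?thesis using y inv subring_simps(3)[OF A] by simp
qed

text \<open>Cramer's rule for the vector \<open>w\<close> of \<open>q ^ n\<close>-th powers: each \<open>xv i\<close> is a root of one and the same additive
  polynomial of degree \<open>q ^ n\<close>.\<close>

lemma dickson_relation:
  assumes i: "i < n"
  shows "xv i ^ (CARD('k) ^ n) =
    (\<Sum>l<n. moore_col CARD('k) n xv (\<lambda>i. xv i ^ (CARD('k) ^ n)) l / to_fract Lp * xv i ^ (CARD('k) ^ l))"
proof -
  have L0: "moore CARD('k) n xv \<noteq> 0" by (rule scalar.moore_nonzero[OF xvar_independent])
  have "moore CARD('k) n xv * xv i ^ (CARD('k) ^ n) =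
    (\<Sum>l<n. moore_col CARD('k) n xv (\<lambda>i. xv i ^ (CARD('k) ^ n)) l * xv i ^ (CARD('k) ^ l))"
    by (rule moore_cramer[OF L0 i, of "\<lambda>i. xv i ^ (CARD('k) ^ n)"])
  then have "xv i ^ (CARD('k) ^ n) =
    (\<Sum>l<n. moore_col CARD('k) n xv (\<lambda>i. xv i ^ (CARD('k) ^ n)) l * xv i ^ (CARD('k) ^ l)) / moore CARD('k) n xv"
    using L0 by (simp add: field_simps)
  then show ?thesis by (simp add: sum_divide_distrib to_fract_Lp)
qed

text \<open>The coefficient with index 0 is \<open>Lp ^ (q - 1)\<close> up to sign by \<open>moore_col_frob\<close>, which is why the
  zeroth Dickson invariant can be replaced by \<open>Lp ^ (q - 1)\<close>, or by \<open>Lp\<close> for the special linear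
  group.\<close>

lemma dickson_coefficient:
  assumes A: "is_subring A" and l: "l < n"
    and dick: "\<And>j. 0 < j \<Longrightarrow> j < n \<Longrightarrow> to_fract (dickson j) \<in> A"
    and L: "to_fract Lp ^ (CARD('k) - 1) \<in> A" "inverse (to_fract Lp ^ (CARD('k) - 1)) \<in> A"
  shows "moore_col CARD('k) n xv (\<lambda>i. xv i ^ (CARD('k) ^ n)) l / to_fract Lp \<in> A"
proof (cases "l = 0")
  case True
  have "Suc (CARD('k) - 1) = CARD('k)" using card_finite_field_ge_2[where 'k = 'k] by simp
  then have "to_fract Lp ^ CARD('k) / to_fract Lp = to_fract Lp ^ (CARD('k) - 1)"
    using Lp_nonzero by (metis nonzero_mult_div_cancel_left power_Suc to_fract_eq_0_iff)
  then show ?thesis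
    using scalar.moore_col_frob[of n xv] l L(1) subring_simps(5)[OF A] True by (auto simp: to_fract_Lp)
next
  case False
  then show ?thesis using dick[of l] l L(2) by (intro Lp_inverse[OF A to_fract_dickson]) auto
qed

lemma generated_fieldI: "y \<in> S \<Longrightarrow> y \<in> generated_field S"
  unfolding generated_field_def using hull_inc[of y "scalars \<union> S" is_subfield] by auto

lemma base_transitive_hom:
  assumes md: "0 < m + d" and C: "C \<in> carrier_mat n n" "det C \<noteq> 0"
  shows "\<exists>g\<in>GLW. copy_matr 0 g = C \<and> (\<forall>i<n. ract g (xv i) = (\<Sum>l<n. scalar (C $$ (i, l)) * xv l))"
  using base_transitive[OF C, of 0] ract_xv[OF _ md] by auto

lemma dickson_poly_invariant:
  "0 < m + d \<Longrightarrow> G \<subseteq> GLW \<Longrightarrow> dickson j \<in> poly_invariants scale n b m d G"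
  using dickson_invariant dickson_poly_ring by (auto simp: poly_invariants_def)

theorem GL_case:
  assumes md: "0 < m + d" and n: "0 < n" and G: "G = GLW"
  shows "homogeneously_generated G"
proof (rule generators_from_base_copy[OF md n, where \<beta> = "\<lambda>j. if j = 0 then Lp ^ (CARD('k) - 1) else dickson j"])
  let ?\<beta> = "\<lambda>j. if j = 0 then Lp ^ (CARD('k) - 1) else dickson j"
  show "G \<subseteq> GLW" using G by simp
  show "homogeneous (?\<beta> j)" for j using homogeneous_Lp_power dickson_homogeneous by simp
  show "?\<beta> j \<in> poly_invariants scale n b m d G" for j
    using dickson_poly_invariant[OF md, of G j] Lp_power_invariant[OF _ md] G
      subring_power[OF poly_ring_subring Lp_poly_ring[OF md]] by (auto simp: poly_invariants_def)
  have "to_fract (?\<beta> 0) \<in> to_fract ` ?\<beta> ` {..<n}" using n by (intro imageI) simp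
  then show "to_fract Lp ^ (CARD('k) - 1) \<in> generated_field (to_fract ` ?\<beta> ` {..<n})"
    by (intro generated_fieldI) (simp add: to_fract_power)
  fix A f
  assume A: "is_subring A" and "scalars \<subseteq> A" and \<beta>: "to_fract ` ?\<beta> ` {..<n} \<subseteq> A"
    and L: "inverse (to_fract Lp ^ (CARD('k) - 1)) \<in> A" and fix_A: "\<And>a g. a \<in> A \<Longrightarrow> g \<in> G \<Longrightarrow> ract g a = a"
    and f: "f \<in> adjoin A n xv" and fix_f: "\<And>g. g \<in> G \<Longrightarrow> ract g f = f"
  have \<beta>A: "to_fract (?\<beta> j) \<in> A" if "j < n" for j using \<beta> that by blast
  show "f \<in> A"
  proof (rule scalar.GL_descent[OF A xvar_independent n _ dickson_relation f])
    show "moore_col CARD('k) n xv (\<lambda>i. xv i ^ (CARD('k) ^ n)) l / to_fract Lp \<in> A" if "l < n" for l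
    proof (rule dickson_coefficient[OF A that _ _ L])
      show "to_fract (dickson j) \<in> A" if "0 < j" "j < n" for j using \<beta>A[OF that(2)] that(1) by simp
      show "to_fract Lp ^ (CARD('k) - 1) \<in> A" using \<beta>A[OF n] by (simp add: to_fract_power)
    qed
    fix C :: "'k mat" assume C: "C \<in> carrier_mat n n" "det C \<noteq> 0"
    obtain g where "g \<in> GLW" "\<forall>i<n. ract g (xv i) = (\<Sum>l<n. scalar (C $$ (i, l)) * xv l)"
      using base_transitive_hom[OF md C] by blast
    then show "\<exists>h. comm_ring_hom h \<and> (\<forall>a\<in>A. h a = a) \<and> h f = f \<and> (\<forall>i<n. h (xv i) = (\<Sum>l<n. scalar (C $$ (i, l)) * xv l))"
      using ract_hom fix_A fix_f G by (intro exI[of _ "ract g"]) auto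
  qed
qed

theorem SL_case:
  assumes md: "0 < m + d" and n: "0 < n" and G: "G = SL scale n b"
  shows "homogeneously_generated G"
proof (rule generators_from_base_copy[OF md n, where \<beta> = "\<lambda>j. if j = 0 then Lp else dickson j"])
  let ?\<beta> = "\<lambda>j. if j = 0 then Lp else dickson j"
  show GG: "G \<subseteq> GLW" using G by (auto simp: SL_def)
  show "homogeneous (?\<beta> j)" for j using homogeneous_Lp_power[of 1] dickson_homogeneous by simp
  have "act g Lp = Lp" if "g \<in> G" for g
  proof (rule act_eqI)
    show g: "g \<in> GLW" using that GG by auto
    then have "det (copy_matr 0 g) = 1" using that SL_iff G by blast
    then show "ract g (to_fract Lp) = to_fract Lp" using ract_Lp[OF g md] by simp
  qed
  then show "?\<beta> j \<in> poly_invariants scale n b m d G" for j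
    using dickson_poly_invariant[OF md GG, of j] Lp_poly_ring[OF md] by (auto simp: poly_invariants_def)
  have "to_fract (?\<beta> 0) \<in> to_fract ` ?\<beta> ` {..<n}" using n by (intro imageI) simp
  then have "to_fract Lp \<in> generated_field (to_fract ` ?\<beta> ` {..<n})" by (intro generated_fieldI) simp
  then show "to_fract Lp ^ (CARD('k) - 1) \<in> generated_field (to_fract ` ?\<beta> ` {..<n})"
    using is_subfield_hull unfolding generated_field_def is_subfield_def by (intro subring_power) auto
  fix A f
  assume A: "is_subring A" and "scalars \<subseteq> A" and \<beta>: "to_fract ` ?\<beta> ` {..<n} \<subseteq> A"
    and L: "inverse (to_fract Lp ^ (CARD('k) - 1)) \<in> A" and fix_A: "\<And>a g. a \<in> A \<Longrightarrow> g \<in> G \<Longrightarrow> ract g a = a"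
    and f: "f \<in> adjoin A n xv" and fix_f: "\<And>g. g \<in> G \<Longrightarrow> ract g f = f"
  have \<beta>A: "to_fract (?\<beta> j) \<in> A" if "j < n" for j using \<beta> that by blast
  have LA: "to_fract Lp \<in> A" using \<beta>A[OF n] by simp
  have "to_fract Lp ^ (CARD('k) - 2) = 1 * to_fract Lp ^ (CARD('k) - 2)" by simp
  then have LI: "inverse (to_fract Lp) \<in> A"
    using Lp_inverse[OF A, of "Lp ^ (CARD('k) - 2)" 1] L subring_power[OF A LA]
    by (simp add: to_fract_power divide_inverse)
  show "f \<in> A"
  proof (rule scalar.SL_descent[OF A xvar_independent n _ dickson_relation _ _ f])
    show "moore CARD('k) n xv \<in> A" "inverse (moore CARD('k) n xv) \<in> A" using LA LI by (simp_all add: to_fract_Lp)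
    show "moore_col CARD('k) n xv (\<lambda>i. xv i ^ (CARD('k) ^ n)) l / to_fract Lp \<in> A" if "l < n" for l
    proof (rule dickson_coefficient[OF A that _ subring_power[OF A LA] L])
      show "to_fract (dickson j) \<in> A" if "0 < j" "j < n" for j using \<beta>A[OF that(2)] that(1) by simp
    qed
    fix C :: "'k mat" assume C: "C \<in> carrier_mat n n" "det C = 1"
    then obtain g where g: "g \<in> GLW" "copy_matr 0 g = C" "\<forall>i<n. ract g (xv i) = (\<Sum>l<n. scalar (C $$ (i, l)) * xv l)"
      using base_transitive_hom[OF md C(1)] by auto
    then have "g \<in> G" using C SL_iff[OF g(1), of 0] G by simp
    then show "\<exists>h. comm_ring_hom h \<and> (\<forall>a\<in>A. h a = a) \<and> h f = f \<and> (\<forall>i<n. h (xv i) = (\<Sum>l<n. scalar (C $$ (i, l)) * xv l))"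
      using ract_hom[OF g(1)] fix_A fix_f g(3) by (intro exI[of _ "ract g"]) auto
  qed
qed

text \<open>The generators on copy 0 are the values \<open>N\<^sub>i = span_poly q z i (z i)\<close>, the orbit products of a flag basis
  \<open>z\<close>. Since \<open>Lp\<close> is a scalar multiple of their product, it lies in the field that they generate.\<close>

theorem Sylow_case:
  assumes md: "0 < m + d" and n: "0 < n" and G: "sylow_subgroup CHAR('k) (GL scale) G"
  shows "homogeneously_generated G"
proof -
  obtain z where z: "scalar.indep z n" "\<And>i. i < n \<Longrightarrow> z i \<in> scalar.lspan xv n" "G = unitriangular z"
    using sylow_unitriangular[OF md G] by blast
  have GG: "G \<subseteq> GLW" using z(3) by (auto simp: unitriangular_def)
  obtain C where C: "C \<in> carrier_mat n n" "\<And>i. i < n \<Longrightarrow> z i = (\<Sum>l<n. scalar (C $$ (i, l)) * xv l)"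
    using scalar.lspan_family_matrix[of n z xv] z(2) by auto
  have mz: "moore CARD('k) n z = scalar (det C) * moore CARD('k) n xv" by (rule scalar.moore_transform[OF C])
  have C0: "det C \<noteq> 0" using mz scalar.moore_nonzero[OF z(1)] by auto
  define Z where "Z = (\<lambda>i. \<Sum>l<n. Const (C $$ (i, l)) * Var (0, l) :: 'k mpoly)"
  have Z: "to_fract (Z i) = z i" if "i < n" for i
    using that by (simp add: Z_def C(2) scalar_def xvar_def)
  have Zdeg: "has_degree 1 (Z i)" for i unfolding Z_def
    using has_degree_mult[OF has_degree_Const has_degree_Var] by (intro has_degree_sum) simp
  have Zring: "Z i \<in> poly_ring n m d" for i unfolding Z_def
    using md by (intro subring_sum[OF poly_ring_subring] subring_simps(3)[OF poly_ring_subring]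
      poly_ring_Const poly_ring_Var) auto
  define \<beta> where "\<beta> = (\<lambda>i. span_poly CARD('k) Z i (Z i))"
  have span_cong: "span_poly CARD('k) y i t = span_poly CARD('k) y' i t"
    if "\<And>j. j < i \<Longrightarrow> y j = y' j" for y y' i and t :: "'k mpoly fract"
    using that by (induction i arbitrary: t) auto
  have \<beta>z: "to_fract (\<beta> i) = span_poly CARD('k) z i (z i)" if "i < n" for i
  proof -
    have "span_poly CARD('k) (\<lambda>i. to_fract (Z i)) i (to_fract (Z i)) = span_poly CARD('k) z i (to_fract (Z i))"
      using that Z by (intro span_cong) simp
    then show ?thesis using Z[OF that] by (simp add: \<beta>_def span_poly_map[OF to_fract_hom])
  qed
  have \<beta>_inv: "act g (\<beta> i) = \<beta> i" if g: "g \<in> G" and i: "i < n" for g i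
  proof (rule act_eqI)
    show gl: "g \<in> GLW" using g GG by auto
    show "ract g (to_fract (\<beta> i)) = to_fract (\<beta> i)" unfolding \<beta>z[OF i]
      using g z(3) by (intro scalar.span_poly_invariant[OF ract_hom[OF gl] _ i]) (auto simp: unitriangular_def)
  qed
  show ?thesis
  proof (rule generators_from_base_copy[OF md n GG, where \<beta> = \<beta>])
    show "homogeneous (\<beta> j)" for j unfolding \<beta>_def
      using scalar.q_pos[where 'k = 'k] by (intro has_degree_homogeneous[OF has_degree_span_poly] Zdeg)
    show "\<beta> j \<in> poly_invariants scale n b m d G" if "j < n" for j
      using \<beta>_inv that subring_span_poly[OF poly_ring_subring Zring Zring] by (auto simp: poly_invariants_def \<beta>_def)
    let ?E = "generated_field (to_fract ` \<beta> ` {..<n})"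
    have E: "is_subring ?E" using is_subfield_hull unfolding generated_field_def is_subfield_def by auto
    have sE: "scalar c \<in> ?E" for c
      unfolding generated_field_def by (rule hull_inc) (simp add: scalars_eq)
    have "to_fract Lp = scalar (inverse (det C)) * moore CARD('k) n z"
    proof -
      have "scalar (inverse (det C)) * moore CARD('k) n z = scalar (inverse (det C) * det C) * moore CARD('k) n xv"
        unfolding mz by (simp only: scalar.hom_mult mult.assoc)
      then show ?thesis using C0 by (simp add: to_fract_Lp)
    qed
    also have "moore CARD('k) n z = (\<Prod>i<n. to_fract (\<beta> i))"
      unfolding scalar.moore_eq_prod_span_poly by (rule prod.cong) (auto simp: \<beta>z)
    also have "scalar (inverse (det C)) * (\<Prod>i<n. to_fract (\<beta> i)) \<in> ?E"
      by (intro subring_simps(3)[OF E] sE subring_prod[OF E] generated_fieldI imageI) auto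
    finally show "to_fract Lp ^ (CARD('k) - 1) \<in> ?E" by (rule subring_power[OF E])
    fix A f
    assume A: "is_subring A" and sc: "scalars \<subseteq> A" and \<beta>A: "to_fract ` \<beta> ` {..<n} \<subseteq> A"
      and "inverse (to_fract Lp ^ (CARD('k) - 1)) \<in> A" and fix_A: "\<And>a g. a \<in> A \<Longrightarrow> g \<in> G \<Longrightarrow> ract g a = a"
      and f: "f \<in> adjoin A n xv" and fix_f: "\<And>g. g \<in> G \<Longrightarrow> ract g f = f"
    have T: "is_subring (adjoin A n z)" by (rule adjoin_subring[OF A])
    have "xv i \<in> adjoin A n z" if i: "i < n" for i
    proof -
      have "xv i \<in> scalar.lspan z n"
        using scalar.lspan_eq_of_indep[OF xvar_independent z(1,2)] scalar.lspan_base[OF i, of xv] by blast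
      then obtain c where c: "xv i = (\<Sum>j<n. scalar (c j) * z j)" by (auto simp: scalar.lspan_def)
      show ?thesis unfolding c
        using sc adjoin_coefficient[of A n z] adjoin_generator[OF A, of _ n z]
        by (intro subring_sum[OF T] subring_simps(3)[OF T]) (auto simp: scalars_eq)
    qed
    then have f': "f \<in> adjoin A n z"
      using f adjoin_minimal[OF T adjoin_coefficient] by blast
    show "f \<in> A"
    proof (rule scalar.unitriangular_descent[OF A z(1) _ f'])
      show "span_poly CARD('k) z i (z i) \<in> A" if "i < n" for i
        using \<beta>A that unfolding \<beta>z[OF that, symmetric] by blast
      fix t assume t: "\<And>i. i < n \<Longrightarrow> t i - z i \<in> scalar.lspan z i"
      obtain g where g: "g \<in> unitriangular z" "\<forall>i<n. ract g (z i) = t i"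
        using unitriangular_transitive[OF md z(1,2) t] by blast
      then have "g \<in> G" "g \<in> GLW" using z(3) GG by auto
      then show "\<exists>h. comm_ring_hom h \<and> (\<forall>a\<in>A. h a = a) \<and> h f = f \<and> (\<forall>i<n. h (z i) = t i)"
        using ract_hom fix_A fix_f g(2) by (intro exI[of _ "ract g"]) auto
    qed
  qed
qed

text \<open>Without variables there are only constants.\<close>

lemma no_variables_case:
  assumes 0: "(m + d) * n = 0" and G: "G \<subseteq> GLW"
  shows "homogeneously_generated G"
proof -
  have ring: "poly_ring n m d = range (Const :: 'k \<Rightarrow> 'k mpoly)"
  proof (intro subset_antisym subsetI)
    fix p :: "'k mpoly" assume "p \<in> poly_ring n m d"
    then have "Poly_Mapping.keys p \<subseteq> {0}" using 0 by (auto simp: poly_ring_def)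
    then have "p = Const (Poly_Mapping.lookup p 0)" unfolding Const_def
      by (intro poly_mapping_eqI) (auto simp: lookup_single when_def in_keys_iff)
    then show "p \<in> range Const" by blast
  qed (auto intro: poly_ring_Const)
  have inv: "poly_invariants scale n b m d G = range Const"
    unfolding poly_invariants_def ring by (auto simp: poly_act_def poly_subst_Const)
  have sf: "is_subfield (scalars :: 'k mpoly fract set)"
    unfolding scalars_eq is_subfield_def is_subring_def
    by (auto simp flip: scalar.hom_minus scalar.hom_mult scalar.hom_inverse intro: range_eqI[of _ _ 1])
  then have sr: "is_subring (scalars :: 'k mpoly fract set)" by (simp add: is_subfield_def)
  have rat: "rat_invariants scale n b m d G = scalars"
  proof
    show "rat_invariants scale n b m d G \<subseteq> scalars"
    proof
      fix y assume "y \<in> rat_invariants scale n b m d G"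
      then obtain c e where "y = scalar c / scalar e"
        unfolding rat_invariants_def rat_field_def ring by (auto simp: Fract_conv_to_fract scalar_def)
      then have "y = scalar (c / e)" by (simp add: divide_inverse scalar.hom_mult scalar.hom_inverse)
      then show "y \<in> scalars" by (simp add: scalars_eq)
    qed
    show "scalars \<subseteq> rat_invariants scale n b m d G"
      using poly_invariants_in_rat[OF G] unfolding inv by (auto simp: scalars_def)
  qed
  have "generated_field {} = (scalars :: 'k mpoly fract set)" "generated_algebra {} = (scalars :: 'k mpoly fract set)"
    unfolding generated_field_def generated_algebra_def using sf sr by (simp_all add: hull_same)
  moreover have "to_fract ` poly_invariants scale n b m d G = scalars"
    unfolding inv by (auto simp: scalars_def)
  moreover have "Const 1 \<in> poly_invariants scale n b m d G" unfolding inv by (rule rangeI)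
  moreover have "Const 1 \<noteq> (0 :: 'k mpoly)" by (simp add: Const_1)
  ultimately show ?thesis unfolding homogeneously_generated_def using 0 rat by (intro exI[of _ "\<lambda>_. 0"]) (auto intro!: bexI[of _ "Const 1"])
qed

end

theorem corollary1p3:
  fixes scale :: "'k::{field, finite} \<Rightarrow> 'w::ab_group_add \<Rightarrow> 'w"
    and b :: "nat \<Rightarrow> 'w"
    and n m d :: nat
    and G :: "('w \<Rightarrow> 'w) set"
  assumes "vector_space scale"
    and "ordered_basis scale n b"
    and "G = carrier (GL scale) \<or> G = SL scale n b \<or> sylow_subgroup CHAR('k) (GL scale) G"
  shows "\<exists>F :: nat \<Rightarrow> 'k mpoly.
    (\<forall>i \<in> {1..(m + d) * n}. homogeneous (F i) \<and> F i \<in> poly_invariants scale n b m d G) \<and>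
    rat_invariants scale n b m d G =
      generated_field (to_fract ` F ` {1..(m + d) * n}) \<and>
    (\<exists>f \<in> poly_invariants scale n b m d G. f \<noteq> 0 \<and>
      adjoin_inverse (to_fract ` poly_invariants scale n b m d G) (to_fract f) =
      adjoin_inverse (generated_algebra (to_fract ` F ` {1..(m + d) * n})) (to_fract f))"
proof -
  interpret linear_invariants scale n b m d
    using assms(1,2) by (rule linear_invariants.intro)
  have "G \<subseteq> carrier (GL scale)"
    using assms(3) by (auto simp: SL_def sylow_subgroup_def dest: subgroup.mem_carrier)
  have "homogeneously_generated G"
  proof (cases "0 < m + d \<and> 0 < n")
    case True
    then have md: "0 < m + d" and n: "0 < n" by auto
    from assms(3) show ?thesis by (elim disjE) (rule GL_case[OF md n] SL_case[OF md n] Sylow_case[OF md n], assumption)+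
  next
    case False
    then show ?thesis using \<open>G \<subseteq> carrier (GL scale)\<close> by (intro no_variables_case) auto
  qed
  then show ?thesis unfolding homogeneously_generated_def .
qed

end
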